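(* Let $N\ge2$, $\Omega\subset\mathbb{R}^N$ a bounded domain, $F,Q$ as in the context, and $\tilde\lambda>0$. Assume $u_0\in W_0^{1,2}(\Omega)$ with $e^{u_0}\in L^1(\Omega)$ is a singular solution of $-Qu_0=\tilde\lambda e^{u_0}$ in $\Omega$, $u_0=0$ on $\partial\Omega$. Then for every $\lambda\in(0,\tilde\lambda)$ the problem $-Qu=\lambda e^u$ in $\Omega$, $u=0$ on $\partial\Omega$ has a minimal regular solution.
   Context: Standing assumptions on $F$: $F:\mathbb{R}^N\to[0,\infty)$ is convex, $F\in C^2(\mathbb{R}^N\setminus\{0\})$, $F(t\xi)=|t|F(\xi)$, $F(\xi)>0$ for $\xi\neq0$; $a|\xi|\le F(\xi)\le b|\xi|$ for constants $0<a\le b$; and $\mu^2|V|^2\le\sum_{i,j}F_{\xi_i\xi_j}(\xi)V_iV_j\le\Lambda|V|^2$ for all unit $\xi$ and all $V\perp\xi$. $Qu:=\sum_i\partial_{x_i}(F(\nabla u)F_{\xi_i}(\nabla u))$. Solutions are weak solutions $u\in W_0^{1,2}(\Omega)$ ($\int_\Omega F(\nabla u)F_\xi(\nabla u)\cdot\nabla\phi=\lambda\int_\Omega e^u\phi$ for all $\phi\in C_c^\infty(\Omega)$). A solution is regular if $e^u\in L^\infty(\Omega)$; a solution is called singular if $e^u\in L^1(\Omega)$. A solution $\underline u$ is minimal if $u\ge\underline u$ for every supersolution $u$ ($-Qu\ge\lambda e^u$ weakly in $\Omega$, $u\ge0$ on $\partial\Omega$). *)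

theory Defs
  imports "HOL-Analysis.Analysis"
begin

definition partial :: "'a::euclidean_space \<Rightarrow> ('a \<Rightarrow> real) \<Rightarrow> 'a \<Rightarrow> real" where
  "partial i f x = frechet_derivative f (at x) i"

definition cgrad :: "('a::euclidean_space \<Rightarrow> real) \<Rightarrow> 'a \<Rightarrow> 'a" where
  "cgrad f x = (\<Sum>i\<in>Basis. partial i f x *\<^sub>R i)"

fun C_on :: "nat \<Rightarrow> 'a::euclidean_space set \<Rightarrow> ('a \<Rightarrow> real) \<Rightarrow> bool" where
  "C_on 0 S f = continuous_on S f"
| "C_on (Suc k) S f = (continuous_on S f \<and> (\<forall>x\<in>S. f differentiable (at x)) \<and>
      (\<forall>i\<in>Basis. C_on k S (partial i f)))"

definition smooth_on :: "'a::euclidean_space set \<Rightarrow> ('a \<Rightarrow> real) \<Rightarrow> bool" where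
  "smooth_on S f \<longleftrightarrow> (\<forall>k. C_on k S f)"

definition test_fun :: "'a::euclidean_space set \<Rightarrow> ('a \<Rightarrow> real) \<Rightarrow> bool" where
  "test_fun \<Omega> \<phi> \<longleftrightarrow> smooth_on UNIV \<phi> \<and> compact (closure {x. \<phi> x \<noteq> 0})
      \<and> closure {x. \<phi> x \<noteq> 0} \<subseteq> \<Omega>"

definition L2_on :: "'a::euclidean_space set \<Rightarrow> ('a \<Rightarrow> real) \<Rightarrow> bool" where
  "L2_on \<Omega> u \<longleftrightarrow> set_borel_measurable lebesgue \<Omega> u \<and>
      set_integrable lebesgue \<Omega> (\<lambda>x. (u x)\<^sup>2)"

definition weak_gradient :: "'a::euclidean_space set \<Rightarrow> ('a \<Rightarrow> real) \<Rightarrow> ('a \<Rightarrow> 'a) \<Rightarrow> bool" where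
  "weak_gradient \<Omega> u g \<longleftrightarrow> set_borel_measurable lebesgue \<Omega> g \<and>
     (\<forall>\<phi>. test_fun \<Omega> \<phi> \<longrightarrow> (\<forall>i\<in>Basis.
        set_integrable lebesgue \<Omega> (\<lambda>x. u x * partial i \<phi> x) \<and>
        set_integrable lebesgue \<Omega> (\<lambda>x. (g x \<bullet> i) * \<phi> x) \<and>
        (LINT x:\<Omega>|lebesgue. u x * partial i \<phi> x) = - (LINT x:\<Omega>|lebesgue. (g x \<bullet> i) * \<phi> x)))"

definition W12 :: "'a::euclidean_space set \<Rightarrow> ('a \<Rightarrow> real) \<Rightarrow> bool" where
  "W12 \<Omega> u \<longleftrightarrow> L2_on \<Omega> u \<and>
     (\<exists>g. weak_gradient \<Omega> u g \<and> set_integrable lebesgue \<Omega> (\<lambda>x. (norm (g x))\<^sup>2))"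

definition W012 :: "'a::euclidean_space set \<Rightarrow> ('a \<Rightarrow> real) \<Rightarrow> bool" where
  "W012 \<Omega> u \<longleftrightarrow> W12 \<Omega> u \<and>
     (\<exists>g \<phi>s. weak_gradient \<Omega> u g \<and> (\<forall>k. test_fun \<Omega> (\<phi>s k)) \<and>
        (\<lambda>k. LINT x:\<Omega>|lebesgue. (u x - \<phi>s k x)\<^sup>2) \<longlonglongrightarrow> 0 \<and>
        (\<lambda>k. LINT x:\<Omega>|lebesgue. (norm (g x - cgrad (\<phi>s k) x))\<^sup>2) \<longlonglongrightarrow> 0)"

definition flux_term :: "('a::euclidean_space \<Rightarrow> real) \<Rightarrow> 'a \<Rightarrow> 'a \<Rightarrow> real" where
  "flux_term F \<xi> v = F \<xi> * (cgrad F \<xi> \<bullet> v)"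

definition weak_solution :: "('a::euclidean_space \<Rightarrow> real) \<Rightarrow> 'a set \<Rightarrow> real \<Rightarrow> ('a \<Rightarrow> real) \<Rightarrow> bool" where
  "weak_solution F \<Omega> lam u \<longleftrightarrow> W012 \<Omega> u \<and>
     (\<exists>g. weak_gradient \<Omega> u g \<and>
        (\<forall>\<phi>. test_fun \<Omega> \<phi> \<longrightarrow>
           set_integrable lebesgue \<Omega> (\<lambda>x. flux_term F (g x) (cgrad \<phi> x)) \<and>
           set_integrable lebesgue \<Omega> (\<lambda>x. exp (u x) * \<phi> x) \<and>
           (LINT x:\<Omega>|lebesgue. flux_term F (g x) (cgrad \<phi> x)) =
             lam * (LINT x:\<Omega>|lebesgue. exp (u x) * \<phi> x)))"

text \<open>Supersolution: -Qu >= lambda e^u weakly in Omega, u >= 0 on the boundary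
  (in the weak sense: u in W^{1,2}(Omega) and min(u,0) in W_0^{1,2}(Omega)).\<close>
definition supersolution :: "('a::euclidean_space \<Rightarrow> real) \<Rightarrow> 'a set \<Rightarrow> real \<Rightarrow> ('a \<Rightarrow> real) \<Rightarrow> bool" where
  "supersolution F \<Omega> lam u \<longleftrightarrow> W12 \<Omega> u \<and> W012 \<Omega> (\<lambda>x. min (u x) 0) \<and>
     (\<exists>g. weak_gradient \<Omega> u g \<and>
        (\<forall>\<phi>. test_fun \<Omega> \<phi> \<and> (\<forall>x. \<phi> x \<ge> 0) \<longrightarrow>
           set_integrable lebesgue \<Omega> (\<lambda>x. flux_term F (g x) (cgrad \<phi> x)) \<and>
           set_integrable lebesgue \<Omega> (\<lambda>x. exp (u x) * \<phi> x) \<and>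
           (LINT x:\<Omega>|lebesgue. flux_term F (g x) (cgrad \<phi> x)) \<ge>
             lam * (LINT x:\<Omega>|lebesgue. exp (u x) * \<phi> x)))"

definition regular_sol :: "'a::euclidean_space set \<Rightarrow> ('a \<Rightarrow> real) \<Rightarrow> bool" where
  "regular_sol \<Omega> u \<longleftrightarrow> (\<exists>C. AE x in lebesgue. x \<in> \<Omega> \<longrightarrow> exp (u x) \<le> C)"

definition singular_sol :: "'a::euclidean_space set \<Rightarrow> ('a \<Rightarrow> real) \<Rightarrow> bool" where
  "singular_sol \<Omega> u \<longleftrightarrow> set_integrable lebesgue \<Omega> (\<lambda>x. exp (u x))"

definition minimal_solution :: "('a::euclidean_space \<Rightarrow> real) \<Rightarrow> 'a set \<Rightarrow> real \<Rightarrow> ('a \<Rightarrow> real) \<Rightarrow> bool" where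
  "minimal_solution F \<Omega> lam u \<longleftrightarrow> weak_solution F \<Omega> lam u \<and>
     (\<forall>v. supersolution F \<Omega> lam v \<longrightarrow> (AE x in lebesgue. x \<in> \<Omega> \<longrightarrow> u x \<le> v x))"

end

theory Submission
  imports Defs
begin

text \<open>With \<open>\<theta> = \<lambda> / \<lambda>'\<close>, where \<open>\<lambda>'\<close> is the parameter of the given singular solution \<open>u\<^sub>0\<close>, the function
  \<open>\<Phi> s = - ln (1 - \<theta> + \<theta> * exp (- s))\<close> is concave, bounded above and satisfies
  \<open>\<lambda>' * exp s * \<Phi>' s = \<lambda> * exp (\<Phi> s)\<close>; hence \<open>\<Phi> \<circ> u\<^sub>0\<close> is a bounded supersolution for \<open>\<lambda>\<close>.
  Starting from \<open>0\<close>, solve \<open>- Q u\<^sub>n\<^sub>+\<^sub>1 = \<lambda> * exp u\<^sub>n\<close> with zero boundary values. By comparison the sequence increases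
  and stays below every supersolution, so it is bounded by \<open>\<Phi> \<circ> u\<^sub>0\<close>, and its limit is the minimal solution.
  The density \<open>F\<^sup>2 / 2\<close> is strongly convex. This gives strong convergence of minimising sequences and stability of
  the Dirichlet problem, so all limits are strong limits of test functions in \<open>L\<^sup>2\<close>.\<close>

section \<open>Square integrable functions\<close>

text \<open>The equation for \<open>u\<^sub>0\<close> may be tested only with smooth functions of
  compact support, whereas the supersolution property of \<open>\<Phi> \<circ> u\<^sub>0\<close>
  asks for a test function \<psi> times the derivative of \<Phi> at \<open>u\<^sub>0\<close>. The
  same product is therefore formed with test functions approximating \<open>u\<^sub>0\<close>: that
  derivative stays between 0 and 1, so \<open>exp u\<^sub>0\<close> times \<psi> dominates the
  right-hand sides although \<open>u\<^sub>0\<close> is unbounded. The flux passes through the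
  composition because F is homogeneous of degree 1, which makes the flux commute with positive
  factors; the sign of the second derivative of \<Phi> then gives the inequality. Minimality is
  claimed against every supersolution, and such a function is only of class W^{1,2} with a negative
  part vanishing on the boundary. Comparison with it needs cut-offs and mollification. F is not
  smooth at the origin, so strong convexity is proved separately for segments through 0. The limit
  of the iteration comes without a gradient. It is identified with the solution of the Dirichlet
  problem for the limiting right-hand side.\<close>

definition sqint :: "'m measure \<Rightarrow> ('m \<Rightarrow> 'b::euclidean_space) \<Rightarrow> bool" where
  "sqint M f \<longleftrightarrow> f \<in> borel_measurable M \<and> integrable M (\<lambda>x. (norm (f x))\<^sup>2)"

text \<open>Square integrability is part of the notion: the integral of a non-integrable function is
  0 by convention, so the limit alone would carry no information.\<close>

definition L2_lim :: "'m measure \<Rightarrow> (nat \<Rightarrow> 'm \<Rightarrow> 'b::euclidean_space) \<Rightarrow> ('m \<Rightarrow> 'b) \<Rightarrow> bool" where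
  "L2_lim M X f \<longleftrightarrow> (\<forall>n. sqint M (X n)) \<and> sqint M f \<and>
     (\<lambda>n. \<integral>x. (norm (X n x - f x))\<^sup>2 \<partial>M) \<longlonglongrightarrow> 0"

lemma sqint_measurable: "sqint M f \<Longrightarrow> f \<in> borel_measurable M"
  and sqint_integrable: "sqint M f \<Longrightarrow> integrable M (\<lambda>x. (norm (f x))\<^sup>2)"
  by (auto simp: sqint_def)

lemma norm_add_power2_le: "(norm (a + b :: 'b::real_normed_vector))\<^sup>2 \<le> 2 * (norm a)\<^sup>2 + 2 * (norm b)\<^sup>2"
proof -
  have "(norm (a + b))\<^sup>2 \<le> (norm a + norm b)\<^sup>2"
    by (intro power_mono norm_triangle_ineq) auto
  also have "\<dots> \<le> 2 * (norm a)\<^sup>2 + 2 * (norm b)\<^sup>2"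
    using zero_le_power2[of "norm a - norm b"] by (simp add: power2_eq_square algebra_simps)
  finally show ?thesis .
qed

lemma norm_diff_power2_le: "(norm (a - b :: 'b::real_normed_vector))\<^sup>2 \<le> 2 * (norm a)\<^sup>2 + 2 * (norm b)\<^sup>2"
  using norm_add_power2_le[of a "- b"] by simp

lemma norm_diff_power2_trans:
  "(norm (a - c :: 'b::real_normed_vector))\<^sup>2 \<le> 2 * (norm (a - b))\<^sup>2 + 2 * (norm (b - c))\<^sup>2"
  using norm_add_power2_le[of "a - b" "b - c"] by simp

lemma sqint_bound:
  assumes f: "f \<in> borel_measurable M" and g: "integrable M g"
    and le: "AE x in M. (norm (f x))\<^sup>2 \<le> g x"
  shows "sqint M f"
  unfolding sqint_def
proof (intro conjI f)
  show "integrable M (\<lambda>x. (norm (f x))\<^sup>2)"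
    by (rule Bochner_Integration.integrable_bound[OF g]) (use f le in auto)
qed

lemma sqint_zero [simp]: "sqint M (\<lambda>x. 0)"
  by (simp add: sqint_def)

lemma sqint_add:
  assumes "sqint M f" "sqint M g" shows "sqint M (\<lambda>x. f x + g x)"
  by (rule sqint_bound[where g = "\<lambda>x. 2 * (norm (f x))\<^sup>2 + 2 * (norm (g x))\<^sup>2"])
    (use assms norm_add_power2_le in \<open>auto simp: sqint_def\<close>)

lemma sqint_diff:
  assumes "sqint M f" "sqint M g" shows "sqint M (\<lambda>x. f x - g x)"
  by (rule sqint_bound[where g = "\<lambda>x. 2 * (norm (f x))\<^sup>2 + 2 * (norm (g x))\<^sup>2"])
    (use assms norm_diff_power2_le in \<open>auto simp: sqint_def\<close>)

lemma sqint_dominated: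
  assumes "sqint M g" "f \<in> borel_measurable M" "AE x in M. norm (f x) \<le> C * norm (g x)"
  shows "sqint M f"
proof (rule sqint_bound[where g = "\<lambda>x. C\<^sup>2 * (norm (g x))\<^sup>2"])
  show "AE x in M. (norm (f x))\<^sup>2 \<le> C\<^sup>2 * (norm (g x))\<^sup>2"
    using assms(3) by eventually_elim (metis norm_ge_zero power_mono power_mult_distrib)
qed (use assms in \<open>auto simp: sqint_def\<close>)

lemma sqint_scaleR:
  assumes "sqint M f" shows "sqint M (\<lambda>x. c *\<^sub>R f x)"
  by (rule sqint_dominated[OF assms, where C = "\<bar>c\<bar>"])
    (use assms in \<open>auto simp: sqint_def\<close>)

lemma sqint_uminus:
  assumes "sqint M f" shows "sqint M (\<lambda>x. - f x)"
  using sqint_scaleR[OF assms, of "-1"] by simp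

lemma sqint_bounded_scaleR:
  fixes c :: "'m \<Rightarrow> real"
  assumes "sqint M f" "c \<in> borel_measurable M" "AE x in M. \<bar>c x\<bar> \<le> C"
  shows "sqint M (\<lambda>x. c x *\<^sub>R f x)"
proof (rule sqint_dominated[OF assms(1), where C = C])
  show "AE x in M. norm (c x *\<^sub>R f x) \<le> C * norm (f x)"
    using assms(3) by eventually_elim (simp add: mult_right_mono)
qed (use assms in \<open>auto simp: sqint_def\<close>)

lemma sqint_cong_AE:
  assumes "sqint M f" "AE x in M. f x = g x" "g \<in> borel_measurable M"
  shows "sqint M g"
proof (rule sqint_dominated[OF assms(1) assms(3), where C = 1])
  show "AE x in M. norm (g x) \<le> 1 * norm (f x)"
    using assms(2) by eventually_elim simp
qed

text \<open>The norm of a pair is Euclidean, so squares add. A function and its gradient can thus be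
  treated as one square integrable map, and convergence in W^{1,2} as one
  \<open>L2_lim\<close>.\<close>

lemma sqint_Pair: "sqint M (\<lambda>x. (f x, g x)) \<longleftrightarrow> sqint M f \<and> sqint M g"
proof
  assume *: "sqint M (\<lambda>x. (f x, g x))"
  have m: "(\<lambda>x. fst (f x, g x)) \<in> borel_measurable M" "(\<lambda>x. snd (f x, g x)) \<in> borel_measurable M"
    using measurable_compose[OF sqint_measurable[OF *] borel_measurable_continuous_onI[OF continuous_on_fst[OF continuous_on_id]]]
      measurable_compose[OF sqint_measurable[OF *] borel_measurable_continuous_onI[OF continuous_on_snd[OF continuous_on_id]]]
    by auto
  show "sqint M f \<and> sqint M g"
    by (intro conjI; rule sqint_dominated[OF *, where C = 1])
      (use m in \<open>auto intro!: AE_I2 norm_fst_le norm_snd_le\<close>)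
next
  assume "sqint M f \<and> sqint M g"
  moreover from this have "(\<lambda>x. (f x, g x)) \<in> borel_measurable M"
    by (auto simp: sqint_def intro: borel_measurable_Pair)
  ultimately show "sqint M (\<lambda>x. (f x, g x))"
    by (auto simp: sqint_def norm_Pair)
qed

lemma sqint_inner_integrable:
  assumes "sqint M f" "sqint M g"
  shows "integrable M (\<lambda>x. f x \<bullet> g x)"
proof (rule Bochner_Integration.integrable_bound[where f = "\<lambda>x. (norm (f x))\<^sup>2 + (norm (g x))\<^sup>2"])
  show "AE x in M. norm (f x \<bullet> g x) \<le> norm ((norm (f x))\<^sup>2 + (norm (g x))\<^sup>2)"
  proof (rule AE_I2)
    fix x
    have "\<bar>f x \<bullet> g x\<bar> \<le> norm (f x) * norm (g x)" by (rule Cauchy_Schwarz_ineq2)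
    also have "\<dots> \<le> (norm (f x))\<^sup>2 + (norm (g x))\<^sup>2"
    proof -
      have "0 \<le> norm (f x) * norm (g x)" by simp
      then show ?thesis
        using sum_squares_bound[of "norm (f x)" "norm (g x)"] by linarith
    qed
    finally show "norm (f x \<bullet> g x) \<le> norm ((norm (f x))\<^sup>2 + (norm (g x))\<^sup>2)" by simp
  qed
qed (use assms in \<open>auto simp: sqint_def\<close>)

lemma sqint_mult_integrable:
  fixes f g :: "'m \<Rightarrow> real"
  assumes "sqint M f" "sqint M g"
  shows "integrable M (\<lambda>x. f x * g x)"
  using sqint_inner_integrable[OF assms] by simp

lemma sqint_inner_young:
  assumes f: "sqint M f" and g: "sqint M g" and t: "t > 0"
  shows "\<bar>\<integral>x. f x \<bullet> g x \<partial>M\<bar> \<le> t / 2 * (\<integral>x. (norm (f x))\<^sup>2 \<partial>M) + 1 / (2 * t) * (\<integral>x. (norm (g x))\<^sup>2 \<partial>M)"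
proof -
  have pt: "\<bar>f x \<bullet> g x\<bar> \<le> t / 2 * (norm (f x))\<^sup>2 + 1 / (2 * t) * (norm (g x))\<^sup>2" for x
  proof -
    have "\<bar>f x \<bullet> g x\<bar> \<le> norm (f x) * norm (g x)" by (rule Cauchy_Schwarz_ineq2)
    also have "\<dots> \<le> t / 2 * (norm (f x))\<^sup>2 + 1 / (2 * t) * (norm (g x))\<^sup>2"
      using zero_le_power2[of "t * norm (f x) - norm (g x)"] t
      by (simp add: field_simps power2_eq_square)
    finally show ?thesis .
  qed
  have "\<bar>\<integral>x. f x \<bullet> g x \<partial>M\<bar> \<le> (\<integral>x. \<bar>f x \<bullet> g x\<bar> \<partial>M)"
    using integral_norm_bound[of M "\<lambda>x. f x \<bullet> g x"] by simp
  also have "\<dots> \<le> (\<integral>x. t / 2 * (norm (f x))\<^sup>2 + 1 / (2 * t) * (norm (g x))\<^sup>2 \<partial>M)"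
    using f g pt sqint_inner_integrable[OF f g]
    by (intro integral_mono) (auto simp: sqint_def)
  also have "\<dots> = t / 2 * (\<integral>x. (norm (f x))\<^sup>2 \<partial>M) + 1 / (2 * t) * (\<integral>x. (norm (g x))\<^sup>2 \<partial>M)"
    using f g by (subst Bochner_Integration.integral_add) (auto simp: sqint_def)
  finally show ?thesis .
qed

text \<open>Young's inequality with the optimal weight \<open>sqrt (b / a)\<close>. The weight makes
  sense only for positive integrals, so e is added to both and then sent to 0.\<close>

lemma sqint_Cauchy_Schwarz:
  assumes f: "sqint M f" and g: "sqint M g"
  shows "(\<integral>x. f x \<bullet> g x \<partial>M)\<^sup>2 \<le> (\<integral>x. (norm (f x))\<^sup>2 \<partial>M) * (\<integral>x. (norm (g x))\<^sup>2 \<partial>M)"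
proof -
  define a b c where "a = (\<integral>x. (norm (f x))\<^sup>2 \<partial>M)" and "b = (\<integral>x. (norm (g x))\<^sup>2 \<partial>M)"
    and "c = (\<integral>x. f x \<bullet> g x \<partial>M)"
  have ab: "0 \<le> a" "0 \<le> b" by (auto simp: a_def b_def)
  have young: "\<bar>c\<bar> \<le> t / 2 * a + 1 / (2 * t) * b" if "t > 0" for t
    using sqint_inner_young[OF f g that] by (simp add: a_def b_def c_def)
  have "\<bar>c\<bar> \<le> sqrt ((a + e) * (b + e))" if e: "e > 0" for e
  proof -
    define t where "t = sqrt ((b + e) / (a + e))"
    have t: "t > 0" using ab e by (simp add: t_def)
    have "t\<^sup>2 = (b + e) / (a + e)" using ab e by (simp add: t_def)
    then have be: "b + e = t\<^sup>2 * (a + e)" using ab e by simp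
    have "\<bar>c\<bar> \<le> t / 2 * (a + e) + 1 / (2 * t) * (b + e)"
      using young[OF t] t e by (smt (verit) divide_pos_pos mult_left_mono zero_less_mult_iff)
    also have "\<dots> = t * (a + e)"
      using t by (simp add: be power2_eq_square)
    also have "\<dots> = sqrt ((a + e) * (b + e))"
      using ab e t by (intro real_sqrt_unique[symmetric]) (auto simp: be power2_eq_square)
    finally show ?thesis .
  qed
  then have "\<forall>\<^sub>F e in at_right 0. \<bar>c\<bar> \<le> sqrt ((a + e) * (b + e))"
    by (auto simp: eventually_at_filter)
  moreover have "((\<lambda>e. sqrt ((a + e) * (b + e))) \<longlongrightarrow> sqrt ((a + 0) * (b + 0))) (at_right 0)"
    by (intro tendsto_intros)
  ultimately have "\<bar>c\<bar> \<le> sqrt (a * b)"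
    using tendsto_lowerbound[of _ _ "at_right (0::real)"] by simp
  then have "c\<^sup>2 \<le> a * b"
    using ab by (metis abs_ge_zero mult_nonneg_nonneg power2_abs power_mono real_sqrt_pow2)
  then show ?thesis by (simp add: a_def b_def c_def)
qed

lemma sqint_norm_diff_trans:
  assumes "sqint M f" "sqint M g" "sqint M h"
  shows "(\<integral>x. (norm (f x - h x))\<^sup>2 \<partial>M) \<le> 2 * (\<integral>x. (norm (f x - g x))\<^sup>2 \<partial>M) + 2 * (\<integral>x. (norm (g x - h x))\<^sup>2 \<partial>M)"
proof -
  have "(\<integral>x. (norm (f x - h x))\<^sup>2 \<partial>M) \<le> (\<integral>x. 2 * (norm (f x - g x))\<^sup>2 + 2 * (norm (g x - h x))\<^sup>2 \<partial>M)"
    using assms by (intro integral_mono)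
      (auto intro!: sqint_integrable sqint_diff norm_diff_power2_trans)
  also have "\<dots> = 2 * (\<integral>x. (norm (f x - g x))\<^sup>2 \<partial>M) + 2 * (\<integral>x. (norm (g x - h x))\<^sup>2 \<partial>M)"
    using assms by (subst Bochner_Integration.integral_add) (auto intro!: sqint_integrable sqint_diff)
  finally show ?thesis .
qed

lemma sqint_eq_0_AE:
  assumes f: "sqint M f" and "(\<integral>x. (norm (f x))\<^sup>2 \<partial>M) \<le> 0"
  shows "AE x in M. f x = 0"
proof -
  have "(\<integral>x. (norm (f x))\<^sup>2 \<partial>M) = 0"
    using assms(2) by (simp add: order_antisym)
  then have "AE x in M. (norm (f x))\<^sup>2 = 0"
    using integral_nonneg_eq_0_iff_AE[OF sqint_integrable[OF f]] by auto
  then show ?thesis by eventually_elim simp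
qed

lemma sqint_finite_bounded:
  assumes "finite_measure M" "f \<in> borel_measurable M" "AE x in M. norm (f x) \<le> C"
  shows "sqint M f"
proof (rule sqint_bound[OF assms(2), where g = "\<lambda>x. C\<^sup>2"])
  show "AE x in M. (norm (f x))\<^sup>2 \<le> C\<^sup>2"
    using assms(3) by eventually_elim (simp add: power_mono)
qed (use assms(1) in \<open>simp add: finite_measure.integrable_const\<close>)

lemma sqint_finite_integrable:
  fixes f :: "'m \<Rightarrow> 'b::euclidean_space"
  assumes "finite_measure M" "sqint M f"
  shows "integrable M f"
proof (rule Bochner_Integration.integrable_bound[where f = "\<lambda>x. 1 + (norm (f x))\<^sup>2"])
  show "AE x in M. norm (f x) \<le> norm (1 + (norm (f x))\<^sup>2)"
  proof (rule AE_I2)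
    fix x have "norm (f x) \<le> 1 + (norm (f x))\<^sup>2"
      using sum_squares_bound[of 1 "norm (f x)"] norm_ge_zero[of "f x"] by (simp; linarith)
    then show "norm (f x) \<le> norm (1 + (norm (f x))\<^sup>2)" by simp
  qed
qed (use assms in \<open>auto simp: sqint_def finite_measure.integrable_const\<close>)

section \<open>Strong convergence in L2\<close>

lemma L2_limI:
  assumes "\<And>n. sqint M (X n)" "sqint M f" "(\<lambda>n. \<integral>x. (norm (X n x - f x))\<^sup>2 \<partial>M) \<longlonglongrightarrow> 0"
  shows "L2_lim M X f"
  using assms by (auto simp: L2_lim_def)

lemma L2_lim_sqint: "L2_lim M X f \<Longrightarrow> sqint M (X n)" "L2_lim M X f \<Longrightarrow> sqint M f"
  and L2_lim_tendsto: "L2_lim M X f \<Longrightarrow> (\<lambda>n. \<integral>x. (norm (X n x - f x))\<^sup>2 \<partial>M) \<longlonglongrightarrow> 0"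
  by (auto simp: L2_lim_def)

lemma L2_lim_squeeze:
  assumes "\<And>n. sqint M (X n)" "sqint M f" "e \<longlonglongrightarrow> 0"
    and "\<And>n. (\<integral>x. (norm (X n x - f x))\<^sup>2 \<partial>M) \<le> e n"
  shows "L2_lim M X f"
proof (rule L2_limI[OF assms(1,2)])
  show "(\<lambda>n. \<integral>x. (norm (X n x - f x))\<^sup>2 \<partial>M) \<longlonglongrightarrow> 0"
    by (rule tendsto_sandwich[OF _ _ tendsto_const assms(3)]) (use assms(4) in auto)
qed

lemma L2_lim_const: "sqint M f \<Longrightarrow> L2_lim M (\<lambda>n. f) f"
  by (auto simp: L2_lim_def)

lemma L2_lim_subseq: "L2_lim M X f \<Longrightarrow> strict_mono r \<Longrightarrow> L2_lim M (\<lambda>n. X (r n)) f"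
  unfolding L2_lim_def using LIMSEQ_subseq_LIMSEQ[of "\<lambda>n. \<integral>x. (norm (X n x - f x))\<^sup>2 \<partial>M" 0 r]
  by (auto simp: o_def)

lemma L2_lim_add:
  assumes X: "L2_lim M X f" and Y: "L2_lim M Y g"
  shows "L2_lim M (\<lambda>n x. X n x + Y n x) (\<lambda>x. f x + g x)"
proof (rule L2_lim_squeeze)
  show "(\<lambda>n. 2 * (\<integral>x. (norm (X n x - f x))\<^sup>2 \<partial>M) + 2 * (\<integral>x. (norm (Y n x - g x))\<^sup>2 \<partial>M)) \<longlonglongrightarrow> 0"
    using tendsto_add[OF tendsto_mult_left[OF L2_lim_tendsto[OF X]] tendsto_mult_left[OF L2_lim_tendsto[OF Y]], of 2 2]
    by simp
  fix n
  have "(\<integral>x. (norm (X n x + Y n x - (f x + g x)))\<^sup>2 \<partial>M) \<le>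
     (\<integral>x. 2 * (norm (X n x - f x))\<^sup>2 + 2 * (norm (Y n x - g x))\<^sup>2 \<partial>M)"
  proof (rule integral_mono)
    show "(norm (X n x + Y n x - (f x + g x)))\<^sup>2 \<le> 2 * (norm (X n x - f x))\<^sup>2 + 2 * (norm (Y n x - g x))\<^sup>2" for x
      using norm_add_power2_le[of "X n x - f x" "Y n x - g x"] by (simp add: algebra_simps)
  qed (use X Y in \<open>auto intro!: sqint_integrable sqint_diff sqint_add Bochner_Integration.integrable_add integrable_mult_right simp: L2_lim_def\<close>)
  also have "\<dots> = 2 * (\<integral>x. (norm (X n x - f x))\<^sup>2 \<partial>M) + 2 * (\<integral>x. (norm (Y n x - g x))\<^sup>2 \<partial>M)"
    using X Y by (subst Bochner_Integration.integral_add) (auto intro!: sqint_integrable sqint_diff simp: L2_lim_def)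
  finally show "(\<integral>x. (norm (X n x + Y n x - (f x + g x)))\<^sup>2 \<partial>M) \<le> \<dots>" .
qed (use X Y in \<open>auto intro!: sqint_add simp: L2_lim_def\<close>)

lemma L2_lim_dominated:
  assumes X: "L2_lim M X f" and Y: "\<And>n. sqint M (Y n)" "sqint M g"
    and le: "\<And>n. AE x in M. norm (Y n x - g x) \<le> C * norm (X n x - f x)"
  shows "L2_lim M Y g"
proof (rule L2_lim_squeeze[OF Y])
  show "(\<lambda>n. C\<^sup>2 * (\<integral>x. (norm (X n x - f x))\<^sup>2 \<partial>M)) \<longlonglongrightarrow> 0"
    using tendsto_mult_left[OF L2_lim_tendsto[OF X], of "C\<^sup>2"] by simp
  fix n
  have "(\<integral>x. (norm (Y n x - g x))\<^sup>2 \<partial>M) \<le> (\<integral>x. C\<^sup>2 * (norm (X n x - f x))\<^sup>2 \<partial>M)"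
  proof (rule integral_mono_AE)
    show "AE x in M. (norm (Y n x - g x))\<^sup>2 \<le> C\<^sup>2 * (norm (X n x - f x))\<^sup>2"
      using le[of n] by eventually_elim (metis norm_ge_zero power_mono power_mult_distrib)
  qed (use X Y in \<open>auto intro!: sqint_integrable sqint_diff simp: L2_lim_def\<close>)
  then show "(\<integral>x. (norm (Y n x - g x))\<^sup>2 \<partial>M) \<le> C\<^sup>2 * (\<integral>x. (norm (X n x - f x))\<^sup>2 \<partial>M)" by simp
qed

lemma L2_lim_scaleR:
  assumes "L2_lim M X f" shows "L2_lim M (\<lambda>n x. c *\<^sub>R X n x) (\<lambda>x. c *\<^sub>R f x)"
  by (rule L2_lim_dominated[OF assms, where C = "\<bar>c\<bar>"])
    (use assms in \<open>auto intro!: sqint_scaleR simp: L2_lim_def simp flip: scaleR_diff_right\<close>)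

lemma L2_lim_diff:
  assumes "L2_lim M X f" "L2_lim M Y g"
  shows "L2_lim M (\<lambda>n x. X n x - Y n x) (\<lambda>x. f x - g x)"
  using L2_lim_add[OF assms(1) L2_lim_scaleR[OF assms(2), of "-1"]] by simp

lemma L2_lim_Pair:
  "L2_lim M (\<lambda>n x. (X n x, Y n x)) (\<lambda>x. (f x, g x)) \<longleftrightarrow> L2_lim M X f \<and> L2_lim M Y g"
proof
  assume *: "L2_lim M (\<lambda>n x. (X n x, Y n x)) (\<lambda>x. (f x, g x))"
  then have "\<And>n. sqint M (X n)" "\<And>n. sqint M (Y n)" "sqint M f" "sqint M g"
    by (auto simp: L2_lim_def sqint_Pair)
  then show "L2_lim M X f \<and> L2_lim M Y g"
    by (intro conjI; intro L2_lim_dominated[OF *, where C = 1]) (auto intro!: AE_I2 norm_fst_le norm_snd_le)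
next
  assume *: "L2_lim M X f \<and> L2_lim M Y g"
  then have s: "\<And>n. sqint M (X n)" "\<And>n. sqint M (Y n)" "sqint M f" "sqint M g"
    by (auto simp: L2_lim_def)
  have "(\<lambda>n. (\<integral>x. (norm (X n x - f x))\<^sup>2 \<partial>M) + (\<integral>x. (norm (Y n x - g x))\<^sup>2 \<partial>M)) \<longlonglongrightarrow> 0"
    using * tendsto_add[of "\<lambda>n. \<integral>x. (norm (X n x - f x))\<^sup>2 \<partial>M" 0 _ "\<lambda>n. \<integral>x. (norm (Y n x - g x))\<^sup>2 \<partial>M" 0]
    by (auto simp: L2_lim_def)
  moreover have "(\<integral>x. (norm ((X n x, Y n x) - (f x, g x)))\<^sup>2 \<partial>M) =
      (\<integral>x. (norm (X n x - f x))\<^sup>2 \<partial>M) + (\<integral>x. (norm (Y n x - g x))\<^sup>2 \<partial>M)" for n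
    using s by (subst Bochner_Integration.integral_add[symmetric])
      (auto intro!: sqint_integrable sqint_diff simp: norm_Pair)
  ultimately show "L2_lim M (\<lambda>n x. (X n x, Y n x)) (\<lambda>x. (f x, g x))"
    using s by (auto simp: L2_lim_def sqint_Pair)
qed

lemma L2_lim_inner_right:
  assumes X: "L2_lim M X f" and g: "sqint M g"
  shows "(\<lambda>n. \<integral>x. g x \<bullet> X n x \<partial>M) \<longlonglongrightarrow> (\<integral>x. g x \<bullet> f x \<partial>M)"
proof -
  have s: "sqint M (\<lambda>x. X n x - f x)" for n
    using X by (auto intro!: sqint_diff simp: L2_lim_def)
  have "(\<lambda>n. (\<integral>x. g x \<bullet> (X n x - f x) \<partial>M)\<^sup>2) \<longlonglongrightarrow> 0"
  proof (rule tendsto_sandwich[where f = "\<lambda>_. 0"])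
    show "(\<lambda>n. (\<integral>x. (norm (g x))\<^sup>2 \<partial>M) * (\<integral>x. (norm (X n x - f x))\<^sup>2 \<partial>M)) \<longlonglongrightarrow> 0"
      using tendsto_mult_left[OF L2_lim_tendsto[OF X]] by force
  qed (use sqint_Cauchy_Schwarz[OF g s] in auto)
  then have "(\<lambda>n. \<integral>x. g x \<bullet> (X n x - f x) \<partial>M) \<longlonglongrightarrow> 0"
    by simp
  moreover have "(\<integral>x. g x \<bullet> (X n x - f x) \<partial>M) = (\<integral>x. g x \<bullet> X n x \<partial>M) - (\<integral>x. g x \<bullet> f x \<partial>M)" for n
    using X g by (subst Bochner_Integration.integral_diff[symmetric])
      (auto intro!: sqint_inner_integrable simp: L2_lim_def inner_diff_right)
  ultimately show ?thesis
    by (simp add: LIM_zero_iff)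
qed

lemma L2_lim_norm_power2:
  assumes X: "L2_lim M X f"
  shows "(\<lambda>n. \<integral>x. (norm (X n x))\<^sup>2 \<partial>M) \<longlonglongrightarrow> (\<integral>x. (norm (f x))\<^sup>2 \<partial>M)"
proof -
  have s: "sqint M (X n)" "sqint M f" for n using X by (auto simp: L2_lim_def)
  have eq: "(\<integral>x. (norm (X n x))\<^sup>2 \<partial>M) = (\<integral>x. (norm (X n x - f x))\<^sup>2 \<partial>M)
      + 2 * (\<integral>x. f x \<bullet> X n x \<partial>M) - (\<integral>x. (norm (f x))\<^sup>2 \<partial>M)" for n
  proof -
    have "(norm (X n x))\<^sup>2 = (norm (X n x - f x))\<^sup>2 + 2 * (f x \<bullet> X n x) - (norm (f x))\<^sup>2" for x
      by (simp add: power2_norm_eq_inner inner_diff inner_commute algebra_simps)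
    then have "(\<integral>x. (norm (X n x))\<^sup>2 \<partial>M) = (\<integral>x. (norm (X n x - f x))\<^sup>2 + 2 * (f x \<bullet> X n x) - (norm (f x))\<^sup>2 \<partial>M)"
      by presburger
    also have "\<dots> = (\<integral>x. (norm (X n x - f x))\<^sup>2 \<partial>M) + 2 * (\<integral>x. f x \<bullet> X n x \<partial>M) - (\<integral>x. (norm (f x))\<^sup>2 \<partial>M)"
      using s by (subst Bochner_Integration.integral_diff)
        (auto intro!: sqint_integrable sqint_diff sqint_inner_integrable simp: Bochner_Integration.integral_add[OF sqint_integrable[OF sqint_diff]] sqint_inner_integrable)
    finally show ?thesis .
  qed
  have "(\<lambda>n. (\<integral>x. (norm (X n x - f x))\<^sup>2 \<partial>M) + 2 * (\<integral>x. f x \<bullet> X n x \<partial>M) - (\<integral>x. (norm (f x))\<^sup>2 \<partial>M))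
     \<longlonglongrightarrow> 0 + 2 * (\<integral>x. f x \<bullet> f x \<partial>M) - (\<integral>x. (norm (f x))\<^sup>2 \<partial>M)"
    by (intro tendsto_intros L2_lim_tendsto[OF X] L2_lim_inner_right[OF X] s)
  then show ?thesis
    unfolding eq by (simp add: power2_norm_eq_inner)
qed

text \<open>Polarisation reduces the claim to the convergence of the norms of sums and
  differences.\<close>

lemma L2_lim_inner:
  assumes X: "L2_lim M X f" and Y: "L2_lim M Y g"
  shows "(\<lambda>n. \<integral>x. X n x \<bullet> Y n x \<partial>M) \<longlonglongrightarrow> (\<integral>x. f x \<bullet> g x \<partial>M)"
proof -
  have s: "sqint M (X n)" "sqint M f" "sqint M (Y n)" "sqint M g" for n
    using X Y by (auto simp: L2_lim_def)
  have pol: "(\<integral>x. u x \<bullet> v x \<partial>M) =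
     ((\<integral>x. (norm (u x + v x))\<^sup>2 \<partial>M) - (\<integral>x. (norm (u x - v x))\<^sup>2 \<partial>M)) / 4"
    if "sqint M u" "sqint M v" for u v :: "'a \<Rightarrow> 'b"
  proof -
    have "(norm (u x + v x))\<^sup>2 - (norm (u x - v x))\<^sup>2 = 4 * (u x \<bullet> v x)" for x
      by (simp add: power2_norm_eq_inner inner_diff inner_add inner_commute algebra_simps)
    then show ?thesis
      using that by (subst Bochner_Integration.integral_diff[symmetric])
        (auto intro!: sqint_integrable sqint_add sqint_diff)
  qed
  show ?thesis
    unfolding pol[OF s(1,3)] pol[OF s(2,4)]
    by (intro tendsto_intros L2_lim_norm_power2 L2_lim_add L2_lim_diff X Y) simp
qed

lemma L2_lim_unique_AE:
  assumes X: "L2_lim M X f" and Y: "L2_lim M X g"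
  shows "AE x in M. f x = g x"
proof -
  have "(\<lambda>n::nat. 0) \<longlonglongrightarrow> (\<integral>x. (norm (f x - g x))\<^sup>2 \<partial>M)"
    using L2_lim_norm_power2[OF L2_lim_diff[OF X Y]] by simp
  from LIMSEQ_unique[OF this tendsto_const] have "(\<integral>x. (norm (f x - g x))\<^sup>2 \<partial>M) \<le> 0"
    by linarith
  then have "AE x in M. f x - g x = 0"
    using X Y by (intro sqint_eq_0_AE sqint_diff) (auto simp: L2_lim_def)
  then show ?thesis by simp
qed

lemma L2_lim_cong_AE:
  assumes "L2_lim M X f" "AE x in M. f x = g x" "g \<in> borel_measurable M"
  shows "L2_lim M X g"
proof -
  have g: "sqint M g" using sqint_cong_AE[OF _ assms(2,3)] assms(1) by (auto simp: L2_lim_def)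
  show ?thesis
  proof (rule L2_lim_dominated[OF assms(1) _ g, where C = 1])
    show "AE x in M. norm (X n x - g x) \<le> 1 * norm (X n x - f x)" for n
      using assms(2) by eventually_elim simp
  qed (use assms in \<open>auto intro: simp: L2_lim_def\<close>)
qed

lemma L2_lim_AE_subseq:
  assumes X: "L2_lim M X f"
  obtains r :: "nat \<Rightarrow> nat" where "strict_mono r" "AE x in M. (\<lambda>n. X (r n) x) \<longlonglongrightarrow> f x"
proof -
  have "\<exists>r::nat\<Rightarrow>nat. strict_mono r \<and> (AE x in M. (\<lambda>n. (norm (X (r n) x - f x))\<^sup>2) \<longlonglongrightarrow> 0)"
    by (rule tendsto_L1_AE_subseq)
      (use X in \<open>auto intro!: sqint_integrable sqint_diff simp: L2_lim_def L2_lim_tendsto\<close>)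
  then obtain r where r: "strict_mono r" "AE x in M. (\<lambda>n. (norm (X (r n) x - f x))\<^sup>2) \<longlonglongrightarrow> 0"
    by auto
  from r(2) have "AE x in M. (\<lambda>n. X (r n) x) \<longlonglongrightarrow> f x"
    by eventually_elim (simp add: tendsto_norm_zero_iff LIM_zero_iff)
  then show thesis using r(1) that by blast
qed

lemma L2_lim_pointwise_dominated:
  assumes m: "\<And>n. X n \<in> borel_measurable M" "f \<in> borel_measurable M" and g: "integrable M g"
    and lim: "AE x in M. (\<lambda>n. X n x) \<longlonglongrightarrow> f x"
    and le: "\<And>n. AE x in M. (norm (X n x))\<^sup>2 \<le> g x" "AE x in M. (norm (f x))\<^sup>2 \<le> g x"
  shows "L2_lim M X f"
proof (rule L2_limI)
  show s: "sqint M (X n)" "sqint M f" for n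
    using sqint_bound m g le by blast+
  have "(\<lambda>n. \<integral>x. (norm (X n x - f x))\<^sup>2 \<partial>M) \<longlonglongrightarrow> (\<integral>x. 0 \<partial>M)"
  proof (rule integral_dominated_convergence[where w = "\<lambda>x. 4 * g x"])
    show "AE x in M. (\<lambda>n. (norm (X n x - f x))\<^sup>2) \<longlonglongrightarrow> 0"
      using lim
    proof eventually_elim
      case (elim x)
      have "(\<lambda>n. (norm (X n x - f x))\<^sup>2) \<longlonglongrightarrow> (norm (f x - f x))\<^sup>2"
        by (intro tendsto_intros elim)
      then show ?case by simp
    qed
    show "AE x in M. norm ((norm (X n x - f x))\<^sup>2) \<le> 4 * g x" for n
      using le(1)[of n] le(2)
    proof eventually_elim
      case (elim x)
      then show ?case using norm_diff_power2_le[of "X n x" "f x"] by simp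
    qed
  qed (use g m s in \<open>auto\<close>)
  then show "(\<lambda>n. \<integral>x. (norm (X n x - f x))\<^sup>2 \<partial>M) \<longlonglongrightarrow> 0" by simp
qed

text \<open>Continuity of superposition operators of linear growth. No single function dominates
  \<open>X n\<close>, so dominated convergence is applied to the excess \<open>G\<close> of the
  squared difference \<open>D\<close> over \<open>4 * C * E\<close>, where \<open>E\<close> is the
  squared error of the arguments: the growth bound leaves
  \<open>C * (6 * (norm (f x))\<^sup>2 + 4)\<close> as a majorant, and the part subtracted tends to
  0 in the mean. Pointwise convergence is available only along a subsequence.\<close>

lemma L2_lim_superposition:
  fixes B :: "'m \<Rightarrow> 'b::euclidean_space \<Rightarrow> 'c::euclidean_space"
  assumes X: "L2_lim M X f" and fin: "finite_measure M"
    and meas: "\<And>h. h \<in> borel_measurable M \<Longrightarrow> (\<lambda>x. B x (h x)) \<in> borel_measurable M"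
    and cont: "\<And>x y. x \<in> space M \<Longrightarrow> isCont (B x) y"
    and le: "\<And>x y. x \<in> space M \<Longrightarrow> (norm (B x y))\<^sup>2 \<le> C * ((norm y)\<^sup>2 + 1)"
  obtains r :: "nat \<Rightarrow> nat" where "strict_mono r" "AE x in M. (\<lambda>n. X (r n) x) \<longlonglongrightarrow> f x"
    "L2_lim M (\<lambda>n x. B x (X (r n) x)) (\<lambda>x. B x (f x))"
proof -
  obtain r :: "nat \<Rightarrow> nat" where r: "strict_mono r" "AE x in M. (\<lambda>n. X (r n) x) \<longlonglongrightarrow> f x"
    using L2_lim_AE_subseq[OF X] by blast
  note Xr = L2_lim_subseq[OF X r(1)]
  have C0: "0 \<le> C" if "x \<in> space M" for x
    using le[OF that, of 0] by (simp add: order_trans[OF zero_le_power2])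
  have s: "sqint M (X (r n))" "sqint M f" for n using Xr by (auto simp: L2_lim_def)
  have sB: "sqint M (\<lambda>x. B x (h x))" if "sqint M h" for h
    by (rule sqint_bound[where g = "\<lambda>x. C * ((norm (h x))\<^sup>2 + 1)"])
      (use that meas le fin in \<open>auto simp: sqint_def finite_measure.integrable_const\<close>)
  define D where "D n x = (norm (B x (X (r n) x) - B x (f x)))\<^sup>2" for n x
  define E where "E n x = (norm (X (r n) x - f x))\<^sup>2" for n x
  define G where "G n x = max 0 (D n x - 4 * C * E n x)" for n x
  have intE: "integrable M (E n)" and intD: "integrable M (D n)" for n
    unfolding E_def[abs_def] D_def[abs_def] by (intro sqint_integrable sqint_diff s sB)+
  have intG: "integrable M (G n)" for n
    unfolding G_def[abs_def] using intE intD by (auto intro!: integrable_max)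
  have "(\<lambda>n. \<integral>x. G n x \<partial>M) \<longlonglongrightarrow> (\<integral>x. 0 \<partial>M)"
  proof (rule integral_dominated_convergence[where w = "\<lambda>x. C * (6 * (norm (f x))\<^sup>2 + 4)"])
    show "integrable M (\<lambda>x. C * (6 * (norm (f x))\<^sup>2 + 4))"
      using s fin by (auto simp: sqint_def finite_measure.integrable_const)
    show "AE x in M. (\<lambda>n. G n x) \<longlonglongrightarrow> 0"
      using r(2) AE_space
    proof eventually_elim
      case (elim x)
      have "(\<lambda>n. B x (X (r n) x)) \<longlonglongrightarrow> B x (f x)"
        by (rule isCont_tendsto_compose[OF cont[OF elim(2)] elim(1)])
      then have "(\<lambda>n. G n x) \<longlonglongrightarrow> max 0 ((norm (B x (f x) - B x (f x)))\<^sup>2 - 4 * C * (norm (f x - f x))\<^sup>2)"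
        unfolding G_def D_def E_def by (intro tendsto_intros elim(1))
      then show ?case by simp
    qed
    show "AE x in M. norm (G n x) \<le> C * (6 * (norm (f x))\<^sup>2 + 4)" for n
    proof (rule AE_I2)
      fix x assume x: "x \<in> space M"
      have "D n x \<le> 2 * (norm (B x (X (r n) x)))\<^sup>2 + 2 * (norm (B x (f x)))\<^sup>2"
        unfolding D_def by (rule norm_diff_power2_le)
      also have "\<dots> \<le> 2 * (C * ((norm (X (r n) x))\<^sup>2 + 1)) + 2 * (C * ((norm (f x))\<^sup>2 + 1))"
        using le[OF x] by (intro add_mono mult_left_mono) auto
      also have "\<dots> \<le> 2 * (C * ((2 * E n x + 2 * (norm (f x))\<^sup>2) + 1)) + 2 * (C * ((norm (f x))\<^sup>2 + 1))"
        using norm_add_power2_le[of "X (r n) x - f x" "f x"] C0[OF x]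
        by (intro add_mono mult_left_mono) (auto simp: E_def)
      finally have "D n x - 4 * C * E n x \<le> C * (6 * (norm (f x))\<^sup>2 + 4)"
        by (simp add: algebra_simps)
      then show "norm (G n x) \<le> C * (6 * (norm (f x))\<^sup>2 + 4)"
        using C0[OF x] by (simp add: G_def)
    qed
  qed (use intG in auto)
  then have Glim: "(\<lambda>n. \<integral>x. G n x \<partial>M) \<longlonglongrightarrow> 0" by simp
  have "L2_lim M (\<lambda>n x. B x (X (r n) x)) (\<lambda>x. B x (f x))"
  proof (rule L2_lim_squeeze[OF sB[OF s(1)] sB[OF s(2)]])
    have "(\<lambda>n. \<integral>x. E n x \<partial>M) \<longlonglongrightarrow> 0"
      using L2_lim_tendsto[OF Xr] by (simp add: E_def)
    then show "(\<lambda>n. (\<integral>x. G n x \<partial>M) + 4 * C * (\<integral>x. E n x \<partial>M)) \<longlonglongrightarrow> 0"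
      using tendsto_add[OF Glim tendsto_mult_left[of "\<lambda>n. \<integral>x. E n x \<partial>M" 0 _ "4 * C"]] by simp
    fix n
    have "(\<integral>x. D n x \<partial>M) \<le> (\<integral>x. G n x + 4 * C * E n x \<partial>M)"
      using intD intG intE by (intro integral_mono) (auto simp: G_def)
    also have "\<dots> = (\<integral>x. G n x \<partial>M) + 4 * C * (\<integral>x. E n x \<partial>M)"
      using intG intE by (subst Bochner_Integration.integral_add) auto
    finally show "(\<integral>x. (norm (B x (X (r n) x) - B x (f x)))\<^sup>2 \<partial>M) \<le> (\<integral>x. G n x \<partial>M) + 4 * C * (\<integral>x. E n x \<partial>M)"
      unfolding D_def .
  qed
  with r show thesis using that by blast
qed

text \<open>The Riesz-Fischer argument: a subsequence with quickly decaying increments converges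
  almost everywhere. The increments are summed in L1, which is where finiteness of the measure
  enters.\<close>

lemma L2_complete:
  fixes X :: "nat \<Rightarrow> 'm \<Rightarrow> 'b::euclidean_space"
  assumes fin: "finite_measure M" and s: "\<And>n. sqint M (X n)"
    and Cauchy: "\<And>e. e > 0 \<Longrightarrow> \<exists>N. \<forall>m\<ge>N. \<forall>n\<ge>N. (\<integral>x. (norm (X m x - X n x))\<^sup>2 \<partial>M) \<le> e"
  obtains f where "L2_lim M X f"
proof -
  interpret finite_measure M by fact
  have "\<exists>r::nat \<Rightarrow> nat. strict_mono r \<and>
    (\<forall>k. \<forall>m\<ge>r k. \<forall>n\<ge>r k. (\<integral>x. (norm (X m x - X n x))\<^sup>2 \<partial>M) \<le> (1/4)^k)"
  proof -
    define P where "P k N \<longleftrightarrow> (\<forall>m\<ge>N. \<forall>n\<ge>N. (\<integral>x. (norm (X m x - X n x))\<^sup>2 \<partial>M) \<le> (1/4)^k)" for k and N :: nat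
    have mono: "P k N \<Longrightarrow> N \<le> N' \<Longrightarrow> P k N'" for k N N' unfolding P_def by fastforce
    have ex: "\<exists>N. P k N" for k unfolding P_def by (rule Cauchy) simp
    have step: "\<exists>N'. P (Suc k) N' \<and> N < N'" for k N
    proof -
      obtain N0 where "P (Suc k) N0" using ex by blast
      then have "P (Suc k) (max N0 (Suc N))" by (rule mono) simp
      then show ?thesis by (intro exI[of _ "max N0 (Suc N)"]) auto
    qed
    obtain r where r: "\<And>k. P k (r k)" "\<And>k. r k < r (Suc k)"
      using dependent_nat_choice[of P "\<lambda>_ N N'. N < N'"] ex step by blast
    then show ?thesis
      by (intro exI[of _ r]) (auto simp: strict_mono_Suc_iff P_def)
  qed
  then obtain r :: "nat \<Rightarrow> nat" where r: "strict_mono r"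
    and rC: "\<And>k m n. m \<ge> r k \<Longrightarrow> n \<ge> r k \<Longrightarrow> (\<integral>x. (norm (X m x - X n x))\<^sup>2 \<partial>M) \<le> (1/4)^k" by blast
  have meas[measurable]: "X n \<in> borel_measurable M" for n using s by (simp add: sqint_def)
  define d where "d k x = norm (X (r (Suc k)) x - X (r k) x)" for k x
  have [measurable]: "d k \<in> borel_measurable M" for k unfolding d_def[abs_def] by measurable
  have dint: "integrable M (\<lambda>x. (d k x)\<^sup>2)" for k
    unfolding d_def by (intro sqint_integrable sqint_diff s)
  have dk: "(\<integral>\<^sup>+x. ennreal (d k x) \<partial>M) \<le> ennreal ((measure M (space M) + 1) * (1/2)^k)" for k
  proof -
    \<comment> \<open>Splitting at the height \<open>(1/2)^k\<close> trades the bound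
      \<open>(1/4)^k\<close> on the integral of the square for a bound of order
      \<open>(1/2)^k\<close> on the integral itself, which is summable.\<close>
    have "d k x \<le> (1/2)^k + 2^k * (d k x)\<^sup>2" for x
    proof (cases "d k x \<le> (1/2)^k")
      case False
      then have "(1/2)^k * d k x \<le> d k x * d k x" by (intro mult_right_mono) (auto simp: d_def)
      then have "2^k * ((1/2)^k * d k x) \<le> 2^k * (d k x * d k x)" by (intro mult_left_mono) auto
      then show ?thesis by (simp add: power2_eq_square power_divide add_increasing)
    qed (simp add: add_increasing2)
    then have "(\<integral>\<^sup>+x. ennreal (d k x) \<partial>M) \<le> (\<integral>\<^sup>+x. ennreal ((1/2)^k + 2^k * (d k x)\<^sup>2) \<partial>M)"
      by (intro nn_integral_mono ennreal_leI)
    also have "\<dots> = ennreal (\<integral>x. (1/2)^k + 2^k * (d k x)\<^sup>2 \<partial>M)"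
      using dint by (intro nn_integral_eq_integral) auto
    also have "(\<integral>x. (1/2)^k + 2^k * (d k x)\<^sup>2 \<partial>M) = (1/2)^k * measure M (space M) + 2^k * (\<integral>x. (d k x)\<^sup>2 \<partial>M)"
      using dint by (subst Bochner_Integration.integral_add) auto
    also have "ennreal \<dots> \<le> ennreal ((1/2)^k * measure M (space M) + 2^k * (1/4)^k)"
      using rC[of k "r (Suc k)" "r k"] r
      by (intro ennreal_leI add_left_mono mult_left_mono) (auto simp: d_def strict_mono_less_eq)
    also have "(1/2)^k * measure M (space M) + 2^k * (1/4)^k = (measure M (space M) + 1) * (1/2::real)^k"
    proof -
      have "2^k * (1/4)^k = (1/2::real)^k" by (simp flip: power_mult_distrib)
      then show ?thesis by (simp add: algebra_simps)
    qed
    finally show ?thesis .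
  qed
  have "(\<integral>\<^sup>+x. (\<Sum>k. ennreal (d k x)) \<partial>M) = (\<Sum>k. \<integral>\<^sup>+x. ennreal (d k x) \<partial>M)"
    by (intro nn_integral_suminf) auto
  also have "\<dots> \<le> (\<Sum>k. ennreal ((measure M (space M) + 1) * (1/2)^k))"
    by (intro suminf_le dk) auto
  also have "\<dots> = ennreal (\<Sum>k. (measure M (space M) + 1) * (1/2)^k)"
    by (intro suminf_ennreal_eq) (auto intro!: summable_sums summable_mult summable_geometric)
  finally have "(\<integral>\<^sup>+x. (\<Sum>k. ennreal (d k x)) \<partial>M) \<noteq> \<infinity>"
    by (auto simp: top_unique)
  then have "AE x in M. (\<Sum>k. ennreal (d k x)) \<noteq> \<infinity>"
    by (intro nn_integral_PInf_AE) auto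
  then have conv: "AE x in M. convergent (\<lambda>k. X (r k) x)"
  proof eventually_elim
    case (elim x)
    have "summable (\<lambda>k. d k x)"
      by (rule summable_suminf_not_top) (use elim in \<open>auto simp: d_def\<close>)
    then have "summable (\<lambda>k. X (r (Suc k)) x - X (r k) x)"
      unfolding d_def by (rule summable_norm_cancel)
    then have "convergent (\<lambda>n. \<Sum>k<n. X (r (Suc k)) x - X (r k) x)"
      by (simp add: summable_iff_convergent)
    then have "convergent (\<lambda>n. (X (r n) x - X (r 0) x) + X (r 0) x)"
      using sum_lessThan_telescope[of "\<lambda>k. X (r k) x"] by (intro convergent_add convergent_const) simp
    then show ?case by simp
  qed
  define f where "f x = lim (\<lambda>k. X (r k) x)" for x
  have [measurable]: "f \<in> borel_measurable M" unfolding f_def by measurable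
  have lim: "AE x in M. (\<lambda>k. X (r k) x) \<longlonglongrightarrow> f x"
    using conv by eventually_elim (simp add: f_def convergent_LIMSEQ_iff)
  \<comment> \<open>By Fatou's lemma the Cauchy bound for \<open>X n - X (r j)\<close> survives j
    tending to infinity.\<close>
  have est: "(\<integral>\<^sup>+x. ennreal ((norm (X n x - f x))\<^sup>2) \<partial>M) \<le> ennreal ((1/4)^k)" if n: "n \<ge> r k" for n k
  proof -
    have "(\<integral>\<^sup>+x. ennreal ((norm (X n x - f x))\<^sup>2) \<partial>M) = (\<integral>\<^sup>+x. liminf (\<lambda>j. ennreal ((norm (X n x - X (r j) x))\<^sup>2)) \<partial>M)"
    proof (rule nn_integral_cong_AE)
      show "AE x in M. ennreal ((norm (X n x - f x))\<^sup>2) = liminf (\<lambda>j. ennreal ((norm (X n x - X (r j) x))\<^sup>2))"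
        using lim
      proof eventually_elim
        case (elim x)
        have "(\<lambda>j. ennreal ((norm (X n x - X (r j) x))\<^sup>2)) \<longlonglongrightarrow> ennreal ((norm (X n x - f x))\<^sup>2)"
          by (intro tendsto_intros elim)
        then show ?case by (intro lim_imp_Liminf[symmetric]) simp
      qed
    qed
    also have "\<dots> \<le> liminf (\<lambda>j. \<integral>\<^sup>+x. ennreal ((norm (X n x - X (r j) x))\<^sup>2) \<partial>M)"
      by (intro nn_integral_liminf) auto
    also have "\<dots> \<le> liminf (\<lambda>j::nat. ennreal ((1/4)^k))"
    proof (rule Liminf_mono)
      have "(\<integral>\<^sup>+x. ennreal ((norm (X n x - X (r j) x))\<^sup>2) \<partial>M) \<le> ennreal ((1/4)^k)" if "j \<ge> k" for j
      proof -
        have "(\<integral>\<^sup>+x. ennreal ((norm (X n x - X (r j) x))\<^sup>2) \<partial>M) = ennreal (\<integral>x. (norm (X n x - X (r j) x))\<^sup>2 \<partial>M)"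
          by (intro nn_integral_eq_integral) (auto intro!: sqint_integrable sqint_diff s)
        also have "\<dots> \<le> ennreal ((1/4)^k)"
          using rC[of k n "r j"] n r that by (intro ennreal_leI) (auto simp: strict_mono_less_eq)
        finally show ?thesis .
      qed
      then show "\<forall>\<^sub>F j in sequentially. (\<integral>\<^sup>+x. ennreal ((norm (X n x - X (r j) x))\<^sup>2) \<partial>M) \<le> ennreal ((1/4)^k)"
        by (auto simp: eventually_sequentially)
    qed
    also have "\<dots> = ennreal ((1/4)^k)" by (simp add: Liminf_const)
    finally show ?thesis .
  qed
  have df: "sqint M (\<lambda>x. X n x - f x)" if n: "n \<ge> r 0" for n
    unfolding sqint_def using est[of 0 n] n
    by (auto simp: integrable_iff_bounded intro: le_less_trans)
  have sf: "sqint M f"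
    using sqint_diff[OF s[of "r 0"] df[of "r 0"]] by simp
  have "L2_lim M X f"
  proof (rule L2_limI[OF s sf], rule LIMSEQ_I)
    fix e :: real assume "e > 0"
    then obtain k where k: "(1/4::real)^k < e" using real_arch_pow_inv[of e "1/4"] by auto
    have "(\<integral>x. (norm (X n x - f x))\<^sup>2 \<partial>M) \<le> (1/4)^k" if "n \<ge> r k" for n
    proof -
      have "ennreal (\<integral>x. (norm (X n x - f x))\<^sup>2 \<partial>M) = (\<integral>\<^sup>+x. ennreal ((norm (X n x - f x))\<^sup>2) \<partial>M)"
        by (intro nn_integral_eq_integral[symmetric]) (auto intro!: sqint_integrable sqint_diff s sf)
      with est[OF that] show ?thesis by (metis ennreal_le_iff zero_le_divide_1_iff zero_le_numeral zero_le_power)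
    qed
    then show "\<exists>no. \<forall>n\<ge>no. norm ((\<integral>x. (norm (X n x - f x))\<^sup>2 \<partial>M) - 0) < e"
      using k by (intro exI[of _ "r k"]) (auto intro: le_less_trans)
  qed
  then show thesis using that by blast
qed

section \<open>Smooth functions and test functions\<close>

lemma has_derivative_cgrad:
  assumes "f differentiable (at x)"
  shows "(f has_derivative (\<lambda>v. cgrad f x \<bullet> v)) (at x)"
proof -
  let ?D = "frechet_derivative f (at x)"
  have D: "(f has_derivative ?D) (at x)" using assms frechet_derivative_works by blast
  then interpret bounded_linear ?D by (rule has_derivative_bounded_linear)
  have "?D v = cgrad f x \<bullet> v" for v
  proof -
    have "?D v = ?D (\<Sum>i\<in>Basis. (v \<bullet> i) *\<^sub>R i)" by (simp add: euclidean_representation)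
    also have "\<dots> = (\<Sum>i\<in>Basis. (v \<bullet> i) * ?D i)" by (simp add: sum scaleR)
    also have "\<dots> = cgrad f x \<bullet> v"
      by (simp add: cgrad_def partial_def inner_sum_left) (simp add: inner_commute mult.commute)
    finally show ?thesis .
  qed
  then show ?thesis by (intro has_derivative_eq_rhs[OF D]) auto
qed

lemma cgrad_eqI:
  assumes "(f has_derivative (\<lambda>v. g \<bullet> v)) (at x)"
  shows "cgrad f x = g"
proof -
  have "frechet_derivative f (at x) = (\<lambda>v. g \<bullet> v)"
    using assms by (simp add: frechet_derivative_at[symmetric])
  then show ?thesis
    by (simp add: cgrad_def partial_def euclidean_representation)
qed

lemma cgrad_inner_Basis: "i \<in> Basis \<Longrightarrow> cgrad f x \<bullet> i = partial i f x"
  by (simp add: cgrad_def inner_sum_left inner_Basis if_distrib sum.delta cong: if_cong)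

lemma smooth_onD:
  assumes "smooth_on UNIV f"
  shows "f differentiable (at x)" "i \<in> Basis \<Longrightarrow> smooth_on UNIV (partial i f)" "continuous_on UNIV f"
proof -
  have "C_on (Suc k) UNIV f" for k using assms by (auto simp: smooth_on_def)
  then show "f differentiable (at x)" "i \<in> Basis \<Longrightarrow> smooth_on UNIV (partial i f)" "continuous_on UNIV f"
    by (auto simp: smooth_on_def)
qed

text \<open>\<open>C_on\<close> recurses on the order through partial derivatives, so a class of
  differentiable functions that is closed under partial derivatives consists of smooth functions.
  Smoothness proofs then only exhibit such a class and never compute higher derivatives.\<close>

lemma smooth_coinduct:
  assumes "P f"
    and "\<And>f x. P f \<Longrightarrow> f differentiable (at x)"
    and "\<And>f i. P f \<Longrightarrow> i \<in> Basis \<Longrightarrow> P (partial i f)"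
  shows "smooth_on UNIV f"
proof -
  have "C_on k UNIV f" for k
    using assms(1)
  proof (induction k arbitrary: f)
    case (Suc k)
    then show ?case
      using assms(2,3) by (auto intro!: differentiable_imp_continuous_on simp: differentiable_on_def
          intro: differentiable_at_withinI)
  qed (use assms(2) in \<open>auto intro!: differentiable_imp_continuous_on simp: differentiable_on_def\<close>)
  then show ?thesis by (simp add: smooth_on_def)
qed

lemma cgrad_const [simp]: "cgrad (\<lambda>x. c) = (\<lambda>x. 0)"
  by (rule ext, rule cgrad_eqI) (auto intro!: derivative_eq_intros)

lemma cgrad_add:
  assumes "f differentiable (at x)" "g differentiable (at x)"
  shows "cgrad (\<lambda>x. f x + g x) x = cgrad f x + cgrad g x"
  by (rule cgrad_eqI)
    (use has_derivative_add[OF assms[THEN has_derivative_cgrad]] in \<open>simp add: inner_add_left\<close>)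

lemma cgrad_mult:
  assumes "f differentiable (at x)" "g differentiable (at x)"
  shows "cgrad (\<lambda>x. f x * g x) x = f x *\<^sub>R cgrad g x + g x *\<^sub>R cgrad f x"
  by (rule cgrad_eqI)
    (use has_derivative_mult[OF assms[THEN has_derivative_cgrad]] in \<open>simp add: inner_add_left mult.commute\<close>)

lemma cgrad_cmult:
  assumes "f differentiable (at x)"
  shows "cgrad (\<lambda>x. c * f x) x = c *\<^sub>R cgrad f x"
  using cgrad_mult[OF differentiable_const assms, of c] by simp

lemma cgrad_compose:
  assumes "(\<Phi> has_real_derivative D) (at (f x))" "f differentiable (at x)"
  shows "cgrad (\<lambda>x. \<Phi> (f x)) x = D *\<^sub>R cgrad f x"
proof (rule cgrad_eqI)
  have "(\<Phi> has_derivative (\<lambda>h. D * h)) (at (f x))" using assms(1) by (simp add: has_field_derivative_def)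
  from has_derivative_compose[OF has_derivative_cgrad[OF assms(2)] this]
  have "((\<lambda>x. \<Phi> (f x)) has_derivative (\<lambda>v. D * (cgrad f x \<bullet> v))) (at x)" .
  moreover have "(\<lambda>v. D * (cgrad f x \<bullet> v)) = (\<lambda>v. (D *\<^sub>R cgrad f x) \<bullet> v)" by simp
  ultimately show "((\<lambda>x. \<Phi> (f x)) has_derivative (\<bullet>) (D *\<^sub>R cgrad f x)) (at x)" by argo
qed

lemma cgrad_inner_const: "cgrad (\<lambda>x. x \<bullet> c) x = c"
  by (rule cgrad_eqI) (auto intro!: derivative_eq_intros simp: inner_commute)

lemma partial_eq_cgrad: "i \<in> Basis \<Longrightarrow> partial i f = (\<lambda>x. cgrad f x \<bullet> i)"
  by (auto simp: cgrad_inner_Basis)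

lemma smooth_const: "smooth_on UNIV (\<lambda>x. c)"
proof (rule smooth_coinduct[where P = "\<lambda>f. \<exists>c. f = (\<lambda>x. c)"])
  fix f :: "'a \<Rightarrow> real" and i :: 'a
  assume "\<exists>c. f = (\<lambda>x. c)" "i \<in> Basis"
  then show "\<exists>c. partial i f = (\<lambda>x. c)" by (auto simp: partial_eq_cgrad)
qed auto

lemma smooth_inner_const: "smooth_on UNIV (\<lambda>x. x \<bullet> c)"
proof (rule smooth_coinduct[where P = "\<lambda>f. (\<exists>c. f = (\<lambda>x. c)) \<or> f = (\<lambda>x. x \<bullet> c)"])
  fix f :: "'a \<Rightarrow> real" and i :: 'a
  assume "(\<exists>c. f = (\<lambda>x. c)) \<or> f = (\<lambda>x. x \<bullet> c)" "i \<in> Basis"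
  then show "(\<exists>c. partial i f = (\<lambda>x. c)) \<or> partial i f = (\<lambda>x. x \<bullet> c)"
    by (auto simp: partial_eq_cgrad cgrad_inner_const)
qed (auto intro!: differentiable_inner)

lemma smooth_realI:
  fixes \<Phi> :: "real \<Rightarrow> real"
  assumes "P \<Phi>" and der: "\<And>\<Phi>. P \<Phi> \<Longrightarrow> \<exists>\<Psi>. P \<Psi> \<and> (\<forall>x. (\<Phi> has_real_derivative \<Psi> x) (at x))"
  shows "smooth_on UNIV \<Phi>"
proof (rule smooth_coinduct[where P = P])
  fix f :: "real \<Rightarrow> real" and i :: real
  assume f: "P f" and i: "i \<in> Basis"
  from der[OF f] obtain g where g: "P g" "\<And>x. (f has_real_derivative g x) (at x)" by blast
  have "cgrad f x = g x" for x
    using g(2) by (intro cgrad_eqI) (simp add: has_field_derivative_def)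
  then have "partial i f = g" using i by (simp add: partial_eq_cgrad)
  with g show "P (partial i f)" by simp
qed (use assms in \<open>auto intro: field_differentiable_imp_differentiable simp: field_differentiable_def\<close>,
  meson der differentiableI has_field_derivative_imp_has_derivative)

lemma smooth_real_deriv:
  fixes \<Phi> :: "real \<Rightarrow> real"
  assumes "smooth_on UNIV \<Phi>"
  shows "(\<Phi> has_real_derivative deriv \<Phi> x) (at x)" "smooth_on UNIV (deriv \<Phi>)"
proof -
  have d: "(\<Phi> has_real_derivative cgrad \<Phi> x) (at x)" for x
    using has_derivative_cgrad[OF smooth_onD(1)[OF assms]] by (simp add: has_field_derivative_def)
  then have eq: "deriv \<Phi> = partial 1 \<Phi>"
    by (auto simp: partial_eq_cgrad DERIV_imp_deriv)
  show "(\<Phi> has_real_derivative deriv \<Phi> x) (at x)"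
    using d[of x] by (simp add: DERIV_imp_deriv[OF d])
  show "smooth_on UNIV (deriv \<Phi>)"
    using smooth_onD(2)[OF assms, of 1] by (simp add: eq)
qed

text \<open>A class for \<open>smooth_coinduct\<close>. Neither products nor compositions alone are
  closed under differentiation, since the product rule creates sums and the chain rule products; the
  generated algebra is closed.\<close>

inductive smooth_alg :: "('a::euclidean_space \<Rightarrow> real) \<Rightarrow> bool" where
  base: "smooth_on UNIV f \<Longrightarrow> smooth_alg f"
| add: "smooth_alg f \<Longrightarrow> smooth_alg g \<Longrightarrow> smooth_alg (\<lambda>x. f x + g x)"
| mult: "smooth_alg f \<Longrightarrow> smooth_alg g \<Longrightarrow> smooth_alg (\<lambda>x. f x * g x)"
| compose: "smooth_on UNIV \<Phi> \<Longrightarrow> smooth_on UNIV f \<Longrightarrow> smooth_alg (\<lambda>x. (\<Phi> :: real \<Rightarrow> real) (f x))"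

lemma smooth_alg_partial:
  "smooth_alg f \<Longrightarrow> (\<forall>x. f differentiable (at x)) \<and> (\<forall>i\<in>Basis. smooth_alg (partial i f))"
proof (induction rule: smooth_alg.induct)
  case (base f)
  then show ?case by (auto intro: smooth_onD smooth_alg.base)
next
  case (add f g)
  then show ?case
    by (auto simp: partial_eq_cgrad cgrad_add inner_add_left intro!: smooth_alg.add)
next
  case (mult f g)
  have "partial i (\<lambda>x. f x * g x) = (\<lambda>x. f x * partial i g x + g x * partial i f x)" if "i \<in> Basis" for i
    using mult that by (auto simp: partial_eq_cgrad cgrad_mult inner_add_left)
  with mult show ?case
    by (auto intro!: smooth_alg.add smooth_alg.mult)
next
  case (compose \<Phi> f)
  note d = smooth_real_deriv[OF compose(1)]
  have "partial i (\<lambda>x. \<Phi> (f x)) = (\<lambda>x. deriv \<Phi> (f x) * partial i f x)" if "i \<in> Basis" for i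
    using that by (auto simp: partial_eq_cgrad cgrad_compose[OF d(1) smooth_onD(1)[OF compose(2)]])
  moreover have "(\<lambda>x. \<Phi> (f x)) differentiable (at x)" for x
    using differentiable_chain_at[OF smooth_onD(1)[OF compose(2)] smooth_onD(1)[OF compose(1)]]
    by (simp add: o_def)
  ultimately show ?case
    using smooth_alg.mult[OF smooth_alg.compose[OF d(2) compose(2)] smooth_alg.base[OF smooth_onD(2)[OF compose(2)]]]
    by auto
qed

lemma smooth_alg_smooth: "smooth_alg f \<Longrightarrow> smooth_on UNIV f"
  by (rule smooth_coinduct[where P = smooth_alg]) (use smooth_alg_partial in blast)+

lemma smooth_add: "smooth_on UNIV f \<Longrightarrow> smooth_on UNIV g \<Longrightarrow> smooth_on UNIV (\<lambda>x. f x + g x)"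
  and smooth_mult: "smooth_on UNIV f \<Longrightarrow> smooth_on UNIV g \<Longrightarrow> smooth_on UNIV (\<lambda>x. f x * g x)"
  and smooth_compose: "smooth_on UNIV \<Phi> \<Longrightarrow> smooth_on UNIV f \<Longrightarrow> smooth_on UNIV (\<lambda>x. (\<Phi> :: real \<Rightarrow> real) (f x))"
  by (auto intro!: smooth_alg_smooth intro: smooth_alg.intros)

lemma smooth_cmult: "smooth_on UNIV f \<Longrightarrow> smooth_on UNIV (\<lambda>x. c * f x)"
  by (intro smooth_mult smooth_const)

lemma smooth_sum:
  "finite I \<Longrightarrow> (\<And>i. i \<in> I \<Longrightarrow> smooth_on UNIV (f i)) \<Longrightarrow> smooth_on UNIV (\<lambda>x. \<Sum>i\<in>I. f i x)"
  by (induction I rule: finite_induct) (auto intro: smooth_const smooth_add)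

lemma smooth_norm_power2: "smooth_on UNIV (\<lambda>x. (norm (x :: 'a::euclidean_space))\<^sup>2)"
proof -
  have "(norm x)\<^sup>2 = (\<Sum>i\<in>Basis. (x \<bullet> i) * (x \<bullet> i))" for x :: 'a
    unfolding power2_norm_eq_inner by (rule euclidean_inner)
  then show ?thesis by (auto intro!: smooth_sum smooth_mult smooth_inner_const)
qed

lemma smooth_affine: "smooth_on UNIV (\<lambda>x::real. c * x + d)"
  using smooth_add[OF smooth_cmult[OF smooth_inner_const[of "1::real"]] smooth_const, of c d] by simp

lemma smooth_ident: "smooth_on UNIV (\<lambda>x::real. x)"
  using smooth_inner_const[of "1::real"] by simp

text \<open>The flat function exp (-1/t) together with the powers of 1/t that differentiation
  produces: the derivative of each member is a combination of two later members.\<close>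

definition flat_exp :: "nat \<Rightarrow> real \<Rightarrow> real" where
  "flat_exp n t = (if t > 0 then (1 / t) ^ n * exp (- (1 / t)) else 0)"

lemma flat_exp_tendsto_0: "(flat_exp n \<longlongrightarrow> 0) (at 0)"
proof -
  have "((\<lambda>y::real. y ^ n / exp y) \<longlongrightarrow> 0) at_top" for n :: nat
    by (rule tendsto_power_div_exp_0)
  then have "((\<lambda>t::real. (inverse t) ^ n / exp (inverse t)) \<longlongrightarrow> 0) (at_right 0)"
    by (rule filterlim_compose) (rule filterlim_inverse_at_top_right)
  then have "(flat_exp n \<longlongrightarrow> 0) (at_right 0)"
    by (rule Lim_transform_eventually)
      (auto simp: eventually_at_filter flat_exp_def exp_minus divide_inverse)
  moreover have "(flat_exp n \<longlongrightarrow> 0) (at_left 0)"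
    by (rule Lim_transform_eventually[OF tendsto_const])
      (auto simp: eventually_at_filter flat_exp_def)
  ultimately show ?thesis by (simp add: filterlim_at_split)
qed

lemma flat_exp_has_derivative:
  "(flat_exp n has_real_derivative (flat_exp (n + 2) t + (- real n) * flat_exp (n + 1) t)) (at t)"
proof (rule linorder_cases[of t 0])
  assume t: "t < 0"
  have "(flat_exp n has_real_derivative 0) (at t)"
    by (rule has_field_derivative_transform_within_open[where f = "\<lambda>_. 0" and S = "{..<0}"])
      (use t in \<open>auto simp: flat_exp_def\<close>)
  then show ?thesis using t by (simp add: flat_exp_def)
next
  assume t: "t = 0"
  \<comment> \<open>At the origin the difference quotient of \<open>flat_exp n\<close> is
    \<open>flat_exp (n + 1)\<close>, which is known to vanish in the limit.\<close>
  have "((\<lambda>h. flat_exp n h / h) \<longlongrightarrow> 0) (at 0)"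
    by (rule Lim_transform_eventually[OF flat_exp_tendsto_0[of "n + 1"]])
      (auto simp: eventually_at_filter flat_exp_def)
  then show ?thesis using t by (simp add: DERIV_def flat_exp_def)
next
  assume t: "0 < t"
  have eq: "(1 / t) ^ n * (exp (- (1 / t)) * (1 / t\<^sup>2)) + (real n * (1 / t) ^ (n - 1) * (- (1 / t\<^sup>2))) * exp (- (1 / t))
      = (1 / t) ^ (n + 2) * exp (- (1 / t)) + (- real n) * ((1 / t) ^ (n + 1) * exp (- (1 / t)))"
  proof (cases n)
    case (Suc m)
    then show ?thesis
      by (simp add: algebra_simps power2_eq_square add_divide_distrib diff_divide_distrib)
  qed (simp add: power2_eq_square)
  have "((\<lambda>t. (1 / t) ^ n * exp (- (1 / t))) has_real_derivative
      (1 / t) ^ n * (exp (- (1 / t)) * (1 / t\<^sup>2)) + (real n * (1 / t) ^ (n - 1) * (- (1 / t\<^sup>2))) * exp (- (1 / t))) (at t)"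
    using t by (auto intro!: derivative_eq_intros simp: power2_eq_square)
  then have "((\<lambda>t. (1 / t) ^ n * exp (- (1 / t))) has_real_derivative
      flat_exp (n + 2) t + (- real n) * flat_exp (n + 1) t) (at t)"
    unfolding eq using t by (simp add: flat_exp_def)
  then show ?thesis
    by (rule has_field_derivative_transform_within_open[where S = "{0<..}"])
      (use t in \<open>auto simp: flat_exp_def\<close>)
qed

inductive flat_span :: "(real \<Rightarrow> real) \<Rightarrow> bool" where
  base: "flat_span (flat_exp n)"
| add: "flat_span f \<Longrightarrow> flat_span g \<Longrightarrow> flat_span (\<lambda>x. f x + g x)"
| cmult: "flat_span f \<Longrightarrow> flat_span (\<lambda>x. c * f x)"

lemma smooth_flat_exp: "smooth_on UNIV (flat_exp n)"
proof (rule smooth_realI[where P = flat_span])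
  show "\<exists>\<Psi>. flat_span \<Psi> \<and> (\<forall>x. (\<Phi> has_real_derivative \<Psi> x) (at x))" if "flat_span \<Phi>" for \<Phi>
    using that
  proof (induction rule: flat_span.induct)
    case (base n)
    have "flat_span (\<lambda>t. flat_exp (n + 2) t + (- real n) * flat_exp (n + 1) t)"
      by (intro flat_span.intros)
    then show ?case using flat_exp_has_derivative by blast
  next
    case (add f g)
    then show ?case by (blast intro: flat_span.add DERIV_add)
  next
    case (cmult f c)
    then show ?case by (blast intro: flat_span.cmult DERIV_cmult)
  qed
qed (rule flat_span.base)

lemma flat_exp_0: "flat_exp 0 t = (if t > 0 then exp (- (1 / t)) else 0)"
  by (simp add: flat_exp_def)

section \<open>Test functions\<close>

lemma test_funI:
  assumes "smooth_on UNIV f" "{x. f x \<noteq> 0} \<subseteq> C" "compact C" "C \<subseteq> \<Omega>"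
  shows "test_fun \<Omega> f"
proof -
  have "closure {x. f x \<noteq> 0} \<subseteq> C" using assms by (simp add: closure_minimal compact_imp_closed)
  moreover from this have "compact (closure {x. f x \<noteq> 0})"
    using compact_Int_closed[OF assms(3) closed_closure, of "{x. f x \<noteq> 0}"] by (simp add: inf.absorb2)
  ultimately show ?thesis
    using assms by (auto simp: test_fun_def)
qed

lemma test_funD:
  assumes "test_fun \<Omega> \<phi>"
  shows "smooth_on UNIV \<phi>" "compact (closure {x. \<phi> x \<noteq> 0})" "closure {x. \<phi> x \<noteq> 0} \<subseteq> \<Omega>"
    "\<phi> differentiable (at x)" "continuous_on UNIV \<phi>" "x \<notin> \<Omega> \<Longrightarrow> \<phi> x = 0"
  using assms closure_subset[of "{x. \<phi> x \<noteq> 0}"] smooth_onD by (auto simp: test_fun_def)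

lemma cgrad_zero_outside:
  assumes "x \<notin> closure {x. \<phi> x \<noteq> 0}"
  shows "cgrad \<phi> x = 0"
proof (rule cgrad_eqI)
  have "(\<phi> has_derivative (\<lambda>v. 0)) (at x)"
    by (rule has_derivative_transform_within_open[where f = "\<lambda>_. 0" and s = "- closure {x. \<phi> x \<noteq> 0}"])
      (use assms closure_subset[of "{x. \<phi> x \<noteq> 0}"] in auto)
  then show "(\<phi> has_derivative (\<bullet>) 0) (at x)" by (rule has_derivative_eq_rhs) auto
qed

lemma test_fun_subset:
  assumes "test_fun \<Omega> \<phi>" "smooth_on UNIV f" "\<And>x. \<phi> x = 0 \<Longrightarrow> f x = 0"
  shows "test_fun \<Omega> f"
  by (rule test_funI[OF assms(2) _ test_funD(2,3)[OF assms(1)]])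
    (use assms(3) closure_subset[of "{x. \<phi> x \<noteq> 0}"] in auto)

lemma test_fun_add:
  assumes "test_fun \<Omega> \<phi>" "test_fun \<Omega> \<psi>" shows "test_fun \<Omega> (\<lambda>x. \<phi> x + \<psi> x)"
proof (rule test_funI[where C = "closure {x. \<phi> x \<noteq> 0} \<union> closure {x. \<psi> x \<noteq> 0}"])
  show "{x. \<phi> x + \<psi> x \<noteq> 0} \<subseteq> closure {x. \<phi> x \<noteq> 0} \<union> closure {x. \<psi> x \<noteq> 0}"
  proof
    fix x assume "x \<in> {x. \<phi> x + \<psi> x \<noteq> 0}"
    then have "\<phi> x \<noteq> 0 \<or> \<psi> x \<noteq> 0" by auto
    then show "x \<in> closure {x. \<phi> x \<noteq> 0} \<union> closure {x. \<psi> x \<noteq> 0}"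
      using closure_subset[of "{x. \<phi> x \<noteq> 0}"] closure_subset[of "{x. \<psi> x \<noteq> 0}"] by blast
  qed
qed (use assms in \<open>auto simp: test_fun_def intro: smooth_add\<close>)

lemma test_fun_mult:
  assumes "test_fun \<Omega> \<phi>" "smooth_on UNIV \<psi>" shows "test_fun \<Omega> (\<lambda>x. \<phi> x * \<psi> x)"
  by (rule test_fun_subset[OF assms(1)]) (use assms in \<open>auto intro: smooth_mult test_funD\<close>)

lemma test_fun_cmult: "test_fun \<Omega> \<phi> \<Longrightarrow> test_fun \<Omega> (\<lambda>x. c * \<phi> x)"
  using test_fun_mult[OF _ smooth_const, of \<Omega> \<phi> c] by (simp add: mult.commute)

lemma test_fun_zero: "test_fun \<Omega> (\<lambda>x. 0)"
  by (rule test_funI[where C = "{}"]) (auto intro: smooth_const)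

lemma test_fun_compose:
  fixes \<Phi> :: "real \<Rightarrow> real"
  assumes "test_fun \<Omega> \<phi>" "smooth_on UNIV \<Phi>" "\<Phi> 0 = 0" shows "test_fun \<Omega> (\<lambda>x. \<Phi> (\<phi> x))"
  by (rule test_fun_subset[OF assms(1)]) (use assms in \<open>auto intro: smooth_compose test_funD\<close>)

lemma test_fun_partial:
  assumes "test_fun \<Omega> \<phi>" "i \<in> Basis" shows "test_fun \<Omega> (partial i \<phi>)"
proof (rule test_funI[OF _ _ test_funD(2,3)[OF assms(1)]])
  show "smooth_on UNIV (partial i \<phi>)" by (intro smooth_onD(2) test_funD(1)[OF assms(1)] assms(2))
  show "{x. partial i \<phi> x \<noteq> 0} \<subseteq> closure {x. \<phi> x \<noteq> 0}"
  proof
    fix x assume "x \<in> {x. partial i \<phi> x \<noteq> 0}"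
    then have "cgrad \<phi> x \<noteq> 0" using assms(2) by (auto simp: partial_eq_cgrad)
    then show "x \<in> closure {x. \<phi> x \<noteq> 0}" using cgrad_zero_outside by blast
  qed
qed

lemma smooth_cgrad_continuous: "smooth_on UNIV \<phi> \<Longrightarrow> continuous_on UNIV (cgrad \<phi>)"
  unfolding cgrad_def[abs_def] by (intro continuous_intros smooth_onD) 

lemma test_fun_bounded:
  assumes "test_fun \<Omega> \<phi>"
  obtains B where "0 < B" "\<And>x. \<bar>\<phi> x\<bar> \<le> B" "\<And>x. norm (cgrad \<phi> x) \<le> B"
proof -
  let ?C = "closure {x. \<phi> x \<noteq> 0}"
  have C: "compact ?C" using assms by (rule test_funD)
  have "bounded (\<phi> ` ?C)" "bounded (cgrad \<phi> ` ?C)"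
    using continuous_on_subset[OF test_funD(5)[OF assms], of ?C]
      continuous_on_subset[OF smooth_cgrad_continuous[OF test_funD(1)[OF assms]], of ?C]
    by (auto intro!: compact_imp_bounded compact_continuous_image C)
  then obtain B1 B2 where B: "\<And>x. x \<in> ?C \<Longrightarrow> norm (\<phi> x) \<le> B1" "\<And>x. x \<in> ?C \<Longrightarrow> norm (cgrad \<phi> x) \<le> B2"
    by (auto simp: bounded_iff)
  show thesis
  proof (rule that[of "max 1 (max B1 B2)"])
    fix x
    show "\<bar>\<phi> x\<bar> \<le> max 1 (max B1 B2)"
      using B(1)[of x] closure_subset[of "{x. \<phi> x \<noteq> 0}"] by (cases "\<phi> x = 0") (auto simp: max_def)
    show "norm (cgrad \<phi> x) \<le> max 1 (max B1 B2)"
      using B(2)[of x] cgrad_zero_outside[of x \<phi>] by (cases "x \<in> ?C") (auto simp: max_def)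
  qed auto
qed

lemma test_fun_lipschitz:
  assumes "test_fun \<Omega> \<phi>" "\<And>x. norm (cgrad \<phi> x) \<le> B"
  shows "\<bar>\<phi> x - \<phi> y\<bar> \<le> B * norm (x - y)"
proof -
  have "norm (\<phi> x - \<phi> y) \<le> B * norm (x - y)"
  proof (rule differentiable_bound[where S = UNIV and f' = "\<lambda>x v. cgrad \<phi> x \<bullet> v"])
    show "onorm (\<lambda>v. cgrad \<phi> z \<bullet> v) \<le> B" for z
    proof (rule onorm_le)
      show "norm (cgrad \<phi> z \<bullet> v) \<le> B * norm v" for v
        using Cauchy_Schwarz_ineq2[of "cgrad \<phi> z" v] mult_right_mono[OF assms(2)[of z] norm_ge_zero[of v]]
        by simp
    qed
  qed (use assms in \<open>auto intro: has_derivative_cgrad test_funD\<close>)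
  then show ?thesis by simp
qed

lemma continuous_compact_support_integrable:
  fixes f :: "'a::euclidean_space \<Rightarrow> 'b::euclidean_space"
  assumes "continuous_on UNIV f" "compact C" "\<And>x. x \<notin> C \<Longrightarrow> f x = 0"
  shows "integrable lborel f"
proof -
  have "integrable lborel (\<lambda>x. indicator C x *\<^sub>R f x)"
    by (rule borel_integrable_compact) (use assms in \<open>auto intro: continuous_on_subset\<close>)
  moreover have "(\<lambda>x. indicator C x *\<^sub>R f x) = f"
    using assms(3) by (auto simp: indicator_def)
  ultimately show ?thesis by simp
qed

lemma test_fun_integrable: "test_fun \<Omega> \<phi> \<Longrightarrow> integrable lborel \<phi>"
  using closure_subset[of "{x. \<phi> x \<noteq> 0}"]
  by (intro continuous_compact_support_integrable[OF test_funD(5) test_funD(2)]) auto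

lemma integral_lborel_translate:
  fixes f :: "'a::euclidean_space \<Rightarrow> real"
  assumes "f \<in> borel_measurable borel"
  shows "(\<integral>x. f (h + x) \<partial>lborel) = (\<integral>x. f x \<partial>lborel)"
    and "integrable lborel f \<Longrightarrow> integrable lborel (\<lambda>x. f (h + x))"
proof -
  have "(\<integral>x. f x \<partial>distr lborel borel ((+) h)) = (\<integral>x. f (h + x) \<partial>lborel)"
    by (rule integral_distr) (use assms in auto)
  then show "(\<integral>x. f (h + x) \<partial>lborel) = (\<integral>x. f x \<partial>lborel)"
    by (simp add: lborel_distr_plus)
  have "integrable (distr lborel borel ((+) h)) f \<longleftrightarrow> integrable lborel (\<lambda>x. f (h + x))"
    by (rule integrable_distr_eq) (use assms in auto)
  then show "integrable lborel f \<Longrightarrow> integrable lborel (\<lambda>x. f (h + x))"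
    by (simp add: lborel_distr_plus)
qed

text \<open>Every difference quotient has integral 0 by translation invariance of Lebesgue measure,
  and the quotients converge dominatedly to the partial derivative. This is the source of all
  integrations by parts below.\<close>

lemma integral_partial_test_fun:
  assumes t: "test_fun \<Omega> \<phi>" and i: "i \<in> Basis"
  shows "(\<integral>x. partial i \<phi> x \<partial>lborel) = 0"
proof -
  obtain B where B: "0 < B" "\<And>x. norm (cgrad \<phi> x) \<le> B" using test_fun_bounded[OF t] by metis
  obtain R where R: "0 < R" "\<And>x. x \<in> closure {x. \<phi> x \<noteq> 0} \<Longrightarrow> norm x \<le> R"
    using compact_imp_bounded[OF test_funD(2)[OF t]] by (auto simp: bounded_pos)
  have far: "\<phi> x = 0" if "norm x > R" for x
    using R(2)[of x] that closure_subset[of "{x. \<phi> x \<noteq> 0}"] by fastforce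
  have [measurable]: "\<phi> \<in> borel_measurable borel"
    using test_funD(5)[OF t] by (rule borel_measurable_continuous_onI)
  define s where "s n x = (\<phi> (inverse (real (Suc n)) *\<^sub>R i + x) - \<phi> x) / inverse (real (Suc n))" for n x
  have int0: "(\<integral>x. s n x \<partial>lborel) = 0" for n
    unfolding s_def using test_fun_integrable[OF t] integral_lborel_translate[of \<phi>]
    by (subst integral_divide_zero) (simp add: Bochner_Integration.integral_diff)
  \<comment> \<open>All increments are at most 1, so the quotients vanish outside the ball of radius
    \<open>R + 1\<close>; inside, the Lipschitz constant \<open>B\<close> bounds them.\<close>
  have "(\<lambda>n. \<integral>x. s n x \<partial>lborel) \<longlonglongrightarrow> (\<integral>x. partial i \<phi> x \<partial>lborel)"
  proof (rule integral_dominated_convergence[where w = "\<lambda>x. indicator (cball 0 (R + 1)) x *\<^sub>R B"])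
    show "integrable lborel (\<lambda>x::'a. indicator (cball 0 (R + 1)) x *\<^sub>R B)"
      by (rule borel_integrable_compact) auto
    show "partial i \<phi> \<in> borel_measurable lborel"
      using test_funD(5)[OF test_fun_partial[OF t i]] by (simp add: borel_measurable_continuous_onI)
    show "s n \<in> borel_measurable lborel" for n unfolding s_def[abs_def] by measurable
    show "AE x in lborel. (\<lambda>n. s n x) \<longlonglongrightarrow> partial i \<phi> x"
    proof (rule AE_I2)
      fix x
      have d: "(\<phi> has_derivative (\<lambda>v. cgrad \<phi> x \<bullet> v)) (at (x + 0 *\<^sub>R i))"
        using has_derivative_cgrad[OF test_funD(4)[OF t]] by simp
      have "((\<lambda>h. \<phi> (x + h *\<^sub>R i)) has_derivative (\<lambda>h. cgrad \<phi> x \<bullet> (h *\<^sub>R i))) (at 0)"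
        by (rule has_derivative_compose[where f = "\<lambda>h. x + h *\<^sub>R i" and g = \<phi> and f' = "\<lambda>h. h *\<^sub>R i", OF _ d])
          (auto intro!: derivative_eq_intros)
      then have "((\<lambda>h. \<phi> (x + h *\<^sub>R i)) has_real_derivative (cgrad \<phi> x \<bullet> i)) (at 0)"
        unfolding has_field_derivative_def by (rule has_derivative_eq_rhs) (auto simp: mult.commute)
      then have "((\<lambda>h. (\<phi> (x + h *\<^sub>R i) - \<phi> x) / h) \<longlongrightarrow> cgrad \<phi> x \<bullet> i) (at 0)"
        by (simp add: DERIV_def)
      moreover have "filterlim (\<lambda>n. inverse (real (Suc n))) (at 0) sequentially"
        using LIMSEQ_inverse_real_of_nat by (auto simp: filterlim_at)
      ultimately have "(\<lambda>n. (\<phi> (x + inverse (real (Suc n)) *\<^sub>R i) - \<phi> x) / inverse (real (Suc n))) \<longlonglongrightarrow> cgrad \<phi> x \<bullet> i"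
        by (rule filterlim_compose)
      then show "(\<lambda>n. s n x) \<longlonglongrightarrow> partial i \<phi> x"
        unfolding s_def cgrad_inner_Basis[OF i] by (simp add: add.commute)
    qed
    show "AE x in lborel. norm (s n x) \<le> indicator (cball 0 (R + 1)) x *\<^sub>R B" for n
    proof (rule AE_I2)
      fix x
      let ?h = "inverse (real (Suc n))"
      have h: "0 < ?h" "?h \<le> 1" by (auto simp: inverse_le_1_iff)
      show "norm (s n x) \<le> indicator (cball 0 (R + 1)) x *\<^sub>R B"
      proof (cases "norm x \<le> R + 1")
        case True
        have "\<bar>\<phi> (?h *\<^sub>R i + x) - \<phi> x\<bar> \<le> B * norm (?h *\<^sub>R i + x - x)"
          by (rule test_fun_lipschitz[OF t B(2)])
        also have "\<dots> = B * ?h" using i h by simp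
        finally have "norm (s n x) \<le> B"
          using h by (simp add: s_def abs_mult divide_le_eq)
        then show ?thesis using True by simp
      next
        case False
        have "norm x \<le> norm (?h *\<^sub>R i + x) + norm (?h *\<^sub>R i)"
          using norm_triangle_ineq4[of "?h *\<^sub>R i + x" "?h *\<^sub>R i"] by simp
        then have "norm (?h *\<^sub>R i + x) > R" using False h i by simp
        then show ?thesis using False far by (simp add: s_def)
      qed
    qed
  qed
  then show ?thesis unfolding int0 by (simp add: LIMSEQ_const_iff)
qed

section \<open>Mollification\<close>

text \<open>The standard bump exp (-1 / (1 - |x|^2 / e^2)) on the ball of radius e. The squared norm
  keeps the argument of \<open>flat_exp\<close> polynomial, hence smooth at the centre too.\<close>

definition bump :: "real \<Rightarrow> 'a::euclidean_space \<Rightarrow> real" where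
  "bump e x = flat_exp 0 (1 - (1 / e\<^sup>2) * (norm x)\<^sup>2)"

definition moll :: "real \<Rightarrow> 'a::euclidean_space \<Rightarrow> real" where
  "moll e x = inverse (\<integral>y. bump e (y :: 'a) \<partial>lborel) * bump e x"

lemma smooth_bump: "smooth_on UNIV (bump e)"
proof -
  have "smooth_on UNIV (\<lambda>x::'a. flat_exp 0 (- (1 / e\<^sup>2) * (norm x)\<^sup>2 + 1))"
    by (rule smooth_compose[OF smooth_flat_exp smooth_compose[OF smooth_affine smooth_norm_power2]])
  then show ?thesis by (simp add: bump_def[abs_def])
qed

lemma bump_nonneg: "0 \<le> bump e x"
  by (simp add: bump_def flat_exp_def)

lemma bump_pos_iff: "e > 0 \<Longrightarrow> bump e x \<noteq> 0 \<longleftrightarrow> norm x < e"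
  by (auto simp: bump_def flat_exp_0 divide_less_eq intro: power2_less_imp_less power_strict_mono)

lemma test_fun_bump:
  assumes "e > 0" shows "test_fun UNIV (bump e)"
  by (rule test_funI[OF smooth_bump, where C = "cball 0 e"]) (auto simp: bump_pos_iff[OF assms])

lemma integral_bump_pos:
  assumes e: "e > 0" shows "(\<integral>y. bump e (y :: 'a::euclidean_space) \<partial>lborel) > 0"
proof (rule ccontr)
  assume "\<not> ?thesis"
  moreover have "0 \<le> (\<integral>y. bump e (y :: 'a) \<partial>lborel)" by (simp add: bump_nonneg)
  ultimately have "(\<integral>y. bump e (y :: 'a) \<partial>lborel) = 0" by linarith
  then have "AE y in lborel. bump e (y :: 'a) = 0"
    using integral_nonneg_eq_0_iff_AE[OF test_fun_integrable[OF test_fun_bump[OF e]]] bump_nonneg by auto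
  then have "AE y in lborel. (y :: 'a) \<notin> ball 0 e"
    by eventually_elim (use bump_pos_iff[OF e] in auto)
  then have "ball (0::'a) e \<in> null_sets lborel"
    by (subst (asm) AE_iff_null_sets[symmetric]) auto
  then have "negligible (ball (0::'a) e)"
    by (metis negligible_iff_null_sets null_sets_completionI)
  then show False using open_not_negligible[of "ball (0::'a) e"] e by auto
qed

lemma moll_nonneg: "0 \<le> moll e x"
  by (simp add: moll_def bump_nonneg)

lemma moll_uminus: "moll e (- x) = moll e x"
  by (simp add: moll_def bump_def)

lemma moll_commute: "moll e (x - y) = moll e (y - x)"
  using moll_uminus[of e "x - y"] by simp

lemma moll_eq_0: "e > 0 \<Longrightarrow> norm x \<ge> e \<Longrightarrow> moll e x = 0"
  using bump_pos_iff[of e x] by (auto simp: moll_def)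

lemma test_fun_moll: "e > 0 \<Longrightarrow> test_fun UNIV (moll e)"
  unfolding moll_def[abs_def] by (intro test_fun_cmult test_fun_bump)

lemma integral_moll: "e > 0 \<Longrightarrow> (\<integral>x. moll e (x :: 'a::euclidean_space) \<partial>lborel) = 1"
  unfolding moll_def using integral_bump_pos[of e, where ?'a = 'a] by simp

definition conv :: "('a::euclidean_space \<Rightarrow> real) \<Rightarrow> ('a \<Rightarrow> real) \<Rightarrow> 'a \<Rightarrow> real" where
  "conv f r x = (\<integral>y. f y * r (x - y) \<partial>lborel)"

lemma test_fun_borel: "test_fun \<Omega> \<phi> \<Longrightarrow> \<phi> \<in> borel_measurable borel"
  by (intro borel_measurable_continuous_onI test_funD(5))

lemma conv_integrable:
  assumes f: "integrable lborel f" and r: "test_fun \<Omega> r"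
  shows "integrable lborel (\<lambda>y. f y * r (x - y))"
proof -
  obtain B where B: "\<And>x. \<bar>r x\<bar> \<le> B" using test_fun_bounded[OF r] by metis
  note [measurable] = test_fun_borel[OF r] borel_measurable_integrable[OF f]
  show ?thesis
  proof (rule Bochner_Integration.integrable_bound[where f = "\<lambda>y. B * f y"])
    show "AE y in lborel. norm (f y * r (x - y)) \<le> norm (B * f y)"
    proof (rule AE_I2)
      fix y
      have "\<bar>f y\<bar> * \<bar>r (x - y)\<bar> \<le> \<bar>f y\<bar> * \<bar>B\<bar>"
        using B[of "x - y"] by (intro mult_left_mono) auto
      then show "norm (f y * r (x - y)) \<le> norm (B * f y)" by (simp add: abs_mult mult.commute)
    qed
  qed (use f in auto)
qed

text \<open>The partial derivatives are again test functions, hence globally Lipschitz, and this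
  makes the first-order remainder quadratic uniformly in the base point. The uniformity is what
  allows differentiation under a convolution integral.\<close>

lemma test_fun_linearization:
  fixes r :: "'a::euclidean_space \<Rightarrow> real"
  assumes r: "test_fun \<Omega> r"
  obtains K where "0 \<le> K" "\<And>z v. \<bar>r (z + v) - r z - cgrad r z \<bullet> v\<bar> \<le> K * (norm v)\<^sup>2"
proof -
  have "\<forall>i\<in>Basis. \<exists>B. \<forall>x y. \<bar>partial i r x - partial i r y\<bar> \<le> B * norm (x - y)"
  proof
    fix i :: 'a assume i: "i \<in> Basis"
    obtain B where "\<And>x. norm (cgrad (partial i r) x) \<le> B"
      using test_fun_bounded[OF test_fun_partial[OF r i]] by metis
    with test_fun_lipschitz[OF test_fun_partial[OF r i]]
    show "\<exists>B. \<forall>x y. \<bar>partial i r x - partial i r y\<bar> \<le> B * norm (x - y)" by blast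
  qed
  then obtain B where B: "\<And>i x y. i \<in> Basis \<Longrightarrow> \<bar>partial i r x - partial i r y\<bar> \<le> B i * norm (x - y)"
    by metis
  define K where "K = (\<Sum>i\<in>Basis. \<bar>B i\<bar>)"
  have lip: "norm (cgrad r x - cgrad r y) \<le> K * norm (x - y)" for x y
  proof -
    have "norm (cgrad r x - cgrad r y) \<le> (\<Sum>i\<in>Basis. \<bar>(cgrad r x - cgrad r y) \<bullet> i\<bar>)"
      by (rule norm_le_l1)
    also have "\<dots> \<le> (\<Sum>i\<in>Basis. \<bar>B i\<bar> * norm (x - y))"
    proof (rule sum_mono)
      fix i :: 'a assume i: "i \<in> Basis"
      have "\<bar>(cgrad r x - cgrad r y) \<bullet> i\<bar> \<le> B i * norm (x - y)"
        using B[OF i, of x y] i by (simp add: inner_diff_left cgrad_inner_Basis)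
      also have "\<dots> \<le> \<bar>B i\<bar> * norm (x - y)" by (intro mult_right_mono) auto
      finally show "\<bar>(cgrad r x - cgrad r y) \<bullet> i\<bar> \<le> \<bar>B i\<bar> * norm (x - y)" .
    qed
    also have "\<dots> = K * norm (x - y)" by (simp add: K_def sum_distrib_right)
    finally show ?thesis .
  qed
  have K: "0 \<le> K" by (simp add: K_def sum_nonneg)
  have "\<bar>r (z + v) - r z - cgrad r z \<bullet> v\<bar> \<le> K * (norm v)\<^sup>2" for z v
  proof -
    have "norm (r (z + v) - r z - cgrad r z \<bullet> (z + v - z)) \<le> norm (z + v - z) * (K * norm v)"
    proof (rule differentiable_bound_linearization[where S = "cball z (norm v)" and f' = "\<lambda>x v. cgrad r x \<bullet> v"])
      show "z + t *\<^sub>R (z + v - z) \<in> cball z (norm v)" if "t \<in> {0..1}" for t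
        using that by (simp add: dist_norm mult_left_le_one_le)
      show "(r has_derivative (\<bullet>) (cgrad r x)) (at x within cball z (norm v))" for x
        using has_derivative_cgrad[OF test_funD(4)[OF r]] by (rule has_derivative_at_withinI)
      show "onorm ((\<bullet>) (cgrad r x) - (\<bullet>) (cgrad r z)) \<le> K * norm v" if x: "x \<in> cball z (norm v)" for x
      proof (rule onorm_le)
        fix w
        have "norm (cgrad r x \<bullet> w - cgrad r z \<bullet> w) \<le> norm (cgrad r x - cgrad r z) * norm w"
          using Cauchy_Schwarz_ineq2[of "cgrad r x - cgrad r z" w] by (simp add: inner_diff_left)
        also have "\<dots> \<le> K * norm (x - z) * norm w" by (intro mult_right_mono lip) auto
        also have "\<dots> \<le> K * norm v * norm w"
          using x K by (intro mult_right_mono mult_left_mono) (auto simp: dist_norm norm_minus_commute)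
        finally show "norm (((\<bullet>) (cgrad r x) - (\<bullet>) (cgrad r z)) w) \<le> K * norm v * norm w" by simp
      qed
    qed auto
    then show ?thesis by (simp add: power2_eq_square algebra_simps)
  qed
  with K show thesis using that by blast
qed

text \<open>The uniform quadratic remainder of r, integrated against |f|, is at most
  \<open>K * N * (norm v)\<^sup>2\<close> with \<open>N\<close> the L1 norm of f, so no regularity
  of f is involved.\<close>

lemma conv_has_derivative:
  fixes f :: "'a::euclidean_space \<Rightarrow> real"
  assumes f: "integrable lborel f" and r: "test_fun \<Omega> r"
  shows "(conv f r has_derivative (\<lambda>v. (\<Sum>i\<in>Basis. conv f (partial i r) x *\<^sub>R i) \<bullet> v)) (at x)"
proof -
  obtain K where K: "0 \<le> K" "\<And>z v. \<bar>r (z + v) - r z - cgrad r z \<bullet> v\<bar> \<le> K * (norm v)\<^sup>2"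
    using test_fun_linearization[OF r] by blast
  define G where "G = (\<Sum>i\<in>Basis. conv f (partial i r) x *\<^sub>R i)"
  define N where "N = (\<integral>y. \<bar>f y\<bar> \<partial>lborel)"
  have N: "0 \<le> N" by (simp add: N_def)
  have ip: "integrable lborel (\<lambda>y. f y * (cgrad r (x - y) \<bullet> v))"
    and ipe: "(\<integral>y. f y * (cgrad r (x - y) \<bullet> v) \<partial>lborel) = G \<bullet> v" for v
  proof -
    have eq: "f y * (cgrad r (x - y) \<bullet> v) = (\<Sum>i\<in>Basis. (i \<bullet> v) * (f y * partial i r (x - y)))" for y
      by (simp add: cgrad_def inner_sum_left sum_distrib_left mult_ac)
    have int: "integrable lborel (\<lambda>y. (i \<bullet> v) * (f y * partial i r (x - y)))" if "i \<in> Basis" for i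
      using conv_integrable[OF f test_fun_partial[OF r that]] by auto
    then show "integrable lborel (\<lambda>y. f y * (cgrad r (x - y) \<bullet> v))" unfolding eq by auto
    show "(\<integral>y. f y * (cgrad r (x - y) \<bullet> v) \<partial>lborel) = G \<bullet> v"
      unfolding eq G_def using int
      by (subst Bochner_Integration.integral_sum) (auto simp: conv_def inner_sum_left intro!: sum.cong mult.commute)
  qed
  have bound: "\<bar>conv f r (x + v) - conv f r x - G \<bullet> v\<bar> \<le> K * N * (norm v)\<^sup>2" for v
  proof -
    define D where "D y = r (x - y + v) - r (x - y) - cgrad r (x - y) \<bullet> v" for y
    have D: "f y * D y = f y * r (x + v - y) - f y * r (x - y) - f y * (cgrad r (x - y) \<bullet> v)" for y
      unfolding D_def by (simp add: algebra_simps)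
    note ints = conv_integrable[OF f r, of "x + v"] conv_integrable[OF f r, of x] ip[of v]
    have iD: "integrable lborel (\<lambda>y. f y * D y)"
      unfolding D by (rule Bochner_Integration.integrable_diff[OF Bochner_Integration.integrable_diff[OF ints(1,2)] ints(3)])
    have "conv f r (x + v) - conv f r x - G \<bullet> v = (\<integral>y. f y * D y \<partial>lborel)"
      unfolding D Bochner_Integration.integral_diff[OF Bochner_Integration.integrable_diff[OF ints(1,2)] ints(3)]
        Bochner_Integration.integral_diff[OF ints(1,2)] ipe conv_def ..
    also have "\<bar>\<dots>\<bar> \<le> (\<integral>y. \<bar>f y * D y\<bar> \<partial>lborel)"
      using integral_norm_bound[of lborel "\<lambda>y. f y * D y"] by simp
    also have "\<dots> \<le> (\<integral>y. (K * (norm v)\<^sup>2) * \<bar>f y\<bar> \<partial>lborel)"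
    proof (rule integral_mono)
      show "integrable lborel (\<lambda>y. \<bar>f y * D y\<bar>)" by (rule integrable_abs[OF iD])
      show "integrable lborel (\<lambda>y. (K * (norm v)\<^sup>2) * \<bar>f y\<bar>)" using f by auto
      show "\<bar>f y * D y\<bar> \<le> (K * (norm v)\<^sup>2) * \<bar>f y\<bar>" for y
        using mult_left_mono[OF K(2)[of "x - y" v], of "\<bar>f y\<bar>"] by (simp add: abs_mult mult.commute D_def)
    qed
    also have "\<dots> = K * N * (norm v)\<^sup>2" by (simp add: N_def)
    finally show ?thesis .
  qed
  have "(conv f r has_derivative (\<lambda>v. G \<bullet> v)) (at x)"
    unfolding has_derivative_at_alt
  proof (intro conjI allI impI)
    show "bounded_linear ((\<bullet>) G)" by (rule bounded_linear_inner_right)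
    fix e :: real assume e: "0 < e"
    show "\<exists>d>0. \<forall>y. norm (y - x) < d \<longrightarrow> norm (conv f r y - conv f r x - G \<bullet> (y - x)) \<le> e * norm (y - x)"
    proof (intro exI[of _ "e / (K * N + 1)"] conjI allI impI)
      have KN: "0 \<le> K * N" using K N by simp
      show "0 < e / (K * N + 1)" using e KN by simp
      fix y assume y: "norm (y - x) < e / (K * N + 1)"
      have "K * N * norm (y - x) \<le> (K * N + 1) * norm (y - x)" by (simp add: distrib_right)
      also have "\<dots> \<le> e" using y KN by (simp add: field_simps)
      finally have le: "K * N * norm (y - x) \<le> e" .
      have "norm (conv f r y - conv f r x - G \<bullet> (y - x)) \<le> K * N * (norm (y - x))\<^sup>2"
        using bound[of "y - x"] by simp
      also have "\<dots> = (K * N * norm (y - x)) * norm (y - x)" by (simp add: power2_eq_square)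
      also have "\<dots> \<le> e * norm (y - x)" by (intro mult_right_mono le) auto
      finally show "norm (conv f r y - conv f r x - G \<bullet> (y - x)) \<le> e * norm (y - x)" .
    qed
  qed
  then show ?thesis by (simp add: G_def)
qed

lemma conv_partial:
  assumes "integrable lborel f" "test_fun \<Omega> r" "i \<in> Basis"
  shows "partial i (conv f r) = conv f (partial i r)"
proof
  fix x
  have "cgrad (conv f r) x = (\<Sum>i\<in>Basis. conv f (partial i r) x *\<^sub>R i)"
    by (rule cgrad_eqI[OF conv_has_derivative[OF assms(1,2)]])
  then show "partial i (conv f r) x = conv f (partial i r) x"
    using assms(3) by (simp add: cgrad_inner_Basis[symmetric] inner_sum_left inner_Basis if_distrib sum.delta cong: if_cong)
qed

text \<open>Derivatives fall on r only, so for fixed f the convolutions with all test functions form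
  a class closed under partial derivatives.\<close>

lemma smooth_conv:
  assumes f: "integrable lborel f" and r: "test_fun \<Omega> r"
  shows "smooth_on UNIV (conv f r)"
proof (rule smooth_coinduct[where P = "\<lambda>g. \<exists>r. test_fun \<Omega> r \<and> g = conv f r"])
  show "g differentiable at x" if "\<exists>r. test_fun \<Omega> r \<and> g = conv f r" for g x
    using that conv_has_derivative[OF f] unfolding differentiable_def by blast
  show "\<exists>r. test_fun \<Omega> r \<and> partial i g = conv f r" if "\<exists>r. test_fun \<Omega> r \<and> g = conv f r" "i \<in> Basis" for g i
    using that conv_partial[OF f] test_fun_partial by blast
qed (use r in blast)

lemma conv_eq_0:
  assumes C: "\<And>y. y \<notin> C \<Longrightarrow> f y = 0" and r: "\<And>z. norm z \<ge> e \<Longrightarrow> r z = 0"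
    and x: "\<And>y. y \<in> C \<Longrightarrow> dist x y \<ge> e"
  shows "conv f r x = 0"
proof -
  have "(\<lambda>y. f y * r (x - y)) = (\<lambda>y. 0)"
  proof
    show "f y * r (x - y) = 0" for y
      using C[of y] r[of "x - y"] x[of y] by (cases "y \<in> C") (auto simp: dist_norm)
  qed
  then show ?thesis by (simp add: conv_def)
qed

lemma test_fun_conv:
  assumes f: "integrable lborel f" and r: "test_fun UNIV r"
    and C: "compact C" "\<And>y. y \<notin> C \<Longrightarrow> f y = 0" and re: "\<And>z. norm z \<ge> e \<Longrightarrow> r z = 0"
    and sub: "\<And>x y. y \<in> C \<Longrightarrow> dist x y \<le> e \<Longrightarrow> x \<in> \<Omega>"
  shows "test_fun \<Omega> (conv f r)"
proof (rule test_funI[OF smooth_conv[OF f r]])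
  let ?S = "{y + z | y z. y \<in> C \<and> z \<in> cball 0 e}"
  show "compact ?S" by (intro compact_sums C compact_cball)
  show "?S \<subseteq> \<Omega>" using sub by (auto simp: dist_norm)
  show "{x. conv f r x \<noteq> 0} \<subseteq> ?S"
  proof
    fix x assume "x \<in> {x. conv f r x \<noteq> 0}"
    then have nz: "conv f r x \<noteq> 0" by simp
    show "x \<in> ?S"
    proof (rule ccontr)
      assume x: "x \<notin> ?S"
      have "dist x y \<ge> e" if "y \<in> C" for y
      proof (rule ccontr)
        assume "\<not> dist x y \<ge> e"
        then have "x = y + (x - y)" "x - y \<in> cball 0 e" by (auto simp: dist_norm norm_minus_commute)
        with that x show False by blast
      qed
      then have "conv f r x = 0" by (intro conv_eq_0[where C = C and e = e and f = f and r = r] C(2) re)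
      with nz show False by simp
    qed
  qed
qed

lemma moll_translate:
  assumes e: "e > 0"
  shows "integrable lborel (\<lambda>y. moll e (x - y))" "(\<integral>y. moll e (x - y :: 'a::euclidean_space) \<partial>lborel) = 1"
proof -
  have eq: "(\<lambda>y. moll e (x - y)) = (\<lambda>y. moll e (- x + y))" by (auto simp: moll_commute[of e x])
  note m = test_fun_borel[OF test_fun_moll[OF e, where ?'a = 'a]] test_fun_integrable[OF test_fun_moll[OF e, where ?'a = 'a]]
  show "integrable lborel (\<lambda>y. moll e (x - y))" "(\<integral>y. moll e (x - y) \<partial>lborel) = 1"
    unfolding eq using integral_lborel_translate[OF m(1), of "- x"] m(2) integral_moll[OF e, where ?'a = 'a]
    by simp_all
qed

text \<open>A pointwise Jensen inequality is integrated in x; after Tonelli the inner integral of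
  the kernel is 1. Being a contraction uniformly in e, mollification needs to be shown convergent
  only on a dense class.\<close>

lemma conv_moll_contraction:
  fixes f :: "'a::euclidean_space \<Rightarrow> real"
  assumes e: "e > 0" and f: "integrable lborel f" "sqint lborel f"
  shows "sqint lborel (conv f (moll e))"
    and "(\<integral>x. (norm (conv f (moll e) x))\<^sup>2 \<partial>lborel) \<le> (\<integral>x. (norm (f x))\<^sup>2 \<partial>lborel)"
proof -
  let ?r = "moll e :: 'a \<Rightarrow> real"
  note t = test_fun_moll[OF e, where ?'a = 'a]
  have [measurable]: "?r \<in> borel_measurable borel" "f \<in> borel_measurable borel"
    using test_fun_borel[OF t] f(1) by auto
  have [measurable]: "conv f ?r \<in> borel_measurable borel"
    by (intro borel_measurable_continuous_onI smooth_onD(3) smooth_conv[OF f(1) t])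
  have f2: "integrable lborel (\<lambda>y. (f y)\<^sup>2)" using f(2) by (simp add: sqint_def)
  \<comment> \<open>Jensen for the probability density \<open>y \<mapsto> moll e (x - y)\<close>: its variance is nonnegative.\<close>
  have jensen: "(conv f ?r x)\<^sup>2 \<le> (\<integral>y. (f y)\<^sup>2 * ?r (x - y) \<partial>lborel)" for x
  proof -
    let ?m = "conv f ?r x"
    note i1 = conv_integrable[OF f2 t, of x] and i2 = conv_integrable[OF f(1) t, of x] and i3 = moll_translate[OF e, of x]
    have "0 \<le> (\<integral>y. (f y - ?m)\<^sup>2 * ?r (x - y) \<partial>lborel)"
      by (intro Bochner_Integration.integral_nonneg) (auto simp: moll_nonneg)
    also have "\<dots> = (\<integral>y. (f y)\<^sup>2 * ?r (x - y) - 2 * ?m * (f y * ?r (x - y)) + ?m\<^sup>2 * ?r (x - y) \<partial>lborel)"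
      by (intro Bochner_Integration.integral_cong) (auto simp: power2_eq_square algebra_simps)
    also have "\<dots> = (\<integral>y. (f y)\<^sup>2 * ?r (x - y) \<partial>lborel) - 2 * ?m * ?m + ?m\<^sup>2"
      using i1 i2 i3 by (simp add: conv_def)
    finally show ?thesis by (simp add: power2_eq_square)
  qed
  have "(\<integral>\<^sup>+x. ennreal ((norm (conv f ?r x))\<^sup>2) \<partial>lborel) \<le> (\<integral>\<^sup>+x. \<integral>\<^sup>+y. ennreal ((f y)\<^sup>2 * ?r (x - y)) \<partial>lborel \<partial>lborel)"
  proof (rule nn_integral_mono)
    fix x
    have "ennreal ((norm (conv f ?r x))\<^sup>2) \<le> ennreal (\<integral>y. (f y)\<^sup>2 * ?r (x - y) \<partial>lborel)"
      using jensen[of x] by (intro ennreal_leI) simp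
    also have "\<dots> = (\<integral>\<^sup>+y. ennreal ((f y)\<^sup>2 * ?r (x - y)) \<partial>lborel)"
      using conv_integrable[OF f2 t, of x] by (intro nn_integral_eq_integral[symmetric]) (auto simp: moll_nonneg)
    finally show "ennreal ((norm (conv f ?r x))\<^sup>2) \<le> (\<integral>\<^sup>+y. ennreal ((f y)\<^sup>2 * ?r (x - y)) \<partial>lborel)" .
  qed
  also have "\<dots> = (\<integral>\<^sup>+y. \<integral>\<^sup>+x. ennreal ((f y)\<^sup>2 * ?r (x - y)) \<partial>lborel \<partial>lborel)"
    by (rule lborel_pair.Fubini'[symmetric]) measurable
  also have "\<dots> = (\<integral>\<^sup>+y. ennreal ((f y)\<^sup>2) \<partial>lborel)"
  proof (rule nn_integral_cong)
    fix y
    have "(\<integral>\<^sup>+x. ennreal ((f y)\<^sup>2 * ?r (x - y)) \<partial>lborel) = ennreal (\<integral>x. (f y)\<^sup>2 * ?r (x - y) \<partial>lborel)"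
      using moll_translate[OF e, of y] by (intro nn_integral_eq_integral) (auto simp: moll_nonneg moll_commute[of e _ y])
    also have "\<dots> = ennreal ((f y)\<^sup>2)"
      using moll_translate[OF e, of y] by (simp add: moll_commute[of e _ y])
    finally show "(\<integral>\<^sup>+x. ennreal ((f y)\<^sup>2 * ?r (x - y)) \<partial>lborel) = ennreal ((f y)\<^sup>2)" .
  qed
  also have "\<dots> = ennreal (\<integral>y. (f y)\<^sup>2 \<partial>lborel)"
    using f2 by (intro nn_integral_eq_integral) auto
  finally have le: "(\<integral>\<^sup>+x. ennreal ((norm (conv f ?r x))\<^sup>2) \<partial>lborel) \<le> ennreal (\<integral>y. (f y)\<^sup>2 \<partial>lborel)" .
  show s: "sqint lborel (conv f ?r)"
    unfolding sqint_def using le by (auto simp: integrable_iff_bounded intro: le_less_trans)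
  have "ennreal (\<integral>x. (norm (conv f ?r x))\<^sup>2 \<partial>lborel) = (\<integral>\<^sup>+x. ennreal ((norm (conv f ?r x))\<^sup>2) \<partial>lborel)"
    by (intro nn_integral_eq_integral[symmetric] sqint_integrable s) auto
  with le have "ennreal (\<integral>x. (norm (conv f ?r x))\<^sup>2 \<partial>lborel) \<le> ennreal (\<integral>y. (f y)\<^sup>2 \<partial>lborel)" by simp
  then show "(\<integral>x. (norm (conv f ?r x))\<^sup>2 \<partial>lborel) \<le> (\<integral>x. (norm (f x))\<^sup>2 \<partial>lborel)"
    by (subst (asm) ennreal_le_iff) auto
qed

lemma conv_diff:
  assumes "integrable lborel f" "integrable lborel g" "test_fun \<Omega> r"
  shows "conv (\<lambda>y. f y - g y) r x = conv f r x - conv g r x"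
  unfolding conv_def left_diff_distrib
  by (intro Bochner_Integration.integral_diff conv_integrable[OF _ assms(3)] assms)

lemma conv_add:
  assumes "integrable lborel f" "integrable lborel g" "test_fun \<Omega> r"
  shows "conv (\<lambda>y. f y + g y) r x = conv f r x + conv g r x"
  unfolding conv_def distrib_right
  by (intro Bochner_Integration.integral_add conv_integrable[OF _ assms(3)] assms)

lemma conv_cmult: "conv (\<lambda>y. c * f y) r x = c * conv f r x"
  by (simp add: conv_def mult.assoc)

section \<open>Convergence of mollifications in L2\<close>

definition mollify :: "('a::euclidean_space \<Rightarrow> real) \<Rightarrow> nat \<Rightarrow> 'a \<Rightarrow> real" where
  "mollify f n = conv f (moll (inverse (real (Suc n))))"

lemma conv_moll_bounded:
  assumes e: "e > 0" and f: "integrable lborel f" "\<And>x. \<bar>f x\<bar> \<le> B"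
  shows "\<bar>conv f (moll e) x\<bar> \<le> B"
proof -
  have "\<bar>conv f (moll e) x\<bar> \<le> (\<integral>y. norm (f y * moll e (x - y)) \<partial>lborel)"
    unfolding conv_def by (rule order_trans[OF _ integral_norm_bound]) simp
  also have "\<dots> \<le> (\<integral>y. B * moll e (x - y) \<partial>lborel)"
    using moll_translate[OF e, of x] f(2)
    by (intro integral_mono integrable_norm[OF conv_integrable[OF f(1) test_fun_moll[OF e]]])
      (auto simp: abs_mult moll_nonneg intro!: mult_right_mono)
  also have "\<dots> = B" using moll_translate[OF e, of x] by simp
  finally show ?thesis .
qed

text \<open>The usual three-term estimate: the contraction property controls the mollified error by
  the error itself, for all radii at once.\<close>

lemma mollify_closed:
  fixes f :: "'a::euclidean_space \<Rightarrow> real"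
  assumes X: "L2_lim lborel X f" and int: "\<And>k. integrable lborel (X k)" "integrable lborel f"
    and conv: "\<And>k. L2_lim lborel (mollify (X k)) (X k)"
  shows "L2_lim lborel (mollify f) f"
proof (rule L2_limI)
  have s: "sqint lborel f" "sqint lborel (X k)" for k using X by (auto simp: L2_lim_def)
  show sf: "sqint lborel f" by fact
  show sm: "sqint lborel (mollify f n)" for n
    unfolding mollify_def by (rule conv_moll_contraction) (use int s in auto)
  show "(\<lambda>n. \<integral>x. (norm (mollify f n x - f x))\<^sup>2 \<partial>lborel) \<longlonglongrightarrow> 0"
  proof (rule LIMSEQ_I)
    fix e :: real assume e: "e > 0"
    \<comment> \<open>Two applications of the quasi-triangle inequality count this error 2 + 4 times
      and the mollification error of \<open>X k\<close> 4 times; 6/12 + 4/8 = 1.\<close>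
    have "eventually (\<lambda>k. (\<integral>x. (norm (X k x - f x))\<^sup>2 \<partial>lborel) < e / 12) sequentially"
      using order_tendstoD(2)[OF L2_lim_tendsto[OF X], of "e / 12"] e by simp
    then obtain k where k: "(\<integral>x. (norm (X k x - f x))\<^sup>2 \<partial>lborel) < e / 12"
      by (auto simp: eventually_sequentially)
    have "eventually (\<lambda>n. (\<integral>x. (norm (mollify (X k) n x - X k x))\<^sup>2 \<partial>lborel) < e / 8) sequentially"
      using order_tendstoD(2)[OF L2_lim_tendsto[OF conv[of k]], of "e / 8"] e by simp
    then obtain N where N: "\<And>n. n \<ge> N \<Longrightarrow> (\<integral>x. (norm (mollify (X k) n x - X k x))\<^sup>2 \<partial>lborel) < e / 8"
      by (auto simp: eventually_sequentially)
    have "(\<integral>x. (norm (mollify f n x - f x))\<^sup>2 \<partial>lborel) < e" if n: "n \<ge> N" for n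
    proof -
      have smk: "sqint lborel (mollify (X k) n)" using conv[of k] by (simp add: L2_lim_def)
      have "(\<integral>x. (norm (mollify f n x - f x))\<^sup>2 \<partial>lborel) \<le>
         2 * (\<integral>x. (norm (mollify f n x - mollify (X k) n x))\<^sup>2 \<partial>lborel)
         + 2 * (\<integral>x. (norm (mollify (X k) n x - f x))\<^sup>2 \<partial>lborel)"
        by (intro sqint_norm_diff_trans sm smk s)
      moreover have "(\<integral>x. (norm (mollify (X k) n x - f x))\<^sup>2 \<partial>lborel) \<le>
         2 * (\<integral>x. (norm (mollify (X k) n x - X k x))\<^sup>2 \<partial>lborel) + 2 * (\<integral>x. (norm (X k x - f x))\<^sup>2 \<partial>lborel)"
        by (intro sqint_norm_diff_trans smk s)
      moreover have "(\<integral>x. (norm (mollify f n x - mollify (X k) n x))\<^sup>2 \<partial>lborel) \<le> (\<integral>x. (norm (X k x - f x))\<^sup>2 \<partial>lborel)"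
      proof -
        let ?e = "inverse (real (Suc n))"
        have "mollify f n x - mollify (X k) n x = conv (\<lambda>y. f y - X k y) (moll ?e) x" for x
          unfolding mollify_def by (rule conv_diff[symmetric, OF int(2) int(1) test_fun_moll]) simp
        moreover have "(\<integral>x. (norm (conv (\<lambda>y. f y - X k y) (moll ?e) x))\<^sup>2 \<partial>lborel) \<le> (\<integral>x. (norm (f x - X k x))\<^sup>2 \<partial>lborel)"
          by (rule conv_moll_contraction(2)) (use int s in \<open>auto intro: sqint_diff\<close>)
        ultimately show ?thesis by (simp add: power2_commute)
      qed
      ultimately show ?thesis using N[OF n] k by linarith
    qed
    then show "\<exists>no. \<forall>n\<ge>no. norm ((\<integral>x. (norm (mollify f n x - f x))\<^sup>2 \<partial>lborel) - 0) < e"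
      by (intro exI[of _ N]) auto
  qed
qed

lemma sqint_indicator:
  assumes "A \<in> sets M" "emeasure M A < \<infinity>"
  shows "sqint M (indicator A :: 'a \<Rightarrow> real)"
proof -
  have "(\<lambda>x. (norm (indicator A x :: real))\<^sup>2) = indicator A" by (auto simp: indicator_def)
  then show ?thesis using assms by (auto simp: sqint_def)
qed

text \<open>Inside U the mollifications are eventually equal to 1, so their inner products with the
  indicator tend to its squared norm. Since mollification does not increase the norm, expanding the
  square of the difference gives convergence, without pointwise information on the boundary of U,
  which may have positive measure.\<close>

lemma mollify_indicator_open:
  fixes U :: "'a::euclidean_space set"
  assumes U: "open U" "emeasure lborel U < \<infinity>"
  shows "L2_lim lborel (mollify (indicator U)) (indicator U)"
proof (rule L2_limI)
  let ?f = "indicator U :: 'a \<Rightarrow> real"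
  have int: "integrable lborel ?f" using U by auto
  show s: "sqint lborel ?f" using U by (intro sqint_indicator) auto
  show sm: "sqint lborel (mollify ?f n)" for n
    unfolding mollify_def by (rule conv_moll_contraction) (use int s in auto)
  have [measurable]: "U \<in> sets borel" "mollify ?f n \<in> borel_measurable borel" for n
    using U(1) sm[of n] by (auto simp: sqint_def)
  have bd: "\<bar>mollify ?f n x\<bar> \<le> 1" for n x
    unfolding mollify_def by (rule conv_moll_bounded) (use int in \<open>auto simp: indicator_def\<close>)
  have "(\<lambda>n. \<integral>x. ?f x * mollify ?f n x \<partial>lborel) \<longlonglongrightarrow> (\<integral>x. ?f x \<partial>lborel)"
  proof (rule integral_dominated_convergence[where w = ?f])
    show "AE x in lborel. (\<lambda>n. ?f x * mollify ?f n x) \<longlonglongrightarrow> ?f x"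
    proof (rule AE_I2)
      fix x
      show "(\<lambda>n. ?f x * mollify ?f n x) \<longlonglongrightarrow> ?f x"
      proof (cases "x \<in> U")
        case True
        then obtain e where e: "e > 0" "ball x e \<subseteq> U" using U openE by blast
        obtain N where N: "inverse (real (Suc N)) < e" using e reals_Archimedean by blast
        have "mollify ?f n x = 1" if "n \<ge> N" for n
        proof -
          let ?e = "inverse (real (Suc n))"
          have "?e \<le> inverse (real (Suc N))" using that by simp
          then have le: "?e < e" using N by linarith
          have eq: "?f y * moll ?e (x - y) = moll ?e (x - y)" for y
          proof (cases "y \<in> U")
            case False
            then have "dist x y \<ge> e" using e by (auto simp: subset_iff not_less[symmetric])
            then show ?thesis using le moll_eq_0[of ?e "x - y"] by (simp add: dist_norm)
          qed simp
          have "mollify ?f n x = (\<integral>y. moll ?e (x - y) \<partial>lborel)"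
            unfolding mollify_def conv_def by (rule Bochner_Integration.integral_cong[OF refl eq])
          also have "\<dots> = 1" by (rule moll_translate(2)) simp
          finally show ?thesis .
        qed
        then have "eventually (\<lambda>n. ?f x * mollify ?f n x = ?f x) sequentially"
          by (auto simp: eventually_sequentially)
        then show ?thesis by (rule tendsto_eventually)
      qed simp
    qed
    show "AE x in lborel. norm (?f x * mollify ?f n x) \<le> ?f x" for n
      using bd by (auto simp: indicator_def)
  qed (use int in auto)
  moreover have norm: "(norm (?f x))\<^sup>2 = ?f x" for x by (auto simp: indicator_def)
  ultimately have lim: "(\<lambda>n. 2 * (\<integral>x. (norm (?f x))\<^sup>2 \<partial>lborel) - 2 * (\<integral>x. ?f x * mollify ?f n x \<partial>lborel))
      \<longlonglongrightarrow> 2 * (\<integral>x. (norm (?f x))\<^sup>2 \<partial>lborel) - 2 * (\<integral>x. (norm (?f x))\<^sup>2 \<partial>lborel)"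
    unfolding norm by (intro tendsto_intros)
  have le: "(\<integral>x. (norm (mollify ?f n x - ?f x))\<^sup>2 \<partial>lborel) \<le> 2 * (\<integral>x. (norm (?f x))\<^sup>2 \<partial>lborel) - 2 * (\<integral>x. ?f x * mollify ?f n x \<partial>lborel)" for n
  proof -
    have i: "integrable lborel (\<lambda>x. ?f x * mollify ?f n x)" by (intro sqint_mult_integrable s sm)
    have "(\<integral>x. (norm (mollify ?f n x - ?f x))\<^sup>2 \<partial>lborel) =
      (\<integral>x. (norm (mollify ?f n x))\<^sup>2 - 2 * (?f x * mollify ?f n x) + (norm (?f x))\<^sup>2 \<partial>lborel)"
      by (intro Bochner_Integration.integral_cong) (auto simp: power2_eq_square algebra_simps)
    also have "\<dots> = (\<integral>x. (norm (mollify ?f n x))\<^sup>2 \<partial>lborel) - 2 * (\<integral>x. ?f x * mollify ?f n x \<partial>lborel) + (\<integral>x. (norm (?f x))\<^sup>2 \<partial>lborel)"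
      using i sqint_integrable[OF s] sqint_integrable[OF sm] by simp
    also have "(\<integral>x. (norm (mollify ?f n x))\<^sup>2 \<partial>lborel) \<le> (\<integral>x. (norm (?f x))\<^sup>2 \<partial>lborel)"
      unfolding mollify_def by (rule conv_moll_contraction(2)) (use int s in auto)
    finally show ?thesis by simp
  qed
  show "(\<lambda>n. \<integral>x. (norm (mollify ?f n x - ?f x))\<^sup>2 \<partial>lborel) \<longlonglongrightarrow> 0"
    by (rule tendsto_sandwich[OF _ _ tendsto_const]) (use le lim in auto)
qed

text \<open>Outer regularity makes the indicator an L2 limit of indicators of open sets of finite
  measure.\<close>

lemma mollify_indicator:
  fixes A :: "'a::euclidean_space set"
  assumes A: "A \<in> sets borel" "emeasure lborel A < \<infinity>"
  shows "L2_lim lborel (mollify (indicator A)) (indicator A)"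
proof -
  have "\<exists>U. open U \<and> A \<subseteq> U \<and> emeasure lborel (U - A) < ennreal (inverse (real (Suc k)))" for k
    by (rule outer_regular_lborel[OF A(1), of "inverse (real (Suc k))"]) auto
  then obtain U where U: "\<And>k. open (U k)" "\<And>k. A \<subseteq> U k"
    "\<And>k. emeasure lborel (U k - A) < ennreal (inverse (real (Suc k)))" by metis
  have [measurable]: "U k \<in> sets borel" "A \<in> sets borel" for k using U(1) A by auto
  have finU: "emeasure lborel (U k) < \<infinity>" for k
  proof -
    have "emeasure lborel (U k) = emeasure lborel (A \<union> (U k - A))" using U(2)[of k] by (simp add: Un_absorb1)
    also have "\<dots> \<le> emeasure lborel A + emeasure lborel (U k - A)" by (intro emeasure_subadditive) auto
    also have "\<dots> < \<infinity>" using A(2) U(3)[of k] by (auto simp: less_top[symmetric] intro: less_trans)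
    finally show ?thesis .
  qed
  have "L2_lim lborel (\<lambda>k. indicator (U k) :: 'a \<Rightarrow> real) (indicator A)"
  proof (rule L2_lim_squeeze)
    show "(\<lambda>k. inverse (real (Suc k))) \<longlonglongrightarrow> 0" by (rule LIMSEQ_inverse_real_of_nat)
    fix k
    have "(\<integral>x. (norm (indicator (U k) x - indicator A x :: real))\<^sup>2 \<partial>lborel) = (\<integral>x. indicator (U k - A) x \<partial>lborel)"
      using U(2)[of k] by (intro Bochner_Integration.integral_cong) (auto simp: indicator_def)
    also have "\<dots> = measure lborel (U k - A)" by simp
    also have "\<dots> \<le> inverse (real (Suc k))"
      unfolding measure_def using U(3)[of k] by (intro enn2real_leI) auto
    finally show "(\<integral>x. (norm (indicator (U k) x - indicator A x :: real))\<^sup>2 \<partial>lborel) \<le> inverse (real (Suc k))" .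
  qed (use finU A in \<open>auto intro!: sqint_indicator\<close>)
  then show ?thesis
    by (rule mollify_closed) (use finU A U in \<open>auto intro!: mollify_indicator_open\<close>)
qed

text \<open>Integrability stands inside the conclusion so that the induction over nonnegative
  measurable functions can hand it down: each building block is dominated by the function that it
  helps to build.\<close>

lemma mollify_nonneg_L2_lim:
  fixes f :: "'a::euclidean_space \<Rightarrow> real"
  assumes "f \<in> borel_measurable lborel" "\<And>x. 0 \<le> f x" 
  shows "integrable lborel f \<longrightarrow> sqint lborel f \<longrightarrow> L2_lim lborel (mollify f) f"
  using assms
proof (induction rule: borel_measurable_induct_real)
  case (set A)
  show ?case
  proof (intro impI)
    assume "integrable lborel (indicator A :: 'a \<Rightarrow> real)"
    then have "emeasure lborel A < \<infinity>" using set by (simp add: integrable_indicator_iff)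
    then show "L2_lim lborel (mollify (indicator A)) (indicator A)"
      using set by (intro mollify_indicator) auto
  qed
next
  case (mult u c)
  show ?case
  proof (intro impI)
    assume *: "integrable lborel (\<lambda>x. c * u x)" "sqint lborel (\<lambda>x. c * u x)"
    have eq: "mollify (\<lambda>x. c * u x) = (\<lambda>n x. c *\<^sub>R mollify u n x)"
      by (auto simp: mollify_def conv_cmult fun_eq_iff)
    show "L2_lim lborel (mollify (\<lambda>x. c * u x)) (\<lambda>x. c * u x)"
    proof (cases "c = 0")
      \<comment> \<open>For c = 0 integrability of the multiple says nothing about u, and the
        induction hypothesis is out of reach.\<close>
      case True
      then show ?thesis unfolding eq by (simp add: L2_lim_const)
    next
      case False
      have "integrable lborel u" using * False by simp
      moreover have "sqint lborel u" using sqint_scaleR[OF *(2), of "inverse c"] False by (simp flip: mult.assoc)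
      ultimately show ?thesis unfolding eq using mult L2_lim_scaleR[of lborel "mollify u" u c] by simp
    qed
  qed
next
  case (add u v)
  show ?case
  proof (intro impI)
    assume *: "integrable lborel (\<lambda>x. v x + u x)" "sqint lborel (\<lambda>x. v x + u x)"
    have b: "norm (u x) \<le> norm (v x + u x)" "norm (v x) \<le> norm (v x + u x)" for x
      using add by auto
    have i: "integrable lborel u" "integrable lborel v"
      by (auto intro!: Bochner_Integration.integrable_bound[OF *(1)] b add)
    have s: "sqint lborel u" "sqint lborel v"
      using b by (auto intro!: sqint_dominated[OF *(2), where C = 1] add)
    have eq: "mollify (\<lambda>x. v x + u x) = (\<lambda>n x. mollify v n x + mollify u n x)"
      by (auto simp: mollify_def fun_eq_iff intro!: conv_add[OF i(2,1) test_fun_moll])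
    show "L2_lim lborel (mollify (\<lambda>x. v x + u x)) (\<lambda>x. v x + u x)"
      unfolding eq using i s add by (intro L2_lim_add) auto
  qed
next
  case (seq U)
  show ?case
  proof (intro impI)
    assume *: "integrable lborel f" "sqint lborel f"
    have le: "U i x \<le> f x" for i x
      using seq by (intro incseq_le[of "\<lambda>i. U i x"]) (auto simp: incseq_def le_fun_def)
    have f0: "0 \<le> f x" for x using le[of 0 x] seq(2)[of 0 x] by linarith
    have i: "integrable lborel (U i)" for i
      using le f0 seq(1,2) by (intro Bochner_Integration.integrable_bound[OF *(1)]) auto
    have s: "sqint lborel (U i)" for i
      using le f0 seq(1,2) by (intro sqint_dominated[OF *(2), where C = 1]) auto
    have lim: "L2_lim lborel U f"
    proof (rule L2_lim_pointwise_dominated[where g = "\<lambda>x. (norm (f x))\<^sup>2"])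
      show "AE x in lborel. (norm (U n x))\<^sup>2 \<le> (norm (f x))\<^sup>2" for n
        using le f0 seq(2) by (auto intro!: power_mono)
    qed (use seq * in \<open>auto simp: sqint_def\<close>)
    show "L2_lim lborel (mollify f) f"
      by (rule mollify_closed[OF lim i *(1)]) (use i s seq in blast)
  qed
qed

proposition mollify_L2_lim:
  fixes f :: "'a::euclidean_space \<Rightarrow> real"
  assumes f: "integrable lborel f" "sqint lborel f"
  shows "L2_lim lborel (mollify f) f"
proof -
  let ?p = "\<lambda>x. max 0 (f x)" and ?n = "\<lambda>x. max 0 (- f x)"
  have [measurable]: "f \<in> borel_measurable borel" using f by auto
  have i: "integrable lborel ?p" "integrable lborel ?n"
    using f by (auto intro!: Bochner_Integration.integrable_bound[OF f(1)])
  have s: "sqint lborel ?p" "sqint lborel ?n"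
    by (auto intro!: sqint_dominated[OF f(2), where C = 1])
  have "L2_lim lborel (mollify ?p) ?p" "L2_lim lborel (mollify ?n) ?n"
    using mollify_nonneg_L2_lim[of ?p] mollify_nonneg_L2_lim[of ?n] i s by auto
  from L2_lim_diff[OF this]
  have "L2_lim lborel (\<lambda>n x. mollify ?p n x - mollify ?n n x) (\<lambda>x. ?p x - ?n x)" .
  moreover have "(\<lambda>n x. mollify ?p n x - mollify ?n n x) = mollify (\<lambda>x. ?p x - ?n x)"
    by (auto simp: mollify_def fun_eq_iff intro!: conv_diff[symmetric, OF i test_fun_moll])
  moreover have "(\<lambda>x. ?p x - ?n x) = f" by auto
  ultimately show ?thesis by simp
qed

section \<open>Sobolev functions on a bounded open set\<close>

text \<open>Used for the kernel \<open>moll e (x - y)\<close> as a function of y: cut off inside the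
  domain, it becomes a test function for a weak gradient. The reflection accounts for the change of
  sign.\<close>

lemma smooth_reflect:
  assumes "smooth_on UNIV r" shows "smooth_on UNIV (\<lambda>y. r (x - y))" "cgrad (\<lambda>y. r (x - y)) y = - cgrad r (x - y)"
proof -
  have d: "((\<lambda>y. r (x - y)) has_derivative (\<lambda>v. (- cgrad r (x - y)) \<bullet> v)) (at y)"
    if "smooth_on UNIV r" for r :: "'a \<Rightarrow> real" and y
  proof -
    have "((\<lambda>y. r (x - y)) has_derivative (\<lambda>v. cgrad r (x - y) \<bullet> (- v))) (at y)"
      by (rule has_derivative_compose[where f = "\<lambda>y. x - y" and g = r and f' = "\<lambda>v. - v",
            OF _ has_derivative_cgrad[OF smooth_onD(1)[OF that]]]) (auto intro!: derivative_eq_intros)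
    then show ?thesis by (rule has_derivative_eq_rhs) auto
  qed
  show "cgrad (\<lambda>y. r (x - y)) y = - cgrad r (x - y)" by (rule cgrad_eqI[OF d[OF assms]])
  show "smooth_on UNIV (\<lambda>y. r (x - y))"
  proof (rule smooth_coinduct[where P = "\<lambda>g. \<exists>r. smooth_on UNIV r \<and> g = (\<lambda>y. r (x - y))"])
    show "g differentiable at y" if "\<exists>r. smooth_on UNIV r \<and> g = (\<lambda>y. r (x - y))" for g y
      using that d unfolding differentiable_def by blast
    show "\<exists>r. smooth_on UNIV r \<and> partial i g = (\<lambda>y. r (x - y))"
      if g: "\<exists>r. smooth_on UNIV r \<and> g = (\<lambda>y. r (x - y))" and i: "i \<in> Basis" for g i
    proof -
      from g obtain r where r: "smooth_on UNIV r" "g = (\<lambda>y. r (x - y))" by blast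
      have "partial i g = (\<lambda>y. (-1) * partial i r (x - y))"
        using i cgrad_eqI[OF d[OF r(1)]] by (auto simp: partial_eq_cgrad r(2))
      moreover have "smooth_on UNIV (\<lambda>y. (-1) * partial i r y)"
        by (intro smooth_cmult smooth_onD(2) r i)
      ultimately show ?thesis by blast
    qed
  qed (use assms in blast)
qed

lemma cgrad_locally_const:
  assumes "open V" "x \<in> V" "\<And>y. y \<in> V \<Longrightarrow> f y = c"
  shows "cgrad f x = 0"
proof (rule cgrad_eqI)
  have "(f has_derivative (\<lambda>v. 0)) (at x)"
    by (rule has_derivative_transform_within_open[where f = "\<lambda>_. c" and s = V]) (use assms in auto)
  then show "(f has_derivative (\<bullet>) 0) (at x)" by (rule has_derivative_eq_rhs) auto
qed

text \<open>The cut-off is constant on a whole neighbourhood of K, of a uniform width d. Its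
  gradient therefore vanishes there, and mollifications of functions supported in K still live where
  the cut-off is 1.\<close>

lemma cutoff_exists:
  fixes K \<Omega> :: "'a::euclidean_space set"
  assumes K: "compact K" "open \<Omega>" "K \<subseteq> \<Omega>"
  obtains \<zeta> d where "test_fun \<Omega> \<zeta>" "\<And>x. 0 \<le> \<zeta> x" "d > 0"
    "\<And>x y. y \<in> K \<Longrightarrow> dist x y \<le> d \<Longrightarrow> x \<in> \<Omega> \<and> \<zeta> x = 1 \<and> cgrad \<zeta> x = 0"
proof -
  obtain e where e: "e > 0" "(\<Union>x\<in>K. cball x e) \<subseteq> \<Omega>"
    using compact_subset_open_imp_cball_epsilon_subset[OF K] by blast
  \<comment> \<open>The indicator of the e/2-neighbourhood of K is mollified at radius e/4: the
    result is 1 closer than e/4 to K and is supported within 3e/4 of K, hence in the domain. The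
    margin d = e/8 stays strictly below e/4.\<close>
  define C where "C = {y + z | y z. y \<in> K \<and> z \<in> cball 0 (e / 2)}"
  have C: "compact C" unfolding C_def by (intro compact_sums K compact_cball)
  have CI: "x \<in> C" if "y \<in> K" "dist x y \<le> e / 2" for x y
  proof -
    have "x = y + (x - y)" "x - y \<in> cball 0 (e / 2)" using that by (auto simp: dist_norm norm_minus_commute)
    then show ?thesis unfolding C_def using that by blast
  qed
  let ?f = "indicator C :: 'a \<Rightarrow> real"
  have int: "integrable lborel ?f"
    using C emeasure_compact_finite[OF C] by (auto simp: compact_imp_closed borel_closed)
  define \<zeta> where "\<zeta> = conv ?f (moll (e / 4))"
  have e4: "e / 4 > 0" using e by simp
  have test: "test_fun \<Omega> \<zeta>"
    unfolding \<zeta>_def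
  proof (rule test_fun_conv[OF int test_fun_moll[OF e4] C])
    show "moll (e / 4) z = 0" if "e / 4 \<le> norm z" for z :: 'a using moll_eq_0[OF e4 that] .
    fix x y assume y: "y \<in> C" "dist x y \<le> e / 4"
    then obtain k z where kz: "k \<in> K" "norm z \<le> e / 2" "y = k + z" by (auto simp: C_def)
    have "dist x k \<le> dist x y + dist y k" by (rule dist_triangle)
    also have "\<dots> \<le> e / 4 + e / 2" using y kz by (intro add_mono) (auto simp: dist_norm)
    also have "\<dots> \<le> e" using e by simp
    finally have "x \<in> cball k e" by (simp add: dist_commute)
    then show "x \<in> \<Omega>" using e(2) kz(1) by blast
  qed auto
  have one: "\<zeta> x = 1" if x: "y \<in> K" "dist x y < e / 4" for x y
  proof -
    have eq: "?f z * moll (e / 4) (x - z) = moll (e / 4) (x - z)" for z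
    proof (cases "z \<in> C")
      case False
      then have "dist z y > e / 2" using CI[OF x(1), of z] by linarith
      then have "dist x z \<ge> e / 4" using x dist_triangle[of z y x] by (simp add: dist_commute)
      then show ?thesis using moll_eq_0[OF e4, of "x - z"] by (simp add: dist_norm)
    qed simp
    have "\<zeta> x = (\<integral>z. moll (e / 4) (x - z) \<partial>lborel)"
      unfolding \<zeta>_def conv_def by (rule Bochner_Integration.integral_cong[OF refl eq])
    also have "\<dots> = 1" by (rule moll_translate(2)[OF e4])
    finally show ?thesis .
  qed
  show thesis
  proof (rule that[OF test])
    show "0 \<le> \<zeta> x" for x unfolding \<zeta>_def conv_def
      by (intro Bochner_Integration.integral_nonneg) (auto simp: moll_nonneg)
    show "e / 8 > 0" using e by simp
    fix x y assume y: "y \<in> K" "dist x y \<le> e / 8"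
    then have xy: "dist x y < e / 4" using e by simp
    have "cgrad \<zeta> x = 0"
      by (rule cgrad_locally_const[of "ball y (e / 4)" _ _ 1]) (use y xy one in \<open>auto simp: dist_commute\<close>)
    moreover have "x \<in> cball y e" using e xy by (simp add: dist_commute)
    then have "x \<in> \<Omega>" using e(2) y(1) by blast
    ultimately show "x \<in> \<Omega> \<and> \<zeta> x = 1 \<and> cgrad \<zeta> x = 0" using one[OF y(1) xy] by simp
  qed
qed

text \<open>Pairs of a function and its gradient in the W^{1,2} closure of the class T. The gradient
  is an explicit argument because it is determined only almost everywhere. The parameter T admits
  the cone of nonnegative test functions, so that inequalities valid for these pass to its
  closure.\<close>

definition H0c :: "(('a::euclidean_space \<Rightarrow> real) \<Rightarrow> bool) \<Rightarrow> 'a set \<Rightarrow> ('a \<Rightarrow> real) \<Rightarrow> ('a \<Rightarrow> 'a) \<Rightarrow> bool" where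
  "H0c T \<Omega> u g \<longleftrightarrow> (\<exists>\<phi>. (\<forall>k. T (\<phi> k)) \<and>
     L2_lim (lebesgue_on \<Omega>) (\<lambda>k x. (\<phi> k x, cgrad (\<phi> k) x)) (\<lambda>x. (u x, g x)))"

abbreviation H0 :: "'a::euclidean_space set \<Rightarrow> ('a \<Rightarrow> real) \<Rightarrow> ('a \<Rightarrow> 'a) \<Rightarrow> bool" where
  "H0 \<Omega> \<equiv> H0c (test_fun \<Omega>) \<Omega>"

abbreviation nonneg_test :: "'a::euclidean_space set \<Rightarrow> ('a \<Rightarrow> real) \<Rightarrow> bool" where
  "nonneg_test \<Omega> \<phi> \<equiv> test_fun \<Omega> \<phi> \<and> (\<forall>x. 0 \<le> \<phi> x)"

lemma H0cE:
  assumes "H0c T \<Omega> u g"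
  obtains \<phi> where "\<And>k. T (\<phi> k)" "L2_lim (lebesgue_on \<Omega>) \<phi> u" "L2_lim (lebesgue_on \<Omega>) (\<lambda>k. cgrad (\<phi> k)) g"
  using assms unfolding H0c_def L2_lim_Pair by blast

lemma H0cI:
  assumes "\<And>k. T (\<phi> k)" "L2_lim (lebesgue_on \<Omega>) \<phi> u" "L2_lim (lebesgue_on \<Omega>) (\<lambda>k. cgrad (\<phi> k)) g"
  shows "H0c T \<Omega> u g"
  using assms unfolding H0c_def L2_lim_Pair by blast

lemma H0c_sqint:
  assumes "H0c T \<Omega> u g" shows "sqint (lebesgue_on \<Omega>) u" "sqint (lebesgue_on \<Omega>) g"
  using assms by (auto elim!: H0cE intro: L2_lim_sqint)

lemma H0c_cong_AE:
  assumes "H0c T \<Omega> u g" "AE x in lebesgue_on \<Omega>. u x = v x" "AE x in lebesgue_on \<Omega>. g x = h x"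
    "v \<in> borel_measurable (lebesgue_on \<Omega>)" "h \<in> borel_measurable (lebesgue_on \<Omega>)"
  shows "H0c T \<Omega> v h"
  using assms by (elim H0cE) (blast intro: H0cI L2_lim_cong_AE)

text \<open>A diagonal choice: the k-th approximant is taken within 1/(k+1) of the k-th pair. No
  linear structure of T enters, so the lemma covers the nonnegative cone.\<close>

lemma H0c_closed:
  assumes H: "\<And>k. H0c T \<Omega> (u k) (g k)" and lim: "L2_lim (lebesgue_on \<Omega>) (\<lambda>k x. (u k x, g k x)) (\<lambda>x. (v x, h x))"
  shows "H0c T \<Omega> v h"
proof -
  let ?M = "lebesgue_on \<Omega>"
  have ex: "\<exists>\<phi>. T \<phi> \<and> sqint ?M (\<lambda>x. (\<phi> x, cgrad \<phi> x)) \<and>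
     (\<integral>x. (norm ((\<phi> x, cgrad \<phi> x) - (u k x, g k x)))\<^sup>2 \<partial>?M) < inverse (real (Suc k))" for k
  proof -
    from H[of k] obtain \<phi> where \<phi>: "\<And>j. T (\<phi> j)" "L2_lim ?M (\<lambda>j x. (\<phi> j x, cgrad (\<phi> j) x)) (\<lambda>x. (u k x, g k x))"
      by (auto simp: H0c_def)
    from order_tendstoD(2)[OF L2_lim_tendsto[OF \<phi>(2)], of "inverse (real (Suc k))"]
    obtain j where "(\<integral>x. (norm ((\<phi> j x, cgrad (\<phi> j) x) - (u k x, g k x)))\<^sup>2 \<partial>?M) < inverse (real (Suc k))"
      by (auto simp: eventually_sequentially)
    with \<phi> show ?thesis by (auto simp: L2_lim_def)
  qed
  define Q where "Q k \<phi> \<longleftrightarrow> T \<phi> \<and> sqint ?M (\<lambda>x. (\<phi> x, cgrad \<phi> x)) \<and>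
     (\<integral>x. (norm ((\<phi> x, cgrad \<phi> x) - (u k x, g k x)))\<^sup>2 \<partial>?M) < inverse (real (Suc k))" for k \<phi>
  have "\<forall>k. \<exists>\<phi>. Q k \<phi>" using ex by (simp add: Q_def)
  from choice[OF this] obtain \<phi> where "\<And>k. Q k (\<phi> k)" by blast
  then have \<phi>: "\<And>k. T (\<phi> k)" "\<And>k. sqint ?M (\<lambda>x. (\<phi> k x, cgrad (\<phi> k) x))"
    "\<And>k. (\<integral>x. (norm ((\<phi> k x, cgrad (\<phi> k) x) - (u k x, g k x)))\<^sup>2 \<partial>?M) < inverse (real (Suc k))"
    unfolding Q_def by blast+
  have "L2_lim ?M (\<lambda>k x. (\<phi> k x, cgrad (\<phi> k) x)) (\<lambda>x. (v x, h x))"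
  proof (rule L2_lim_squeeze)
    let ?e = "\<lambda>k. 2 * inverse (real (Suc k)) + 2 * (\<integral>x. (norm ((u k x, g k x) - (v x, h x)))\<^sup>2 \<partial>?M)"
    have "?e \<longlonglongrightarrow> 2 * 0 + 2 * 0"
      by (rule tendsto_add[OF tendsto_mult_left[OF LIMSEQ_inverse_real_of_nat] tendsto_mult_left[OF L2_lim_tendsto[OF lim]]])
    then show "?e \<longlonglongrightarrow> 0" by simp
    fix k
    have "(\<integral>x. (norm ((\<phi> k x, cgrad (\<phi> k) x) - (v x, h x)))\<^sup>2 \<partial>?M) \<le>
       2 * (\<integral>x. (norm ((\<phi> k x, cgrad (\<phi> k) x) - (u k x, g k x)))\<^sup>2 \<partial>?M) + 2 * (\<integral>x. (norm ((u k x, g k x) - (v x, h x)))\<^sup>2 \<partial>?M)"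
      using lim by (intro sqint_norm_diff_trans \<phi>) (auto simp: L2_lim_def)
    also have "\<dots> \<le> ?e k" using \<phi>(3)[of k] by simp
    finally show "(\<integral>x. (norm ((\<phi> k x, cgrad (\<phi> k) x) - (v x, h x)))\<^sup>2 \<partial>?M) \<le> ?e k" .
  qed (use \<phi> lim in \<open>auto simp: L2_lim_def\<close>)
  with \<phi>(1) show ?thesis unfolding H0c_def by blast
qed

lemma H0_add:
  assumes "H0 \<Omega> u g" "H0 \<Omega> v h"
  shows "H0 \<Omega> (\<lambda>x. u x + v x) (\<lambda>x. g x + h x)"
proof -
  obtain \<phi> where \<phi>: "\<And>k. test_fun \<Omega> (\<phi> k)" "L2_lim (lebesgue_on \<Omega>) \<phi> u" "L2_lim (lebesgue_on \<Omega>) (\<lambda>k. cgrad (\<phi> k)) g"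
    using H0cE[OF assms(1)] by blast
  obtain \<psi> where \<psi>: "\<And>k. test_fun \<Omega> (\<psi> k)" "L2_lim (lebesgue_on \<Omega>) \<psi> v" "L2_lim (lebesgue_on \<Omega>) (\<lambda>k. cgrad (\<psi> k)) h"
    using H0cE[OF assms(2)] by blast
  have eq: "(\<lambda>k. cgrad (\<lambda>x. \<phi> k x + \<psi> k x)) = (\<lambda>k x. cgrad (\<phi> k) x + cgrad (\<psi> k) x)"
    using cgrad_add[OF test_funD(4)[OF \<phi>(1)] test_funD(4)[OF \<psi>(1)]] by (auto simp: fun_eq_iff)
  show ?thesis
  proof (rule H0cI)
    show "test_fun \<Omega> (\<lambda>x. \<phi> k x + \<psi> k x)" for k by (intro test_fun_add \<phi> \<psi>)
    show "L2_lim (lebesgue_on \<Omega>) (\<lambda>k x. \<phi> k x + \<psi> k x) (\<lambda>x. u x + v x)" by (intro L2_lim_add \<phi> \<psi>)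
    show "L2_lim (lebesgue_on \<Omega>) (\<lambda>k. cgrad (\<lambda>x. \<phi> k x + \<psi> k x)) (\<lambda>x. g x + h x)"
      unfolding eq by (intro L2_lim_add \<phi> \<psi>)
  qed
qed

lemma H0_cmult:
  assumes "H0 \<Omega> u g"
  shows "H0 \<Omega> (\<lambda>x. c * u x) (\<lambda>x. c *\<^sub>R g x)"
proof -
  obtain \<phi> where \<phi>: "\<And>k. test_fun \<Omega> (\<phi> k)" "L2_lim (lebesgue_on \<Omega>) \<phi> u" "L2_lim (lebesgue_on \<Omega>) (\<lambda>k. cgrad (\<phi> k)) g"
    using H0cE[OF assms(1)] by blast
  have eq: "(\<lambda>k. cgrad (\<lambda>x. c * \<phi> k x)) = (\<lambda>k x. c *\<^sub>R cgrad (\<phi> k) x)"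
    using cgrad_cmult[OF test_funD(4)[OF \<phi>(1)]] by (auto simp: fun_eq_iff)
  show ?thesis
  proof (rule H0cI)
    show "test_fun \<Omega> (\<lambda>x. c * \<phi> k x)" for k by (intro test_fun_cmult \<phi>)
    show "L2_lim (lebesgue_on \<Omega>) (\<lambda>k x. c * \<phi> k x) (\<lambda>x. c * u x)" using L2_lim_scaleR[OF \<phi>(2)] by simp
    show "L2_lim (lebesgue_on \<Omega>) (\<lambda>k. cgrad (\<lambda>x. c * \<phi> k x)) (\<lambda>x. c *\<^sub>R g x)"
      unfolding eq by (intro L2_lim_scaleR \<phi>)
  qed
qed

lemma H0_uminus: "H0 \<Omega> u g \<Longrightarrow> H0 \<Omega> (\<lambda>x. - u x) (\<lambda>x. - g x)"
  using H0_cmult[of \<Omega> u g "-1"] by simp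

lemma H0_diff: "H0 \<Omega> u g \<Longrightarrow> H0 \<Omega> v h \<Longrightarrow> H0 \<Omega> (\<lambda>x. u x - v x) (\<lambda>x. g x - h x)"
  using H0_add[OF _ H0_uminus, of \<Omega> u g v h] by simp

section \<open>Sobolev functions with zero boundary values and the Poincare inequality\<close>

locale bounded_domain =
  fixes \<Omega> :: "'a::euclidean_space set"
  assumes open_domain: "open \<Omega>" and bounded_domain: "bounded \<Omega>"
begin

abbreviation M :: "'a measure" where "M \<equiv> lebesgue_on \<Omega>"

lemma domain_sets [measurable, simp]: "\<Omega> \<in> sets lebesgue"
  using open_domain by (simp add: borel_open)

lemma finite_M: "finite_measure M"
  using open_domain bounded_domain by (intro finite_measure_lebesgue_on lmeasurable_open)

lemma space_M [simp]: "space M = \<Omega>" by simp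

lemma set_integrable_M: "set_integrable lebesgue \<Omega> f \<longleftrightarrow> integrable M f"
  for f :: "'a \<Rightarrow> 'b::{banach, second_countable_topology}"
  by (simp add: set_integrable_def integrable_restrict_space)

lemma set_integral_M: "(LINT x:\<Omega>|lebesgue. f x) = (\<integral>x. f x \<partial>M)"
  for f :: "'a \<Rightarrow> 'b::{banach, second_countable_topology}"
  by (simp add: set_lebesgue_integral_def integral_restrict_space)

lemma set_measurable_M: "set_borel_measurable lebesgue \<Omega> f \<longleftrightarrow> f \<in> borel_measurable M"
  for f :: "'a \<Rightarrow> 'b::real_normed_vector"
  by (simp add: set_borel_measurable_def borel_measurable_restrict_space_iff)

lemma AE_M: "(AE x in lebesgue. x \<in> \<Omega> \<longrightarrow> P x) \<longleftrightarrow> (AE x in M. P x)"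
  by (simp add: AE_restrict_space_iff)

lemma borel_M: "f \<in> borel_measurable borel \<Longrightarrow> f \<in> borel_measurable M"
  by (intro measurable_restrict_space1 measurable_completion) simp

lemma continuous_M: "continuous_on UNIV f \<Longrightarrow> f \<in> borel_measurable M"
  by (intro borel_M borel_measurable_continuous_onI)

lemma integrable_M_lborel:
  fixes f :: "'a \<Rightarrow> 'b::euclidean_space"
  assumes f: "f \<in> borel_measurable borel" and out: "\<And>x. x \<notin> \<Omega> \<Longrightarrow> f x = 0"
  shows "integrable M f \<longleftrightarrow> integrable lborel f" "(\<integral>x. f x \<partial>M) = (\<integral>x. f x \<partial>lborel)"
proof -
  have "(\<lambda>x. indicator \<Omega> x *\<^sub>R f x) = f" using out by (auto simp: indicator_def)
  then show "integrable M f \<longleftrightarrow> integrable lborel f" "(\<integral>x. f x \<partial>M) = (\<integral>x. f x \<partial>lborel)"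
    using f by (simp_all add: integrable_restrict_space integral_restrict_space integrable_completion integral_completion)
qed

lemma L2_lim_lborel_M:
  assumes "L2_lim lborel X f" shows "L2_lim M X f"
proof -
  have mono: "integrable M h \<and> (\<integral>x. h x \<partial>M) \<le> (\<integral>x. h x \<partial>lborel)"
    if h: "integrable lborel h" "\<And>x. 0 \<le> h x" for h :: "'a \<Rightarrow> real"
  proof -
    have i: "integrable lebesgue h" using h by (subst integrable_completion) auto
    have ii: "integrable lebesgue (\<lambda>x. indicator \<Omega> x *\<^sub>R h x)" by (rule integrable_mult_indicator[OF domain_sets i])
    have "(\<integral>x. indicator \<Omega> x *\<^sub>R h x \<partial>lebesgue) \<le> (\<integral>x. h x \<partial>lebesgue)"
      using ii i h by (intro integral_mono) (auto simp: indicator_def)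
    also have "\<dots> = (\<integral>x. h x \<partial>lborel)" using h by (intro integral_completion) auto
    finally show ?thesis using ii by (simp add: integrable_restrict_space integral_restrict_space)
  qed
  have s: "sqint M h" if "sqint lborel h" for h :: "'a \<Rightarrow> 'b"
    using that mono[of "\<lambda>x. (norm (h x))\<^sup>2"] by (auto simp: sqint_def intro: borel_M)
  show ?thesis
  proof (rule L2_lim_squeeze[OF _ _ L2_lim_tendsto[OF assms]])
    fix n
    show "(\<integral>x. (norm (X n x - f x))\<^sup>2 \<partial>M) \<le> (\<integral>x. (norm (X n x - f x))\<^sup>2 \<partial>lborel)"
      using assms mono[of "\<lambda>x. (norm (X n x - f x))\<^sup>2"] sqint_integrable[OF sqint_diff[of lborel "X n" f]]
      by (auto simp: L2_lim_def)
  qed (use assms s in \<open>auto simp: L2_lim_def\<close>)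
qed

lemma test_fun_sqint:
  assumes "test_fun \<Omega>' \<phi>" shows "sqint M \<phi>" "sqint M (cgrad \<phi>)"
proof -
  obtain B where "\<And>x. \<bar>\<phi> x\<bar> \<le> B" "\<And>x. norm (cgrad \<phi> x) \<le> B" using test_fun_bounded[OF assms] by metis
  then show "sqint M \<phi>" "sqint M (cgrad \<phi>)"
    using test_funD[OF assms] by (auto intro!: sqint_finite_bounded[OF finite_M, where C = B] continuous_M smooth_cgrad_continuous)
qed

lemma H0_test: "test_fun \<Omega> \<phi> \<Longrightarrow> H0 \<Omega> \<phi> (cgrad \<phi>)"
  by (rule H0cI[where \<phi> = "\<lambda>_. \<phi>"]) (auto intro: L2_lim_const test_fun_sqint)

lemma test_fun_parts:
  assumes \<phi>: "test_fun \<Omega> \<phi>" and \<psi>: "test_fun \<Omega> \<psi>" and i: "i \<in> Basis"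
  shows "(\<integral>x. \<phi> x * partial i \<psi> x \<partial>M) = - (\<integral>x. partial i \<phi> x * \<psi> x \<partial>M)"
proof -
  let ?p = "\<lambda>x. \<phi> x * \<psi> x"
  have t: "test_fun \<Omega> ?p" using test_fun_mult[OF \<phi> test_funD(1)[OF \<psi>]] .
  have eq: "partial i ?p x = \<phi> x * partial i \<psi> x + partial i \<phi> x * \<psi> x" for x
    using i cgrad_mult[OF test_funD(4)[OF \<phi>] test_funD(4)[OF \<psi>]]
    by (simp add: partial_eq_cgrad inner_add_left)
  have "0 = (\<integral>x. partial i ?p x \<partial>M)"
    using integral_partial_test_fun[OF t i] test_funD(6)[OF test_fun_partial[OF t i]]
    by (subst integrable_M_lborel) (auto intro: test_fun_borel[OF test_fun_partial[OF t i]])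
  also have "\<dots> = (\<integral>x. \<phi> x * partial i \<psi> x \<partial>M) + (\<integral>x. partial i \<phi> x * \<psi> x \<partial>M)"
    unfolding eq by (intro Bochner_Integration.integral_add sqint_mult_integrable test_fun_sqint[OF \<phi>]
        test_fun_sqint[OF \<psi>] test_fun_sqint[OF test_fun_partial[OF \<phi> i]] test_fun_sqint[OF test_fun_partial[OF \<psi> i]])
  finally show ?thesis by simp
qed

lemma sqint_inner_const: "sqint M g \<Longrightarrow> sqint M (\<lambda>x. g x \<bullet> c)" for g :: "'a \<Rightarrow> 'a"
proof (rule sqint_dominated[where g = g and C = "norm c"])
  show "AE x in M. norm (g x \<bullet> c) \<le> norm c * norm (g x)"
    using Cauchy_Schwarz_ineq2[of "g _" c] by (intro AE_I2) (simp add: mult.commute)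
qed (auto simp: sqint_def)

lemma weak_gradientI:
  assumes "sqint M u" "sqint M g"
    "\<And>\<phi> i. test_fun \<Omega> \<phi> \<Longrightarrow> i \<in> Basis \<Longrightarrow> (\<integral>x. u x * partial i \<phi> x \<partial>M) = - (\<integral>x. (g x \<bullet> i) * \<phi> x \<partial>M)"
  shows "weak_gradient \<Omega> u g"
  unfolding weak_gradient_def set_integrable_M set_integral_M set_measurable_M
  using assms by (auto intro!: sqint_mult_integrable test_fun_sqint(1) test_fun_partial sqint_inner_const simp: sqint_measurable)

lemma weak_gradientD:
  assumes "weak_gradient \<Omega> u g"
  shows "g \<in> borel_measurable M"
    "test_fun \<Omega> \<phi> \<Longrightarrow> i \<in> Basis \<Longrightarrow> integrable M (\<lambda>x. u x * partial i \<phi> x)"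
    "test_fun \<Omega> \<phi> \<Longrightarrow> i \<in> Basis \<Longrightarrow> integrable M (\<lambda>x. (g x \<bullet> i) * \<phi> x)"
    "test_fun \<Omega> \<phi> \<Longrightarrow> i \<in> Basis \<Longrightarrow> (\<integral>x. u x * partial i \<phi> x \<partial>M) = - (\<integral>x. (g x \<bullet> i) * \<phi> x \<partial>M)"
  using assms unfolding weak_gradient_def set_integrable_M set_integral_M set_measurable_M by auto

lemma H0_weak_gradient:
  assumes H: "H0 \<Omega> u g" shows "weak_gradient \<Omega> u g"
proof (rule weak_gradientI[OF H0c_sqint[OF H]])
  fix \<psi> i assume \<psi>: "test_fun \<Omega> \<psi>" and i: "(i::'a) \<in> Basis"
  obtain \<phi> where \<phi>: "\<And>k. test_fun \<Omega> (\<phi> k)" "L2_lim M \<phi> u" "L2_lim M (\<lambda>k. cgrad (\<phi> k)) g"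
    using H0cE[OF H] by blast
  have l1: "(\<lambda>k. \<integral>x. partial i \<psi> x \<bullet> \<phi> k x \<partial>M) \<longlonglongrightarrow> (\<integral>x. partial i \<psi> x \<bullet> u x \<partial>M)"
    by (rule L2_lim_inner_right[OF \<phi>(2) test_fun_sqint(1)[OF test_fun_partial[OF \<psi> i]]])
  have "(\<lambda>k. \<integral>x. (\<psi> x *\<^sub>R i) \<bullet> cgrad (\<phi> k) x \<partial>M) \<longlonglongrightarrow> (\<integral>x. (\<psi> x *\<^sub>R i) \<bullet> g x \<partial>M)"
    by (rule L2_lim_inner_right[OF \<phi>(3)], rule sqint_dominated[OF test_fun_sqint(1)[OF \<psi>], where C = 1])
      (use i sqint_measurable[OF test_fun_sqint(1)[OF \<psi>]] in auto)
  then have l2: "(\<lambda>k. - (\<integral>x. (\<psi> x *\<^sub>R i) \<bullet> cgrad (\<phi> k) x \<partial>M)) \<longlonglongrightarrow> - (\<integral>x. (\<psi> x *\<^sub>R i) \<bullet> g x \<partial>M)"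
    by (rule tendsto_minus)
  have eq: "(\<integral>x. partial i \<psi> x \<bullet> \<phi> k x \<partial>M) = - (\<integral>x. (\<psi> x *\<^sub>R i) \<bullet> cgrad (\<phi> k) x \<partial>M)" for k
    using test_fun_parts[OF \<phi>(1) \<psi> i, of k] i
    by (simp add: cgrad_inner_Basis inner_commute[of i] mult.commute)
  have "(\<integral>x. partial i \<psi> x \<bullet> u x \<partial>M) = - (\<integral>x. (\<psi> x *\<^sub>R i) \<bullet> g x \<partial>M)"
    using l1 l2 unfolding eq by (rule LIMSEQ_unique)
  then show "(\<integral>x. u x * partial i \<psi> x \<partial>M) = - (\<integral>x. (g x \<bullet> i) * \<psi> x \<partial>M)"
    by (simp add: inner_commute[of i] mult.commute)
qed

lemma poincare_test:
  obtains P where "P > 0" "\<And>\<phi>. test_fun \<Omega> \<phi> \<Longrightarrow> (\<integral>x. (norm (\<phi> x))\<^sup>2 \<partial>M) \<le> P * (\<integral>x. (norm (cgrad \<phi> x))\<^sup>2 \<partial>M)"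
proof -
  obtain R where R: "R > 0" "\<And>x. x \<in> \<Omega> \<Longrightarrow> norm x \<le> R"
    using bounded_domain by (auto simp: bounded_pos)
  have "(\<integral>x. (norm (\<phi> x))\<^sup>2 \<partial>M) \<le> 4 * R\<^sup>2 * (\<integral>x. (norm (cgrad \<phi> x))\<^sup>2 \<partial>M)" if t: "test_fun \<Omega> \<phi>" for \<phi>
  proof -
    obtain i :: 'a where i: "i \<in> Basis" using nonempty_Basis by blast
    \<comment> \<open>Integrate the \<open>i\<close>-th partial derivative of \<open>(x \<bullet> i) * \<phi> x\<^sup>2\<close>.\<close>
    let ?p = "\<lambda>x. (\<phi> x * \<phi> x) * (x \<bullet> i)"
    have t2: "test_fun \<Omega> (\<lambda>x. \<phi> x * \<phi> x)" by (rule test_fun_mult[OF t test_funD(1)[OF t]])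
    have tp: "test_fun \<Omega> ?p" by (rule test_fun_mult[OF t2 smooth_inner_const])
    have eq: "partial i ?p x = (\<phi> x)\<^sup>2 + 2 * (x \<bullet> i) * \<phi> x * (cgrad \<phi> x \<bullet> i)" for x
    proof -
      have "cgrad ?p x = (\<phi> x * \<phi> x) *\<^sub>R i + (x \<bullet> i) *\<^sub>R (\<phi> x *\<^sub>R cgrad \<phi> x + \<phi> x *\<^sub>R cgrad \<phi> x)"
        by (simp only: cgrad_mult[OF test_funD(4)[OF t2] smooth_onD(1)[OF smooth_inner_const]]
            cgrad_mult[OF test_funD(4)[OF t] test_funD(4)[OF t]] cgrad_inner_const)
      then show ?thesis
        using i by (simp add: cgrad_inner_Basis[symmetric] inner_add_left algebra_simps power2_eq_square)
    qed
    have "0 = (\<integral>x. partial i ?p x \<partial>M)"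
      using integral_partial_test_fun[OF tp i] test_funD(6)[OF test_fun_partial[OF tp i]]
      by (subst integrable_M_lborel) (auto intro: test_fun_borel[OF test_fun_partial[OF tp i]])
    also have "\<dots> \<ge> (\<integral>x. 1 / 2 * (norm (\<phi> x))\<^sup>2 - 2 * R\<^sup>2 * (norm (cgrad \<phi> x))\<^sup>2 \<partial>M)"
    proof (rule integral_mono)
      show "integrable M (partial i ?p)"
        using sqint_finite_integrable[OF finite_M test_fun_sqint(1)[OF test_fun_partial[OF tp i]]] .
      show "integrable M (\<lambda>x. 1 / 2 * (norm (\<phi> x))\<^sup>2 - 2 * R\<^sup>2 * (norm (cgrad \<phi> x))\<^sup>2)"
        using test_fun_sqint[OF t] by (auto simp: sqint_def)
      fix x assume "x \<in> space M"
      then have x: "norm x \<le> R" using R by simp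
      define s where "s = (x \<bullet> i) * (cgrad \<phi> x \<bullet> i)"
      have "\<bar>s\<bar> \<le> R * norm (cgrad \<phi> x)"
      proof -
        have "\<bar>x \<bullet> i\<bar> \<le> R" "\<bar>cgrad \<phi> x \<bullet> i\<bar> \<le> norm (cgrad \<phi> x)"
          using i x Basis_le_norm[of i x] Basis_le_norm[of i "cgrad \<phi> x"] by auto
        then show ?thesis using R by (auto simp: s_def abs_mult intro!: mult_mono)
      qed
      then have "s\<^sup>2 \<le> (R * norm (cgrad \<phi> x))\<^sup>2"
        by (metis abs_ge_zero power2_abs power_mono)
      \<comment> \<open>The derivative is \<phi>^2 + 2 s \<phi>, and half of this square bounds it
        from below by \<phi>^2/2 - 2 s^2. After integration the Poincare constant becomes
        \<open>4 * R\<^sup>2\<close>.\<close>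
      moreover have "0 \<le> (\<phi> x + 2 * s)\<^sup>2" by simp
      ultimately show "1 / 2 * (norm (\<phi> x))\<^sup>2 - 2 * R\<^sup>2 * (norm (cgrad \<phi> x))\<^sup>2 \<le> partial i ?p x"
        unfolding eq s_def by (simp add: power2_eq_square algebra_simps)
    qed
    also have "(\<integral>x. 1 / 2 * (norm (\<phi> x))\<^sup>2 - 2 * R\<^sup>2 * (norm (cgrad \<phi> x))\<^sup>2 \<partial>M) =
        1 / 2 * (\<integral>x. (norm (\<phi> x))\<^sup>2 \<partial>M) - 2 * R\<^sup>2 * (\<integral>x. (norm (cgrad \<phi> x))\<^sup>2 \<partial>M)"
      using test_fun_sqint[OF t] by (subst Bochner_Integration.integral_diff) (auto simp: sqint_def)
    finally show ?thesis by simp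
  qed
  then show thesis using R that[of "4 * R\<^sup>2"] by simp
qed

lemma poincare:
  obtains P where "P > 0" "\<And>u g. H0 \<Omega> u g \<Longrightarrow> (\<integral>x. (norm (u x))\<^sup>2 \<partial>M) \<le> P * (\<integral>x. (norm (g x))\<^sup>2 \<partial>M)"
proof -
  obtain P where P: "P > 0" "\<And>\<phi>. test_fun \<Omega> \<phi> \<Longrightarrow> (\<integral>x. (norm (\<phi> x))\<^sup>2 \<partial>M) \<le> P * (\<integral>x. (norm (cgrad \<phi> x))\<^sup>2 \<partial>M)"
    using poincare_test by blast
  have "(\<integral>x. (norm (u x))\<^sup>2 \<partial>M) \<le> P * (\<integral>x. (norm (g x))\<^sup>2 \<partial>M)" if H: "H0 \<Omega> u g" for u g
  proof -
    obtain \<phi> where \<phi>: "\<And>k. test_fun \<Omega> (\<phi> k)" "L2_lim M \<phi> u" "L2_lim M (\<lambda>k. cgrad (\<phi> k)) g"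
    using H0cE[OF H] by blast
    show ?thesis
      by (rule LIMSEQ_le[OF L2_lim_norm_power2[OF \<phi>(2)] tendsto_mult_left[OF L2_lim_norm_power2[OF \<phi>(3)]]])
        (use P(2)[OF \<phi>(1)] in blast)
  qed
  with P(1) that show thesis by blast
qed

end

section \<open>Uniqueness of weak gradients and localisation by cut-offs\<close>

lemma L2_lim_sum:
  assumes "finite I" "\<And>i. i \<in> I \<Longrightarrow> L2_lim M (X i) (f i)"
  shows "L2_lim M (\<lambda>n x. \<Sum>i\<in>I. X i n x) (\<lambda>x. \<Sum>i\<in>I. f i x)"
  using assms by (induction I rule: finite_induct) (auto intro!: L2_lim_add L2_lim_const)

lemma H0c_mono: "H0c T \<Omega> u g \<Longrightarrow> (\<And>\<phi>. T \<phi> \<Longrightarrow> T' \<phi>) \<Longrightarrow> H0c T' \<Omega> u g"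
  unfolding H0c_def by blast

context bounded_domain
begin

lemma AE_lborel_M: "(AE x in lborel. P x) \<Longrightarrow> (AE x in M. P x)"
proof -
  assume "AE x in lborel. P x"
  then have "AE x in lebesgue. P x" by (rule AE_completion)
  then have "AE x in lebesgue. x \<in> \<Omega> \<longrightarrow> P x" by eventually_elim simp
  then show ?thesis by (simp only: AE_M)
qed

text \<open>Sobolev functions are only Lebesgue measurable, while the convolution theory is set up
  for \<open>lborel\<close>. The representative is kept zero off C everywhere, not just almost
  everywhere, so that its mollifications have compact support in the domain.\<close>

lemma borel_representative:
  fixes f :: "'a \<Rightarrow> real"
  assumes f: "f \<in> borel_measurable M" and C: "compact C" "\<And>x. x \<notin> C \<Longrightarrow> f x = 0"
  obtains f' where "f' \<in> borel_measurable borel" "\<And>x. x \<notin> C \<Longrightarrow> f' x = 0" "AE x in M. f x = f' x"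
proof -
  have "(\<lambda>x. indicator \<Omega> x *\<^sub>R f x) \<in> borel_measurable lebesgue"
    using f by (subst (asm) borel_measurable_restrict_space_iff) auto
  from completion_ex_borel_measurable_real[OF this] obtain f1
    where f1: "f1 \<in> borel_measurable lborel" "AE x in lborel. indicator \<Omega> x *\<^sub>R f x = f1 x" by auto
  have [measurable]: "C \<in> sets borel" using C by (simp add: compact_imp_closed borel_closed)
  show thesis
  proof (rule that[of "\<lambda>x. indicator C x * f1 x"])
    show "(\<lambda>x. indicator C x * f1 x) \<in> borel_measurable borel" using f1(1) by simp
    have "AE x in lebesgue. x \<in> \<Omega> \<longrightarrow> f x = indicator C x * f1 x"
      using AE_completion[OF f1(2)] by eventually_elim (auto simp: indicator_def C(2))
    then show "AE x in M. f x = indicator C x * f1 x" by (simp only: AE_M)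
  qed simp
qed

lemma representative_lborel:
  fixes f :: "'a \<Rightarrow> real"
  assumes "f \<in> borel_measurable borel" "\<And>x. x \<notin> C \<Longrightarrow> f x = 0" "C \<subseteq> \<Omega>" "sqint M f"
  shows "integrable lborel f" "sqint lborel f"
proof -
  have out: "f x = 0" if "x \<notin> \<Omega>" for x using that assms by auto
  show "integrable lborel f"
    using sqint_finite_integrable[OF finite_M assms(4)] integrable_M_lborel[OF assms(1) out] by simp
  have "integrable M (\<lambda>x. (norm (f x))\<^sup>2)" using assms(4) by (simp add: sqint_def)
  then have "integrable lborel (\<lambda>x. (norm (f x))\<^sup>2)"
    using assms(1) out by (subst (asm) integrable_M_lborel) auto
  then show "sqint lborel f" using assms(1) by (simp add: sqint_def)
qed

lemma mollify_test_fun: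
  assumes f: "integrable lborel f" and C: "compact C" "\<And>x. x \<notin> C \<Longrightarrow> f x = 0"
    and d: "\<And>x y. y \<in> C \<Longrightarrow> dist x y \<le> d \<Longrightarrow> x \<in> \<Omega>" "inverse (real (Suc n)) \<le> d"
  shows "test_fun \<Omega> (mollify f n)"
    and "mollify f n x \<noteq> 0 \<Longrightarrow> \<exists>y\<in>C. dist x y \<le> d"
proof -
  let ?e = "inverse (real (Suc n))"
  have e: "?e > 0" by simp
  have m0: "\<And>z::'a. ?e \<le> norm z \<Longrightarrow> moll ?e z = 0" using moll_eq_0[OF e] by blast
  show "test_fun \<Omega> (mollify f n)"
    unfolding mollify_def
    by (rule test_fun_conv[OF f test_fun_moll[OF e] C m0]) (use d in force)+
  show "\<exists>y\<in>C. dist x y \<le> d" if "mollify f n x \<noteq> 0"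
  proof (rule ccontr)
    assume "\<not> ?thesis"
    then have "?e \<le> dist x y" if "y \<in> C" for y using that d(2) by fastforce
    then have "mollify f n x = 0" unfolding mollify_def by (intro conv_eq_0[where C = C and e = ?e] C(2) m0)
    with that show False by simp
  qed
qed

text \<open>The fundamental lemma of the calculus of variations. Testing with mollifications of the
  sign of h on K yields in the limit the integral of |h| over K. Since h is integrable only against
  test functions, the cut-off \<zeta>, equal to 1 on all supports involved, provides the
  majorant.\<close>

lemma AE_zero_on_compact:
  assumes h: "h \<in> borel_measurable M" and hi: "\<And>\<phi>. test_fun \<Omega> \<phi> \<Longrightarrow> integrable M (\<lambda>x. h x * \<phi> x)"
    and h0: "\<And>\<phi>. test_fun \<Omega> \<phi> \<Longrightarrow> (\<integral>x. h x * \<phi> x \<partial>M) = 0"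
    and K: "compact K" "K \<subseteq> \<Omega>"
  shows "AE x in M. x \<in> K \<longrightarrow> h x = (0::real)"
proof -
  note [measurable] = h
  obtain \<zeta> d where \<zeta>: "test_fun \<Omega> \<zeta>" "\<And>x. 0 \<le> \<zeta> x" and d: "d > 0"
    "\<And>x y. y \<in> K \<Longrightarrow> dist x y \<le> d \<Longrightarrow> x \<in> \<Omega> \<and> \<zeta> x = 1 \<and> cgrad \<zeta> x = 0"
    using cutoff_exists[OF K(1) open_domain K(2)] by blast
  have [measurable]: "K \<in> sets borel" using K by (simp add: compact_imp_closed borel_closed)
  have [measurable]: "(indicator K :: 'a \<Rightarrow> real) \<in> borel_measurable M" by (intro borel_M) simp
  have sm: "(\<lambda>x. indicator K x * sgn (h x)) \<in> borel_measurable M" by measurable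
  obtain s1 where s1: "s1 \<in> borel_measurable borel" "\<And>x. x \<notin> K \<Longrightarrow> s1 x = 0" "AE x in M. indicator K x * sgn (h x) = s1 x"
    using borel_representative[OF sm K(1)] by auto
  \<comment> \<open>The Borel representative agrees with the sign only almost everywhere; clamping
    restores the bound 1 at every point, as \<open>conv_moll_bounded\<close> requires.\<close>
  define s where "s x = max (-1) (min 1 (s1 x))" for x
  have sB [measurable]: "s \<in> borel_measurable borel" unfolding s_def[abs_def] using s1(1) by measurable
  have sK: "s x = 0" if "x \<notin> K" for x using s1(2)[OF that] by (simp add: s_def)
  have sb: "\<bar>s x\<bar> \<le> 1" for x by (auto simp: s_def)
  have sAE: "AE x in M. s x = indicator K x * sgn (h x)"
    using s1(3)
  proof eventually_elim
    case (elim x)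
    have "\<bar>indicator K x * sgn (h x)\<bar> \<le> 1" by (auto simp: indicator_def sgn_if)
    with elim show ?case by (simp add: s_def)
  qed
  have sqs: "sqint M s" by (rule sqint_finite_bounded[OF finite_M borel_M]) (use sb in auto)
  have s: "integrable lborel s" "sqint lborel s"
    using representative_lborel[OF sB sK K(2) sqs] by auto
  obtain r :: "nat \<Rightarrow> nat" where r: "strict_mono r" "AE x in lborel. (\<lambda>n. mollify s (r n) x) \<longlonglongrightarrow> s x"
    using L2_lim_AE_subseq[OF mollify_L2_lim[OF s]] by auto
  obtain N where N: "inverse (real (Suc N)) < d" using d(1) reals_Archimedean by blast
  have rn: "inverse (real (Suc (r (n + N)))) \<le> d" for n
  proof -
    have "N \<le> r (n + N)" using seq_suble[OF r(1), of "n + N"] by linarith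
    then have "inverse (real (Suc (r (n + N)))) \<le> inverse (real (Suc N))" by simp
    then show ?thesis using N by linarith
  qed
  define \<phi> where "\<phi> n = mollify s (r (n + N))" for n
  have d': "\<And>x y. y \<in> K \<Longrightarrow> dist x y \<le> d \<Longrightarrow> x \<in> \<Omega>" using d(2) by blast
  have \<phi>: "test_fun \<Omega> (\<phi> n)" for n
    unfolding \<phi>_def by (rule mollify_test_fun(1)[where C = K and d = d]) (fact s K sK d' rn)+
  have \<phi>\<zeta>: "\<zeta> x = 1" if "\<phi> n x \<noteq> 0" for n x
  proof -
    have "\<exists>y\<in>K. dist x y \<le> d"
      by (rule mollify_test_fun(2)[where C = K and d = d and f = s and n = "r (n + N)"])
        (fact s K sK d' rn that[unfolded \<phi>_def])+
    then show ?thesis using d(2) by blast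
  qed
  have \<phi>b: "\<bar>\<phi> n x\<bar> \<le> 1" for n x
    unfolding \<phi>_def mollify_def by (rule conv_moll_bounded) (use s sb in auto)
  have eq: "h x * \<phi> n x = (h x * \<zeta> x) * \<phi> n x" for n x using \<phi>\<zeta>[of n x] by (cases "\<phi> n x = 0") auto
  have "(\<lambda>n. \<integral>x. (h x * \<zeta> x) * \<phi> n x \<partial>M) \<longlonglongrightarrow> (\<integral>x. (h x * \<zeta> x) * s x \<partial>M)"
  proof (rule integral_dominated_convergence[where w = "\<lambda>x. \<bar>h x * \<zeta> x\<bar>"])
    show "integrable M (\<lambda>x. \<bar>h x * \<zeta> x\<bar>)" using hi[OF \<zeta>(1)] by auto
    show "AE x in M. (\<lambda>n. h x * \<zeta> x * \<phi> n x) \<longlonglongrightarrow> h x * \<zeta> x * s x"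
      using AE_lborel_M[OF r(2)]
    proof eventually_elim
      case (elim x)
      then have "(\<lambda>n. \<phi> n x) \<longlonglongrightarrow> s x" unfolding \<phi>_def by (rule LIMSEQ_ignore_initial_segment)
      then show ?case by (rule tendsto_mult_left)
    qed
    show "AE x in M. norm (h x * \<zeta> x * \<phi> n x) \<le> \<bar>h x * \<zeta> x\<bar>" for n
      using \<phi>b by (auto simp: abs_mult mult_left_le)
    have "\<zeta> \<in> borel_measurable M" "\<And>n. \<phi> n \<in> borel_measurable M" "s \<in> borel_measurable M"
      using borel_M[OF test_fun_borel[OF \<zeta>(1)]] borel_M[OF test_fun_borel[OF \<phi>]] borel_M[OF sB] by auto
    then show "(\<lambda>x. h x * \<zeta> x * s x) \<in> borel_measurable M" "\<And>n. (\<lambda>x. h x * \<zeta> x * \<phi> n x) \<in> borel_measurable M"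
      by auto
  qed
  moreover have "(\<integral>x. (h x * \<zeta> x) * \<phi> n x \<partial>M) = 0" for n
    using h0[OF \<phi>[of n]] by (simp only: eq)
  ultimately have int0: "(\<integral>x. (h x * \<zeta> x) * s x \<partial>M) = 0"
    by (simp add: LIMSEQ_const_iff)
  have sM: "s \<in> borel_measurable M" "\<zeta> \<in> borel_measurable M" 
    using borel_M[OF test_fun_borel[OF \<zeta>(1)]] borel_M[OF sB] by auto
  have pos: "AE x in M. (h x * \<zeta> x) * s x = (if x \<in> K then \<bar>h x\<bar> else 0)"
    using sAE
  proof eventually_elim
    case (elim x)
    have "\<zeta> x = 1" if "x \<in> K" using d(2)[OF that, of x] d(1) by simp
    then show ?case using elim by (auto simp: indicator_def abs_sgn)
  qed
  have "integrable M (\<lambda>x. (h x * \<zeta> x) * s x)"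
    by (rule Bochner_Integration.integrable_bound[OF hi[OF \<zeta>(1)]])
      (use sb sM in \<open>auto simp: abs_mult mult_left_le\<close>)
  moreover have "AE x in M. 0 \<le> (h x * \<zeta> x) * s x" using pos by eventually_elim auto
  ultimately have "AE x in M. (h x * \<zeta> x) * s x = 0"
    using int0 integral_nonneg_eq_0_iff_AE by blast
  with pos show ?thesis by eventually_elim auto
qed

lemma AE_zero_of_test:
  assumes "h \<in> borel_measurable M" "\<And>\<phi>. test_fun \<Omega> \<phi> \<Longrightarrow> integrable M (\<lambda>x. h x * \<phi> x)"
    "\<And>\<phi>. test_fun \<Omega> \<phi> \<Longrightarrow> (\<integral>x. h x * \<phi> x \<partial>M) = 0"
  shows "AE x in M. h x = (0::real)"
proof -
  obtain C :: "nat \<Rightarrow> 'a set" where C: "\<And>n. compact (C n)" "\<And>n. C n \<subseteq> \<Omega>" "\<Union>(range C) = \<Omega>"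
    using open_Union_compact_subsets[OF open_domain] by metis
  have "AE x in M. \<forall>n. x \<in> C n \<longrightarrow> h x = 0"
    unfolding AE_all_countable using AE_zero_on_compact[OF assms C(1,2)] by blast
  then show ?thesis
    using AE_space
  proof eventually_elim
    case (elim x)
    then have "x \<in> \<Union>(range C)" using C(3) by simp
    with elim show ?case by blast
  qed
qed

text \<open>Membership in W^{1,2}, approximation by test functions and the equation each assert the
  existence of some weak gradient. Uniqueness lets one gradient serve all of them.\<close>

lemma weak_gradient_unique:
  assumes g: "weak_gradient \<Omega> u g" and g': "weak_gradient \<Omega> u g'"
  shows "AE x in M. g x = g' x"
proof -
  note [measurable] = weak_gradientD(1)[OF g] weak_gradientD(1)[OF g']
  have "AE x in M. g x \<bullet> i - g' x \<bullet> i = 0" if i: "i \<in> Basis" for i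
  proof (rule AE_zero_of_test)
    fix \<phi> assume t: "test_fun \<Omega> \<phi>"
    note ints = weak_gradientD(3)[OF g t i] weak_gradientD(3)[OF g' t i]
    show "integrable M (\<lambda>x. (g x \<bullet> i - g' x \<bullet> i) * \<phi> x)"
      unfolding left_diff_distrib by (rule Bochner_Integration.integrable_diff[OF ints])
    show "(\<integral>x. (g x \<bullet> i - g' x \<bullet> i) * \<phi> x \<partial>M) = 0"
      unfolding left_diff_distrib Bochner_Integration.integral_diff[OF ints]
      using weak_gradientD(4)[OF g t i] weak_gradientD(4)[OF g' t i] by simp
  qed measurable
  then have "AE x in M. \<forall>i\<in>Basis. g x \<bullet> i - g' x \<bullet> i = 0"
    by (intro AE_finite_allI) auto
  then show ?thesis by eventually_elim (auto intro: euclidean_eqI)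
qed

lemma L2_on_M: "L2_on \<Omega> u \<longleftrightarrow> sqint M u"
  unfolding L2_on_def set_integrable_M set_measurable_M sqint_def by simp

lemma W12_M: "W12 \<Omega> u \<longleftrightarrow> (\<exists>g. sqint M u \<and> sqint M g \<and> weak_gradient \<Omega> u g)"
  unfolding W12_def L2_on_M set_integrable_M sqint_def using weak_gradientD(1) by blast

text \<open>The gradient approximated in \<open>W012\<close> is not itself assumed square
  integrable, and without that the vanishing of the integrals would mean little. Uniqueness
  transfers square integrability from the gradient supplied by \<open>W12\<close>.\<close>

lemma W012_M: "W012 \<Omega> u \<longleftrightarrow> (\<exists>g. H0 \<Omega> u g)"
proof
  assume u: "W012 \<Omega> u"
  then obtain g \<phi> where g: "weak_gradient \<Omega> u g" "\<And>k. test_fun \<Omega> (\<phi> k)"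
    "(\<lambda>k. \<integral>x. (norm (u x - \<phi> k x))\<^sup>2 \<partial>M) \<longlonglongrightarrow> 0" "(\<lambda>k. \<integral>x. (norm (g x - cgrad (\<phi> k) x))\<^sup>2 \<partial>M) \<longlonglongrightarrow> 0"
    unfolding W012_def set_integral_M by auto
  from u obtain g1 where g1: "sqint M u" "sqint M g1" "weak_gradient \<Omega> u g1"
    unfolding W012_def W12_M by blast
  have "sqint M g"
    by (rule sqint_cong_AE[OF g1(2) weak_gradient_unique[OF g1(3) g(1)] weak_gradientD(1)[OF g(1)]])
  then have "H0 \<Omega> u g"
    using g g1(1) test_fun_sqint[OF g(2)]
    by (intro H0cI[where \<phi> = \<phi>] L2_limI) (auto simp: norm_minus_commute power2_commute)
  then show "\<exists>g. H0 \<Omega> u g" by blast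
next
  assume "\<exists>g. H0 \<Omega> u g"
  then obtain g where g: "H0 \<Omega> u g" by blast
  obtain \<phi> where \<phi>: "\<And>k. test_fun \<Omega> (\<phi> k)" "L2_lim M \<phi> u" "L2_lim M (\<lambda>k. cgrad (\<phi> k)) g"
    using H0cE[OF g] by blast
  show "W012 \<Omega> u"
    unfolding W012_def set_integral_M W12_M
  proof (intro conjI exI)
    show "sqint M u" "sqint M g" "weak_gradient \<Omega> u g" "weak_gradient \<Omega> u g"
      using H0c_sqint[OF g] H0_weak_gradient[OF g] by auto
    show "\<forall>k. test_fun \<Omega> (\<phi> k)" using \<phi> by blast
    show "(\<lambda>k. \<integral>x. (u x - \<phi> k x)\<^sup>2 \<partial>M) \<longlonglongrightarrow> 0"
      using L2_lim_tendsto[OF \<phi>(2)] by (simp add: power2_commute)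
    show "(\<lambda>k. \<integral>x. (norm (g x - cgrad (\<phi> k) x))\<^sup>2 \<partial>M) \<longlonglongrightarrow> 0"
      using L2_lim_tendsto[OF \<phi>(3)] by (simp add: norm_minus_commute)
  qed
qed

lemma H0_unique_gradient:
  assumes "H0 \<Omega> u k" "weak_gradient \<Omega> u g"
  shows "H0 \<Omega> u g"
  by (rule H0c_cong_AE[OF assms(1) _ weak_gradient_unique[OF H0_weak_gradient[OF assms(1)] assms(2)]])
    (use H0c_sqint[OF assms(1)] weak_gradientD(1)[OF assms(2)] in \<open>auto simp: sqint_def\<close>)

text \<open>A cut-off moves a function that is merely of class W^{1,2} into the closure of the test
  functions, where chain rule and Poincare inequality are available. Its mollifications approximate
  it because differentiating them amounts to mollifying the product-rule gradient.\<close>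

lemma H0_cutoff_mult:
  assumes w: "sqint M w" and h: "sqint M h" and wh: "weak_gradient \<Omega> w h" and \<zeta>: "test_fun \<Omega> \<zeta>"
  shows "H0 \<Omega> (\<lambda>x. \<zeta> x * w x) (\<lambda>x. \<zeta> x *\<^sub>R h x + w x *\<^sub>R cgrad \<zeta> x)"
proof -
  define C where "C = closure {x. \<zeta> x \<noteq> 0}"
  have C: "compact C" "C \<subseteq> \<Omega>" using test_funD[OF \<zeta>] by (auto simp: C_def)
  have out: "\<zeta> x = 0" "cgrad \<zeta> x = 0" if "x \<notin> C" for x
    using that closure_subset[of "{x. \<zeta> x \<noteq> 0}"] cgrad_zero_outside[of x \<zeta>] by (auto simp: C_def)
  obtain B where B: "\<And>x. \<bar>\<zeta> x\<bar> \<le> B" "\<And>x. norm (cgrad \<zeta> x) \<le> B" using test_fun_bounded[OF \<zeta>] by metis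
  have \<zeta>M: "\<zeta> \<in> borel_measurable M" "cgrad \<zeta> \<in> borel_measurable M"
    using test_fun_sqint[OF \<zeta>] by (auto simp: sqint_def)
  define U0 where "U0 x = \<zeta> x * w x" for x
  define G0 where "G0 x = \<zeta> x *\<^sub>R h x + w x *\<^sub>R cgrad \<zeta> x" for x
  have U0s: "sqint M U0"
    unfolding U0_def[abs_def] using sqint_bounded_scaleR[OF w \<zeta>M(1), of B] B by simp
  have "sqint M (\<lambda>x. w x *\<^sub>R cgrad \<zeta> x)"
  proof (rule sqint_dominated[OF w, where C = B])
    show "AE x in M. norm (w x *\<^sub>R cgrad \<zeta> x) \<le> B * norm (w x)"
      using mult_right_mono[OF B(2) abs_ge_zero, of _ "w _"] by (intro AE_I2) (simp add: mult.commute)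
  qed (use w \<zeta>M in \<open>auto simp: sqint_def\<close>)
  then have G0s: "sqint M G0"
    unfolding G0_def[abs_def] using sqint_bounded_scaleR[OF h \<zeta>M(1), of B] B by (intro sqint_add) auto
  obtain U where U: "U \<in> borel_measurable borel" "\<And>x. x \<notin> C \<Longrightarrow> U x = 0" "AE x in M. U0 x = U x"
    using borel_representative[OF sqint_measurable[OF U0s] C(1)] out by (auto simp: U0_def)
  \<comment> \<open>Representatives and mollifications exist for real functions, so the gradient is
    treated by components.\<close>
  have "\<forall>i\<in>Basis. \<exists>Gi. Gi \<in> borel_measurable borel \<and> (\<forall>x. x \<notin> C \<longrightarrow> Gi x = 0) \<and> (AE x in M. G0 x \<bullet> i = Gi x)"
  proof
    fix i :: 'a assume "i \<in> Basis"
    have z: "G0 x \<bullet> i = 0" if "x \<notin> C" for x using out[OF that] by (simp add: G0_def)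
    show "\<exists>Gi. Gi \<in> borel_measurable borel \<and> (\<forall>x. x \<notin> C \<longrightarrow> Gi x = 0) \<and> (AE x in M. G0 x \<bullet> i = Gi x)"
      using borel_representative[OF sqint_measurable[OF sqint_inner_const[OF G0s]] C(1) z] by blast
  qed
  then obtain G where G: "\<And>i. i \<in> Basis \<Longrightarrow> G i \<in> borel_measurable borel"
    "\<And>i x. i \<in> Basis \<Longrightarrow> x \<notin> C \<Longrightarrow> G i x = 0" "\<And>i. i \<in> Basis \<Longrightarrow> AE x in M. G0 x \<bullet> i = G i x"
    unfolding bchoice_iff by blast
  have UL: "integrable lborel U" "sqint lborel U"
    using representative_lborel[OF U(1,2) C(2) sqint_cong_AE[OF U0s U(3) borel_M[OF U(1)]]] by auto
  have GL: "integrable lborel (G i)" "sqint lborel (G i)" if i: "i \<in> Basis" for i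
    using representative_lborel[OF G(1)[OF i] G(2)[OF i] C(2) sqint_cong_AE[OF sqint_inner_const[OF G0s] G(3)[OF i] borel_M[OF G(1)[OF i]]]] by auto
  obtain d where d: "d > 0" "(\<Union>x\<in>C. cball x d) \<subseteq> \<Omega>"
    using compact_subset_open_imp_cball_epsilon_subset[OF C(1) open_domain C(2)] by blast
  then have d': "x \<in> \<Omega>" if "y \<in> C" "dist x y \<le> d" for x y using that by (auto simp: dist_commute subset_iff)
  obtain N where N: "inverse (real (Suc N)) < d" using d(1) reals_Archimedean by blast
  have nN: "inverse (real (Suc (n + N))) \<le> d" for n
  proof -
    have "inverse (real (Suc (n + N))) \<le> inverse (real (Suc N))" by simp
    then show ?thesis using N by linarith
  qed
  define \<phi> where "\<phi> n = mollify U (n + N)" for n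
  have \<phi>: "test_fun \<Omega> (\<phi> n)" for n
    unfolding \<phi>_def by (rule mollify_test_fun(1)[OF UL(1) C(1) U(2) d' nN])
  \<comment> \<open>The derivative of the kernel in x is minus its derivative in y. Multiplied by
    \<zeta>, the kernel is a test function in y, and the weak gradient of w moves the derivative
    onto w; the term with the derivative of \<zeta> completes the product rule.\<close>
  have part: "partial i (\<phi> n) x = mollify (G i) (n + N) x" if i: "i \<in> Basis" for i n x
  proof -
    let ?e = "inverse (real (Suc (n + N)))"
    let ?r = "moll ?e :: 'a \<Rightarrow> real"
    have e: "?e > 0" by simp
    note tr = test_fun_moll[OF e, where ?'a = 'a]
    define \<psi> where "\<psi> y = ?r (x - y)" for y
    have \<psi>: "smooth_on UNIV \<psi>" "partial i \<psi> y = - partial i ?r (x - y)" for y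
      unfolding \<psi>_def[abs_def] using smooth_reflect[OF test_funD(1)[OF tr]] i by (auto simp: partial_eq_cgrad)
    have t: "test_fun \<Omega> (\<lambda>y. \<zeta> y * \<psi> y)" by (rule test_fun_mult[OF \<zeta> \<psi>(1)])
    have pt: "partial i (\<lambda>y. \<zeta> y * \<psi> y) y = \<zeta> y * partial i \<psi> y + partial i \<zeta> y * \<psi> y" for y
      using i by (simp add: partial_eq_cgrad cgrad_mult[OF test_funD(4)[OF \<zeta>] smooth_onD(1)[OF \<psi>(1)]] inner_add_left)
    have b\<psi>: "\<psi> \<in> borel_measurable borel" "partial i \<psi> \<in> borel_measurable borel"
      using smooth_onD[OF \<psi>(1)] smooth_onD(3)[OF smooth_onD(2)[OF \<psi>(1) i]]
      by (auto intro!: borel_measurable_continuous_onI)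
    note [measurable] = b\<psi> U(1) G(1)[OF i] borel_M[OF b\<psi>(1)] borel_M[OF b\<psi>(2)] sqint_measurable[OF U0s]
      sqint_measurable[OF G0s] borel_M[OF U(1)] borel_M[OF G(1)[OF i]] sqint_measurable[OF w] sqint_measurable[OF h]
    have s2: "sqint M (\<lambda>y. partial i \<zeta> y * \<psi> y)"
      by (rule test_fun_sqint(1)[OF test_fun_mult[OF test_fun_partial[OF \<zeta> i] \<psi>(1)]])
    have s3: "sqint M (\<lambda>y. \<zeta> y * \<psi> y)" by (rule test_fun_sqint(1)[OF t])
    have "test_fun \<Omega> (\<lambda>y. \<zeta> y * partial i \<psi> y)" by (rule test_fun_mult[OF \<zeta> smooth_onD(2)[OF \<psi>(1) i]])
    then have s1: "sqint M (\<lambda>y. \<zeta> y * partial i \<psi> y)" by (rule test_fun_sqint)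
    have "partial i (\<phi> n) x = conv U (partial i ?r) x"
      unfolding \<phi>_def mollify_def conv_partial[OF UL(1) tr i] ..
    also have "\<dots> = (\<integral>y. U y * (- partial i \<psi> y) \<partial>lborel)" by (simp add: conv_def \<psi>(2))
    also have "\<dots> = (\<integral>y. U y * (- partial i \<psi> y) \<partial>M)"
      using C(2) U(2) by (intro integrable_M_lborel(2)[symmetric]) auto
    also have "\<dots> = (\<integral>y. - (w y * (\<zeta> y * partial i \<psi> y)) \<partial>M)"
    proof (rule integral_cong_AE)
      show "AE y in M. U y * (- partial i \<psi> y) = - (w y * (\<zeta> y * partial i \<psi> y))"
        using U(3) by eventually_elim (simp add: U0_def mult_ac)
      have "(\<lambda>y. \<zeta> y * partial i \<psi> y) \<in> borel_measurable M" using s1 by (simp add: sqint_def)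
      then show "(\<lambda>y. - (w y * (\<zeta> y * partial i \<psi> y))) \<in> borel_measurable M" by measurable
    qed measurable
    also have "\<dots> = - (\<integral>y. w y * partial i (\<lambda>y. \<zeta> y * \<psi> y) y \<partial>M) + (\<integral>y. w y * (partial i \<zeta> y * \<psi> y) \<partial>M)"
      unfolding pt distrib_left
        Bochner_Integration.integral_add[OF sqint_mult_integrable[OF w s1] sqint_mult_integrable[OF w s2]] by simp
    also have "\<dots> = (\<integral>y. (h y \<bullet> i) * (\<zeta> y * \<psi> y) \<partial>M) + (\<integral>y. w y * (partial i \<zeta> y * \<psi> y) \<partial>M)"
      using weak_gradientD(4)[OF wh t i] by simp
    also have "\<dots> = (\<integral>y. (h y \<bullet> i) * (\<zeta> y * \<psi> y) + w y * (partial i \<zeta> y * \<psi> y) \<partial>M)"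
      by (rule Bochner_Integration.integral_add[symmetric, OF sqint_mult_integrable[OF sqint_inner_const[OF h] s3] sqint_mult_integrable[OF w s2]])
    also have "\<dots> = (\<integral>y. (G0 y \<bullet> i) * \<psi> y \<partial>M)"
      using i by (intro Bochner_Integration.integral_cong refl)
        (simp add: G0_def inner_add_left partial_eq_cgrad algebra_simps)
    also have "\<dots> = (\<integral>y. G i y * \<psi> y \<partial>M)"
    proof (rule integral_cong_AE)
      show "AE y in M. (G0 y \<bullet> i) * \<psi> y = G i y * \<psi> y" using G(3)[OF i] by eventually_elim simp
    qed measurable
    also have "\<dots> = (\<integral>y. G i y * \<psi> y \<partial>lborel)"
      using C(2) G(2)[OF i] by (intro integrable_M_lborel(2)) auto
    also have "\<dots> = mollify (G i) (n + N) x" by (simp add: mollify_def conv_def \<psi>_def)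
    finally show ?thesis .
  qed
  have sh: "strict_mono (\<lambda>n. n + N)" by (simp add: strict_mono_def)
  have limU: "L2_lim M \<phi> U"
    unfolding \<phi>_def[abs_def] by (rule L2_lim_subseq[OF L2_lim_lborel_M[OF mollify_L2_lim[OF UL]] sh])
  have limG: "L2_lim M (\<lambda>n x. partial i (\<phi> n) x *\<^sub>R i) (\<lambda>x. G i x *\<^sub>R i)" if i: "i \<in> Basis" for i
  proof -
    have l: "L2_lim M (\<lambda>n x. partial i (\<phi> n) x) (G i)"
      unfolding part[OF i] by (rule L2_lim_subseq[OF L2_lim_lborel_M[OF mollify_L2_lim[OF GL[OF i]]] sh])
    have sc: "sqint M (\<lambda>x. f x *\<^sub>R i)" if "sqint M f" for f :: "'a \<Rightarrow> real"
      by (rule sqint_dominated[OF that, where C = 1]) (use that i in \<open>auto simp: sqint_def\<close>)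
    show ?thesis
      by (rule L2_lim_dominated[OF l, where C = 1])
        (use i l sc in \<open>auto simp: L2_lim_def simp flip: scaleR_diff_left\<close>)
  qed
  have "L2_lim M (\<lambda>n. cgrad (\<phi> n)) (\<lambda>x. \<Sum>i\<in>Basis. G i x *\<^sub>R i)"
    using L2_lim_sum[OF finite_Basis limG] by (simp add: cgrad_def[abs_def])
  then have "H0 \<Omega> U (\<lambda>x. \<Sum>i\<in>Basis. G i x *\<^sub>R i)"
    by (intro H0cI[where \<phi> = \<phi>] \<phi> limU)
  then show ?thesis
  proof (rule H0c_cong_AE)
    show "AE x in M. U x = \<zeta> x * w x" using U(3) by eventually_elim (simp add: U0_def)
    have "AE x in M. \<forall>i\<in>Basis. G0 x \<bullet> i = G i x" using G(3) by (intro AE_finite_allI) auto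
    then show "AE x in M. (\<Sum>i\<in>Basis. G i x *\<^sub>R i) = \<zeta> x *\<^sub>R h x + w x *\<^sub>R cgrad \<zeta> x"
    proof eventually_elim
      case (elim x)
      then have "(\<Sum>i\<in>Basis. G i x *\<^sub>R i) = (\<Sum>i\<in>Basis. (G0 x \<bullet> i) *\<^sub>R i)" by (intro sum.cong) auto
      then show ?case by (simp add: euclidean_representation G0_def)
    qed
  qed (use U0s G0s in \<open>auto simp: sqint_def U0_def[abs_def] G0_def[abs_def]\<close>)
qed

end

section \<open>Chain rule and positive parts\<close>

lemma smooth_isCont: "smooth_on UNIV f \<Longrightarrow> isCont f x"
  using smooth_onD(3)[of f] by (simp add: continuous_on_eq_continuous_at)

text \<open>As \<open>m \<rightarrow> \<infinity>\<close> this converges to the positive part together with its derivative.\<close>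
definition smooth_pos :: "real \<Rightarrow> real \<Rightarrow> real" where
  "smooth_pos m s = s * flat_exp 0 (m * s)"

lemma smooth_smooth_pos: "smooth_on UNIV (smooth_pos m)"
proof -
  have "smooth_on UNIV (\<lambda>s. s * flat_exp 0 (m * s + 0))"
    by (intro smooth_mult smooth_ident smooth_compose[OF smooth_flat_exp smooth_affine])
  then show ?thesis by (simp add: smooth_pos_def[abs_def])
qed

lemma smooth_pos_eq: "m > 0 \<Longrightarrow> smooth_pos m s = (if s > 0 then s * exp (- (1 / (m * s))) else 0)"
  by (auto simp: smooth_pos_def flat_exp_0 zero_less_mult_iff)

lemma deriv_smooth_pos:
  assumes m: "m > 0"
  shows "deriv (smooth_pos m) s = (if s > 0 then (1 + 1 / (m * s)) * exp (- (1 / (m * s))) else 0)"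
proof -
  have "(flat_exp 0 has_real_derivative flat_exp 2 (m * s)) (at (m * s))"
    using flat_exp_has_derivative[of 0 "m * s"] by (simp add: numeral_2_eq_2)
  then have "((\<lambda>s. flat_exp 0 (m * s)) has_real_derivative flat_exp 2 (m * s) * m) (at s)"
    by (rule DERIV_chain2) (auto intro!: derivative_eq_intros)
  then have "((\<lambda>s. s * flat_exp 0 (m * s)) has_real_derivative (1 * flat_exp 0 (m * s) + flat_exp 2 (m * s) * m * s)) (at s)"
    by (rule DERIV_mult[OF DERIV_ident])
  then have "deriv (smooth_pos m) s = flat_exp 0 (m * s) + flat_exp 2 (m * s) * m * s"
    unfolding smooth_pos_def[abs_def] by (simp add: DERIV_imp_deriv)
  also have "\<dots> = (if s > 0 then (1 + 1 / (m * s)) * exp (- (1 / (m * s))) else 0)"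
    using m by (auto simp: flat_exp_def zero_less_mult_iff field_simps power2_eq_square)
  finally show ?thesis .
qed

lemma deriv_smooth_pos_bound:
  assumes m: "m > 0" shows "\<bar>deriv (smooth_pos m) s\<bar> \<le> 1"
proof (cases "s > 0")
  case True
  define y where "y = 1 / (m * s)"
  have y: "y > 0" using True m by (simp add: y_def)
  have "(1 + y) * exp (- y) \<le> exp y * exp (- y)"
    using exp_ge_add_one_self[of y] by (intro mult_right_mono) auto
  also have "\<dots> = 1" by (simp flip: exp_add)
  finally show ?thesis using True y m by (simp add: deriv_smooth_pos y_def[symmetric] abs_mult)
qed (use m in \<open>simp add: deriv_smooth_pos\<close>)

lemma smooth_pos_tendsto:
  "(\<lambda>n. smooth_pos (real (Suc n)) s) \<longlonglongrightarrow> max 0 s"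
  "(\<lambda>n. deriv (smooth_pos (real (Suc n))) s) \<longlonglongrightarrow> (if s > 0 then 1 else 0)"
proof -
  have l: "(\<lambda>n. 1 / (real (Suc n) * s)) \<longlonglongrightarrow> 0"
  proof -
    have "(\<lambda>n. inverse (real (Suc n)) * (1 / s)) \<longlonglongrightarrow> 0 * (1 / s)"
      by (rule tendsto_mult_right[OF LIMSEQ_inverse_real_of_nat])
    then show ?thesis by (simp add: field_simps)
  qed
  show "(\<lambda>n. smooth_pos (real (Suc n)) s) \<longlonglongrightarrow> max 0 s"
  proof (cases "s > 0")
    case True
    have "(\<lambda>n. s * exp (- (1 / (real (Suc n) * s)))) \<longlonglongrightarrow> s * exp (- 0)"
      by (rule tendsto_mult_left[OF tendsto_exp[OF tendsto_minus[OF l]]])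
    then show ?thesis using True by (simp add: smooth_pos_eq)
  qed (simp add: smooth_pos_eq)
  show "(\<lambda>n. deriv (smooth_pos (real (Suc n))) s) \<longlonglongrightarrow> (if s > 0 then 1 else 0)"
  proof (cases "s > 0")
    case True
    have "(\<lambda>n. (1 + 1 / (real (Suc n) * s)) * exp (- (1 / (real (Suc n) * s)))) \<longlonglongrightarrow> (1 + 0) * exp (- 0)"
      by (rule tendsto_mult[OF tendsto_add[OF tendsto_const l] tendsto_exp[OF tendsto_minus[OF l]]])
    then show ?thesis using True by (simp add: deriv_smooth_pos)
  qed (simp add: deriv_smooth_pos)
qed

lemma smooth_Lipschitz:
  fixes \<Phi> :: "real \<Rightarrow> real"
  assumes "smooth_on UNIV \<Phi>" "\<And>s. \<bar>deriv \<Phi> s\<bar> \<le> C" "\<Phi> 0 = 0"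
  shows "\<bar>\<Phi> s\<bar> \<le> C * \<bar>s\<bar>"
  using field_differentiable_bound[of UNIV \<Phi> "deriv \<Phi>" C s 0] smooth_real_deriv(1)[OF assms(1)] assms(2,3) by auto

context bounded_domain
begin

text \<open>The map taking (s, \<xi>) to (\<Phi> s, \<Phi>' s times \<xi>) is continuous with linear
  growth, so superposition applies to function and gradient at once. The class T records what
  composition with \<Phi> adds, for instance nonnegativity.\<close>

lemma H0_chain:
  fixes \<Phi> :: "real \<Rightarrow> real"
  assumes H: "H0 \<Omega> u g" and \<Phi>: "smooth_on UNIV \<Phi>" "\<Phi> 0 = 0" "\<And>s. \<bar>deriv \<Phi> s\<bar> \<le> C"
    and T: "\<And>\<phi>. test_fun \<Omega> \<phi> \<Longrightarrow> T (\<lambda>x. \<Phi> (\<phi> x))"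
  shows "H0c T \<Omega> (\<lambda>x. \<Phi> (u x)) (\<lambda>x. deriv \<Phi> (u x) *\<^sub>R g x)"
proof -
  obtain \<phi> where \<phi>: "\<And>k. test_fun \<Omega> (\<phi> k)" "L2_lim M (\<lambda>k x. (\<phi> k x, cgrad (\<phi> k) x)) (\<lambda>x. (u x, g x))"
    using H unfolding H0c_def by blast
  define B where "B p = (\<Phi> (fst p), deriv \<Phi> (fst p) *\<^sub>R snd p)" for p :: "real \<times> 'a"
  have cont: "isCont B p" for p
    unfolding B_def[abs_def]
    by (intro continuous_intros isCont_o2[OF _ smooth_isCont[OF \<Phi>(1)]] isCont_o2[OF _ smooth_isCont[OF smooth_real_deriv(2)[OF \<Phi>(1)]]])
  have Bm: "B \<in> borel_measurable borel"
    by (intro borel_measurable_continuous_onI) (simp add: continuous_on_eq_continuous_at cont)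
  have bound: "(norm (B p))\<^sup>2 \<le> C\<^sup>2 * ((norm p)\<^sup>2 + 1)" for p
  proof -
    have "(norm (B p))\<^sup>2 = \<bar>\<Phi> (fst p)\<bar>\<^sup>2 + (\<bar>deriv \<Phi> (fst p)\<bar> * norm (snd p))\<^sup>2"
      by (simp add: B_def norm_Pair)
    also have "\<dots> \<le> (C * \<bar>fst p\<bar>)\<^sup>2 + (C * norm (snd p))\<^sup>2"
      using smooth_Lipschitz[OF \<Phi>(1,3,2), of "fst p"] \<Phi>(3)[of "fst p"]
      by (intro add_mono power_mono mult_right_mono) auto
    also have "\<dots> = C\<^sup>2 * (norm p)\<^sup>2"
      by (cases p) (simp add: norm_Pair power_mult_distrib algebra_simps)
    also have "\<dots> \<le> C\<^sup>2 * ((norm p)\<^sup>2 + 1)" by (intro mult_left_mono) auto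
    finally show ?thesis .
  qed
  obtain r :: "nat \<Rightarrow> nat" where r: "strict_mono r"
    "L2_lim M (\<lambda>n x. B (\<phi> (r n) x, cgrad (\<phi> (r n)) x)) (\<lambda>x. B (u x, g x))"
  proof (rule L2_lim_superposition[OF \<phi>(2) finite_M, of "\<lambda>_. B" "C\<^sup>2"])
    show "(\<lambda>x. B (h x)) \<in> borel_measurable M" if "h \<in> borel_measurable M" for h
      by (rule measurable_compose[OF that Bm])
  qed (use cont bound in auto)
  have "cgrad (\<lambda>x. \<Phi> (\<phi> n x)) x = deriv \<Phi> (\<phi> n x) *\<^sub>R cgrad (\<phi> n) x" for n x
    by (rule cgrad_compose[OF smooth_real_deriv(1)[OF \<Phi>(1)] test_funD(4)[OF \<phi>(1)]])
  with r(2) have "L2_lim M (\<lambda>n x. (\<Phi> (\<phi> (r n) x), cgrad (\<lambda>x. \<Phi> (\<phi> (r n) x)) x)) (\<lambda>x. (\<Phi> (u x), deriv \<Phi> (u x) *\<^sub>R g x))"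
    by (simp add: B_def)
  then show ?thesis
    unfolding H0c_def using T[OF \<phi>(1)] by (intro exI[of _ "\<lambda>n x. \<Phi> (\<phi> (r n) x)"]) simp
qed

text \<open>The smooth approximations of the positive part are nonnegative, vanish at 0 and have
  slope at most 1. The positive part thus lands in the closure of the nonnegative test functions,
  which makes it admissible in differential inequalities.\<close>

lemma H0_pos_part:
  assumes H: "H0 \<Omega> u g"
  shows "H0c (nonneg_test \<Omega>) \<Omega> (\<lambda>x. max 0 (u x)) (\<lambda>x. if u x > 0 then g x else 0)"
proof (rule H0c_closed)
  let ?P = "\<lambda>n. smooth_pos (real (Suc n))"
  show "H0c (nonneg_test \<Omega>) \<Omega> (\<lambda>x. ?P n (u x)) (\<lambda>x. deriv (?P n) (u x) *\<^sub>R g x)" for n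
  proof (rule H0_chain[OF H smooth_smooth_pos])
    show z: "?P n 0 = 0" by (simp add: smooth_pos_eq)
    have nn: "0 \<le> ?P n s" for s by (simp add: smooth_pos_eq)
    show "nonneg_test \<Omega> (\<lambda>x. ?P n (\<phi> x))" if "test_fun \<Omega> \<phi>" for \<phi>
      using test_fun_compose[OF that smooth_smooth_pos z] nn by blast
    show "\<bar>deriv (?P n) s\<bar> \<le> 1" for s by (rule deriv_smooth_pos_bound) simp
  qed
  have s: "sqint M u" "sqint M g" by (fact H0c_sqint[OF H])+
  note [measurable] = sqint_measurable[OF s(1)] sqint_measurable[OF s(2)]
  have c: "?P n \<in> borel_measurable borel" "deriv (?P n) \<in> borel_measurable borel" for n
    using smooth_onD(3)[OF smooth_smooth_pos] smooth_onD(3)[OF smooth_real_deriv(2)[OF smooth_smooth_pos]]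
    by (auto intro: borel_measurable_continuous_onI)
  note [measurable] = c
  have P: "\<bar>?P n s\<bar> \<le> \<bar>s\<bar>" for n s
    using smooth_Lipschitz[OF smooth_smooth_pos, of "real (Suc n)" 1 s] deriv_smooth_pos_bound[of "real (Suc n)"]
    by (simp add: smooth_pos_eq)
  show "L2_lim M (\<lambda>n x. (?P n (u x), deriv (?P n) (u x) *\<^sub>R g x)) (\<lambda>x. (max 0 (u x), if u x > 0 then g x else 0))"
    unfolding L2_lim_Pair
  proof (intro conjI)
    show "L2_lim M (\<lambda>n x. ?P n (u x)) (\<lambda>x. max 0 (u x))"
    proof (rule L2_lim_pointwise_dominated[where g = "\<lambda>x. (norm (u x))\<^sup>2"])
      show "AE x in M. (norm (?P n (u x)))\<^sup>2 \<le> (norm (u x))\<^sup>2" for n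
        by (intro AE_I2 power_mono) (use P in auto)
      show "AE x in M. (norm (max 0 (u x)))\<^sup>2 \<le> (norm (u x))\<^sup>2" by (intro AE_I2 power_mono) auto
      show "(\<lambda>x. ?P n (u x)) \<in> borel_measurable M" for n
        by (rule measurable_compose[OF sqint_measurable[OF s(1)] c(1)])
      show "AE x in M. (\<lambda>n. ?P n (u x)) \<longlonglongrightarrow> max 0 (u x)"
        by (intro AE_I2 smooth_pos_tendsto(1))
      show "(\<lambda>x. max 0 (u x)) \<in> borel_measurable M" by measurable
      show "integrable M (\<lambda>x. (norm (u x))\<^sup>2)" by (rule sqint_integrable[OF s(1)])
    qed
    show "L2_lim M (\<lambda>n x. deriv (?P n) (u x) *\<^sub>R g x) (\<lambda>x. if u x > 0 then g x else 0)"
    proof (rule L2_lim_pointwise_dominated[where g = "\<lambda>x. (norm (g x))\<^sup>2"])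
      show "AE x in M. (norm (deriv (?P n) (u x) *\<^sub>R g x))\<^sup>2 \<le> (norm (g x))\<^sup>2" for n
        by (intro AE_I2 power_mono)
          (use deriv_smooth_pos_bound[of "real (Suc n)"] in \<open>auto intro!: mult_left_le_one_le\<close>)
      show "AE x in M. (norm (if u x > 0 then g x else 0))\<^sup>2 \<le> (norm (g x))\<^sup>2" by auto
      show "AE x in M. (\<lambda>n. deriv (?P n) (u x) *\<^sub>R g x) \<longlonglongrightarrow> (if u x > 0 then g x else 0)"
      proof (rule AE_I2)
        fix x
        have "(\<lambda>n. deriv (?P n) (u x) *\<^sub>R g x) \<longlonglongrightarrow> (if u x > 0 then 1 else 0) *\<^sub>R g x"
          by (rule tendsto_scaleR[OF smooth_pos_tendsto(2) tendsto_const])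
        then show "(\<lambda>n. deriv (?P n) (u x) *\<^sub>R g x) \<longlonglongrightarrow> (if u x > 0 then g x else 0)"
          by (simp split: if_splits)
      qed
      show "(\<lambda>x. deriv (?P n) (u x) *\<^sub>R g x) \<in> borel_measurable M" for n
        by (rule borel_measurable_scaleR[OF measurable_compose[OF sqint_measurable[OF s(1)] c(2)] sqint_measurable[OF s(2)]])
      show "(\<lambda>x. if u x > 0 then g x else 0) \<in> borel_measurable M" by measurable
      show "integrable M (\<lambda>x. (norm (g x))\<^sup>2)" by (rule sqint_integrable[OF s(2)])
    qed
  qed
qed

lemma H0c_test_le:
  assumes V: "sqint M V" and le: "\<And>\<phi>. T \<phi> \<Longrightarrow> (\<integral>x. V x \<bullet> cgrad \<phi> x \<partial>M) \<le> 0" and H: "H0c T \<Omega> u g"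
  shows "(\<integral>x. V x \<bullet> g x \<partial>M) \<le> 0"
proof -
  obtain \<phi> where \<phi>: "\<And>k. T (\<phi> k)" "L2_lim M \<phi> u" "L2_lim M (\<lambda>k. cgrad (\<phi> k)) g"
    using H0cE[OF H] by blast
  show ?thesis
    by (rule LIMSEQ_le_const2[OF L2_lim_inner_right[OF \<phi>(3) V]]) (use le \<phi>(1) in blast)
qed

lemma H0_test_eq:
  assumes V: "sqint M V" and f: "sqint M f"
    and eq: "\<And>\<phi>. test_fun \<Omega> \<phi> \<Longrightarrow> (\<integral>x. V x \<bullet> cgrad \<phi> x \<partial>M) = (\<integral>x. f x * \<phi> x \<partial>M)" and H: "H0 \<Omega> u g"
  shows "(\<integral>x. V x \<bullet> g x \<partial>M) = (\<integral>x. f x * u x \<partial>M)"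
proof -
  obtain \<phi> where \<phi>: "\<And>k. test_fun \<Omega> (\<phi> k)" "L2_lim M \<phi> u" "L2_lim M (\<lambda>k. cgrad (\<phi> k)) g"
    using H0cE[OF H] by blast
  have "(\<lambda>k. \<integral>x. V x \<bullet> cgrad (\<phi> k) x \<partial>M) \<longlonglongrightarrow> (\<integral>x. f x * u x \<partial>M)"
    unfolding eq[OF \<phi>(1)] using L2_lim_inner_right[OF \<phi>(2) f] by simp
  with L2_lim_inner_right[OF \<phi>(3) V] show ?thesis by (rule LIMSEQ_unique)
qed

text \<open>Locally \<open>w\<close> agrees with a cut-off of itself, to which the chain rule applies.\<close>
lemma weak_gradient_min:
  assumes w: "sqint M w" and h: "sqint M h" and wh: "weak_gradient \<Omega> w h"
  shows "weak_gradient \<Omega> (\<lambda>x. min (w x) 0) (\<lambda>x. if w x < 0 then h x else 0)"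
proof (rule weak_gradientI)
  note [measurable] = sqint_measurable[OF w] sqint_measurable[OF h]
  show "sqint M (\<lambda>x. min (w x) 0)" by (rule sqint_dominated[OF w, where C = 1]) auto
  show "sqint M (\<lambda>x. if w x < 0 then h x else 0)" by (rule sqint_dominated[OF h, where C = 1]) auto
  fix \<phi> i assume t: "test_fun \<Omega> \<phi>" and i: "(i::'a) \<in> Basis"
  let ?K = "closure {x. \<phi> x \<noteq> 0}"
  obtain \<zeta> d where \<zeta>: "test_fun \<Omega> \<zeta>" "\<And>x. 0 \<le> \<zeta> x" and d: "d > 0"
    "\<And>x y. y \<in> ?K \<Longrightarrow> dist x y \<le> d \<Longrightarrow> x \<in> \<Omega> \<and> \<zeta> x = 1 \<and> cgrad \<zeta> x = 0"
    using cutoff_exists[OF test_funD(2)[OF t] open_domain test_funD(3)[OF t]] by blast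
  have K: "\<zeta> x = 1" "cgrad \<zeta> x = 0" if "x \<in> ?K" for x using d(2)[OF that, of x] d(1) by auto
  \<comment> \<open>The minimum with 0 is minus the positive part of the negative, so the cut-off
    function is negated first; the signs cancel at the end.\<close>
  let ?u = "\<lambda>x. - (\<zeta> x * w x)" and ?g = "\<lambda>x. - (\<zeta> x *\<^sub>R h x + w x *\<^sub>R cgrad \<zeta> x)"
  have "H0 \<Omega> ?u ?g" by (rule H0_uminus[OF H0_cutoff_mult[OF w h wh \<zeta>(1)]])
  from H0c_mono[OF H0_pos_part[OF this], of "test_fun \<Omega>"]
  have "H0 \<Omega> (\<lambda>x. max 0 (?u x)) (\<lambda>x. if ?u x > 0 then ?g x else 0)" by blast
  from weak_gradientD(4)[OF H0_weak_gradient[OF this] t i]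
  have "(\<integral>x. max 0 (?u x) * partial i \<phi> x \<partial>M) = - (\<integral>x. ((if ?u x > 0 then ?g x else 0) \<bullet> i) * \<phi> x \<partial>M)" .
  moreover have "max 0 (?u x) * partial i \<phi> x = - (min (w x) 0 * partial i \<phi> x)" for x
  proof (cases "x \<in> ?K")
    case True
    then show ?thesis using K[OF True] by (auto simp: max_def min_def)
  next
    case False
    then show ?thesis using cgrad_zero_outside[OF False] i by (simp add: partial_eq_cgrad)
  qed
  moreover have "((if ?u x > 0 then ?g x else 0) \<bullet> i) * \<phi> x = - (((if w x < 0 then h x else 0) \<bullet> i) * \<phi> x)" for x
  proof (cases "x \<in> ?K")
    case True
    then show ?thesis using K[OF True] by auto
  next
    case False
    then have "\<phi> x = 0" using closure_subset[of "{x. \<phi> x \<noteq> 0}"] by auto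
    then show ?thesis by simp
  qed
  ultimately show "(\<integral>x. min (w x) 0 * partial i \<phi> x \<partial>M) = - (\<integral>x. ((if w x < 0 then h x else 0) \<bullet> i) * \<phi> x \<partial>M)"
    by simp
qed

end

section \<open>The anisotropic energy density\<close>

lemma cgrad_inner_sum: "cgrad f x \<bullet> v = (\<Sum>i\<in>Basis. (v \<bullet> i) * partial i f x)"
proof -
  have "cgrad f x \<bullet> v = (\<Sum>i\<in>Basis. partial i f x * (i \<bullet> v))" by (simp add: cgrad_def inner_sum_left)
  then show ?thesis by (simp add: inner_commute mult.commute)
qed

locale finsler =
  fixes F :: "'a::euclidean_space \<Rightarrow> real" and a b \<mu> \<Lambda> :: real
  assumes F_convex: "convex_on UNIV F"
    and F_nonneg: "\<forall>\<xi>. F \<xi> \<ge> 0"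
    and F_C2: "C_on 2 (- {0}) F"
    and F_hom: "\<forall>t \<xi>. F (t *\<^sub>R \<xi>) = \<bar>t\<bar> * F \<xi>"
    and ab: "0 < a" "a \<le> b" "\<forall>\<xi>. a * norm \<xi> \<le> F \<xi> \<and> F \<xi> \<le> b * norm \<xi>"
    and mu: "\<mu> > 0"
    and hess: "\<forall>\<xi> V. norm \<xi> = 1 \<and> V \<bullet> \<xi> = 0 \<longrightarrow>
        \<mu>\<^sup>2 * (norm V)\<^sup>2 \<le> (\<Sum>i\<in>Basis. \<Sum>j\<in>Basis. partial j (partial i F) \<xi> * (V \<bullet> i) * (V \<bullet> j)) \<and>
        (\<Sum>i\<in>Basis. \<Sum>j\<in>Basis. partial j (partial i F) \<xi> * (V \<bullet> i) * (V \<bullet> j)) \<le> \<Lambda> * (norm V)\<^sup>2"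
begin

text \<open>The flux: away from 0 it is the gradient of F^2/2. Because F vanishes at 0, so does
  \<open>A\<close>, whatever value \<open>cgrad F 0\<close> takes there.\<close>

definition A :: "'a \<Rightarrow> 'a" where "A \<xi> = F \<xi> *\<^sub>R cgrad F \<xi>"

definition Hs :: "'a \<Rightarrow> 'a \<Rightarrow> 'a \<Rightarrow> real" where
  "Hs \<xi> V W = (\<Sum>i\<in>Basis. (V \<bullet> i) * (cgrad (partial i F) \<xi> \<bullet> W))"

lemma F_0 [simp]: "F 0 = 0"
  using F_hom[rule_format, of 0 0] by simp

lemma A_0 [simp]: "A 0 = 0" by (simp add: A_def)

lemma F_smooth:
  assumes "\<xi> \<noteq> 0"
  shows "F differentiable (at \<xi>)" "i \<in> Basis \<Longrightarrow> partial i F differentiable (at \<xi>)"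
    "isCont F \<xi>" "i \<in> Basis \<Longrightarrow> isCont (partial i F) \<xi>"
  using F_C2 assms by (auto simp: numeral_2_eq_2 differentiable_imp_continuous_within)

lemma F_deriv: "\<xi> \<noteq> 0 \<Longrightarrow> (F has_derivative (\<lambda>v. cgrad F \<xi> \<bullet> v)) (at \<xi>)"
  by (intro has_derivative_cgrad F_smooth)

lemma partial_F_deriv:
  "\<xi> \<noteq> 0 \<Longrightarrow> i \<in> Basis \<Longrightarrow> (partial i F has_derivative (\<lambda>v. cgrad (partial i F) \<xi> \<bullet> v)) (at \<xi>)"
  by (intro has_derivative_cgrad F_smooth)

lemma line_deriv:
  assumes "(f has_derivative (\<lambda>v. g \<bullet> v)) (at (x + t *\<^sub>R v))"
  shows "((\<lambda>t. f (x + t *\<^sub>R v)) has_real_derivative g \<bullet> v) (at t)"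
proof -
  have "((\<lambda>t. f (x + t *\<^sub>R v)) has_derivative (\<lambda>h. g \<bullet> (h *\<^sub>R v))) (at t)"
    by (rule has_derivative_compose[where f = "\<lambda>t. x + t *\<^sub>R v" and g = f and f' = "\<lambda>h. h *\<^sub>R v", OF _ assms])
      (auto intro!: derivative_eq_intros)
  then show ?thesis
    unfolding has_field_derivative_def by (rule has_derivative_eq_rhs) (auto simp: mult.commute)
qed

lemma F_triangle: "F (\<xi> + \<eta>) \<le> F \<xi> + F \<eta>"
proof -
  have "F ((1 - 1/2) *\<^sub>R (2 *\<^sub>R \<xi>) + (1/2) *\<^sub>R (2 *\<^sub>R \<eta>)) \<le> (1 - 1/2) * F (2 *\<^sub>R \<xi>) + (1/2) * F (2 *\<^sub>R \<eta>)"
    by (rule convex_onD[OF F_convex]) auto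
  then show ?thesis using F_hom by simp
qed

text \<open>Subadditivity bounds each forward difference quotient in direction v by F v, hence by b
  |v|; taking v to be the gradient itself bounds its norm.\<close>

lemma cgrad_F_bound:
  assumes "\<xi> \<noteq> 0" shows "norm (cgrad F \<xi>) \<le> b"
proof -
  have le: "cgrad F \<xi> \<bullet> v \<le> b * norm v" for v
  proof -
    have "((\<lambda>t. F (\<xi> + t *\<^sub>R v)) has_real_derivative cgrad F \<xi> \<bullet> v) (at 0)"
      by (rule line_deriv) (use F_deriv[OF assms] in simp)
    then have "((\<lambda>t. (F (\<xi> + t *\<^sub>R v) - F \<xi>) / t) \<longlongrightarrow> cgrad F \<xi> \<bullet> v) (at_right 0)"
      unfolding DERIV_def by (simp add: filterlim_at_split)
    moreover have "\<forall>\<^sub>F t in at_right 0. (F (\<xi> + t *\<^sub>R v) - F \<xi>) / t \<le> b * norm v"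
    proof -
      have "(F (\<xi> + t *\<^sub>R v) - F \<xi>) / t \<le> b * norm v" if "t > 0" for t
      proof -
        have "F (\<xi> + t *\<^sub>R v) - F \<xi> \<le> F (t *\<^sub>R v)" using F_triangle[of \<xi> "t *\<^sub>R v"] by simp
        also have "\<dots> = t * F v" using F_hom that by simp
        also have "\<dots> \<le> t * (b * norm v)" using ab that by (intro mult_left_mono) auto
        finally show ?thesis using that by (simp add: field_simps)
      qed
      then show ?thesis by (auto simp: eventually_at_filter)
    qed
    ultimately show ?thesis by (intro tendsto_upperbound[where F = "at_right 0"]) auto
  qed
  have "norm (cgrad F \<xi>) * norm (cgrad F \<xi>) \<le> b * norm (cgrad F \<xi>)"
    using le[of "cgrad F \<xi>"] by (simp add: power2_norm_eq_inner[symmetric] power2_eq_square)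
  then show ?thesis using ab by (cases "cgrad F \<xi> = 0") auto
qed

lemma A_bound: "norm (A \<xi>) \<le> b\<^sup>2 * norm \<xi>"
proof (cases "\<xi> = 0")
  case False
  have "norm (A \<xi>) = F \<xi> * norm (cgrad F \<xi>)" using F_nonneg by (simp add: A_def)
  also have "\<dots> \<le> (b * norm \<xi>) * b"
    using cgrad_F_bound[OF False] ab F_nonneg by (intro mult_mono) auto
  finally show ?thesis by (simp add: power2_eq_square mult_ac)
qed simp

text \<open>At the origin F is not differentiable, but the linear bound on \<open>A\<close> forces
  continuity there.\<close>

lemma A_isCont: "isCont A \<xi>"
proof (cases "\<xi> = 0")
  case True
  have "(A \<longlongrightarrow> 0) (at 0)"
  proof (rule Lim_null_comparison)
    show "\<forall>\<^sub>F x in at 0. norm (A x) \<le> b\<^sup>2 * norm x" using A_bound by simp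
    have "((\<lambda>x::'a. b\<^sup>2 * norm x) \<longlongrightarrow> b\<^sup>2 * norm (0::'a)) (at 0)" by (intro tendsto_intros)
    then show "((\<lambda>x::'a. b\<^sup>2 * norm x) \<longlongrightarrow> 0) (at 0)" by simp
  qed
  then show ?thesis using True by (simp add: isCont_def)
next
  case False
  show ?thesis unfolding A_def[abs_def] cgrad_def
    using F_smooth[OF False] by (intro continuous_intros) auto
qed

lemma euler:
  assumes "\<xi> \<noteq> 0" shows "cgrad F \<xi> \<bullet> \<xi> = F \<xi>"
proof -
  have d: "((\<lambda>t. F (0 + t *\<^sub>R \<xi>)) has_real_derivative cgrad F \<xi> \<bullet> \<xi>) (at 1)"
    by (rule line_deriv) (use F_deriv[OF assms] in simp)
  have "((\<lambda>t. t * F \<xi>) has_real_derivative F \<xi>) (at 1)" by (auto intro!: derivative_eq_intros)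
  then have "((\<lambda>t. F (0 + t *\<^sub>R \<xi>)) has_real_derivative F \<xi>) (at 1)"
    by (rule has_field_derivative_transform_within_open[where S = "{0<..}"]) (use F_hom in auto)
  with d show ?thesis by (rule DERIV_unique)
qed

lemma cgrad_F_hom:
  assumes "\<xi> \<noteq> 0" "t > 0" shows "cgrad F (t *\<^sub>R \<xi>) = cgrad F \<xi>"
proof (rule cgrad_eqI)
  have "(F has_derivative (\<lambda>v. cgrad F \<xi> \<bullet> v)) (at ((1 / t) *\<^sub>R (t *\<^sub>R \<xi>)))"
    using F_deriv[OF assms(1)] assms(2) by simp
  then have "((\<lambda>x. F ((1 / t) *\<^sub>R x)) has_derivative (\<lambda>v. cgrad F \<xi> \<bullet> ((1 / t) *\<^sub>R v))) (at (t *\<^sub>R \<xi>))"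
    by (rule has_derivative_compose[where f = "\<lambda>x. (1 / t) *\<^sub>R x" and g = F and f' = "\<lambda>x. (1 / t) *\<^sub>R x", rotated])
      (auto intro!: derivative_eq_intros)
  from has_derivative_mult_right[OF this, of t]
  have "((\<lambda>x. t * F ((1 / t) *\<^sub>R x)) has_derivative (\<lambda>v. cgrad F \<xi> \<bullet> v)) (at (t *\<^sub>R \<xi>))"
    using assms(2) by simp
  moreover have "(\<lambda>x. t * F ((1 / t) *\<^sub>R x)) = F" using F_hom assms(2) by (auto simp: fun_eq_iff)
  ultimately show "(F has_derivative (\<bullet>) (cgrad F \<xi>)) (at (t *\<^sub>R \<xi>))" by simp
qed

lemma partial_F_hom: "\<xi> \<noteq> 0 \<Longrightarrow> t > 0 \<Longrightarrow> i \<in> Basis \<Longrightarrow> partial i F (t *\<^sub>R \<xi>) = partial i F \<xi>"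
  by (simp add: cgrad_inner_Basis[symmetric] cgrad_F_hom)

lemma hessian_radial_right:
  assumes "\<xi> \<noteq> 0" "i \<in> Basis" shows "cgrad (partial i F) \<xi> \<bullet> \<xi> = 0"
proof -
  have d: "((\<lambda>t. partial i F (0 + t *\<^sub>R \<xi>)) has_real_derivative cgrad (partial i F) \<xi> \<bullet> \<xi>) (at 1)"
    by (rule line_deriv) (use partial_F_deriv[OF assms] in simp)
  have "((\<lambda>t. partial i F (0 + t *\<^sub>R \<xi>)) has_real_derivative 0) (at 1)"
    by (rule has_field_derivative_transform_within_open[where S = "{0<..}" and f = "\<lambda>t. partial i F \<xi>"])
      (use partial_F_hom assms in auto)
  with d show ?thesis by (rule DERIV_unique)
qed

text \<open>Euler's identity is differentiated, and the gradient of F cancels on both sides. With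
  \<open>hessian_radial_right\<close> the Hessian form degenerates in the radial direction in each
  argument, so only tangential parts matter.\<close>

lemma hessian_radial_left:
  assumes "\<xi> \<noteq> 0" shows "(\<Sum>i\<in>Basis. (\<xi> \<bullet> i) *\<^sub>R cgrad (partial i F) \<xi>) = 0"
proof -
  have "((\<lambda>x. \<Sum>i\<in>Basis. (x \<bullet> i) * partial i F x) has_derivative
      (\<lambda>v. \<Sum>i\<in>Basis. (\<xi> \<bullet> i) * (cgrad (partial i F) \<xi> \<bullet> v) + (v \<bullet> i) * partial i F \<xi>)) (at \<xi>)"
    by (intro has_derivative_sum has_derivative_mult partial_F_deriv assms has_derivative_inner_left has_derivative_ident)
  then have "(F has_derivative
      (\<lambda>v. \<Sum>i\<in>Basis. (\<xi> \<bullet> i) * (cgrad (partial i F) \<xi> \<bullet> v) + (v \<bullet> i) * partial i F \<xi>)) (at \<xi>)"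
  proof (rule has_derivative_transform_within_open[where s = "- {0}"])
    show "(\<Sum>i\<in>Basis. (x \<bullet> i) * partial i F x) = F x" if "x \<in> - {0}" for x
      using euler[of x] that by (simp add: cgrad_inner_sum)
  qed (use assms in auto)
  moreover have "(\<lambda>v. \<Sum>i\<in>Basis. (\<xi> \<bullet> i) * (cgrad (partial i F) \<xi> \<bullet> v) + (v \<bullet> i) * partial i F \<xi>)
      = (\<lambda>v. ((\<Sum>i\<in>Basis. (\<xi> \<bullet> i) *\<^sub>R cgrad (partial i F) \<xi>) + cgrad F \<xi>) \<bullet> v)"
    by (simp add: fun_eq_iff cgrad_inner_sum inner_add_left inner_sum_left sum.distrib)
  ultimately have "cgrad F \<xi> = (\<Sum>i\<in>Basis. (\<xi> \<bullet> i) *\<^sub>R cgrad (partial i F) \<xi>) + cgrad F \<xi>"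
    by (intro cgrad_eqI) simp
  then show ?thesis by simp
qed

text \<open>Second derivatives are homogeneous of degree -1, which brings every point back to the
  unit sphere, where ellipticity is assumed.\<close>

lemma hessian_scale:
  assumes "\<xi> \<noteq> 0" "t > 0" "i \<in> Basis"
  shows "t *\<^sub>R cgrad (partial i F) (t *\<^sub>R \<xi>) = cgrad (partial i F) \<xi>"
proof -
  have "(partial i F has_derivative (\<lambda>v. cgrad (partial i F) (t *\<^sub>R \<xi>) \<bullet> v)) (at (t *\<^sub>R \<xi>))"
    using assms by (intro partial_F_deriv) auto
  then have "((\<lambda>x. partial i F (t *\<^sub>R x)) has_derivative (\<lambda>v. cgrad (partial i F) (t *\<^sub>R \<xi>) \<bullet> (t *\<^sub>R v))) (at \<xi>)"
    by (rule has_derivative_compose[where f = "\<lambda>x. t *\<^sub>R x" and g = "partial i F" and f' = "\<lambda>x. t *\<^sub>R x", rotated])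
      (auto intro!: derivative_eq_intros)
  then have "(partial i F has_derivative (\<lambda>v. cgrad (partial i F) (t *\<^sub>R \<xi>) \<bullet> (t *\<^sub>R v))) (at \<xi>)"
    by (rule has_derivative_transform_within_open[where s = "- {0}"]) (use assms partial_F_hom in auto)
  then have "(partial i F has_derivative (\<lambda>v. (t *\<^sub>R cgrad (partial i F) (t *\<^sub>R \<xi>)) \<bullet> v)) (at \<xi>)"
    by (rule has_derivative_eq_rhs) auto
  then show ?thesis by (rule cgrad_eqI[symmetric])
qed

lemma Hs_add_radial:
  assumes "\<xi> \<noteq> 0" shows "Hs \<xi> (s *\<^sub>R \<xi> + W) (s *\<^sub>R \<xi> + W) = Hs \<xi> W W"
proof -
  have r: "cgrad (partial i F) \<xi> \<bullet> (s *\<^sub>R \<xi> + W) = cgrad (partial i F) \<xi> \<bullet> W" if "i \<in> Basis" for i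
    using hessian_radial_right[OF assms that] by (simp add: inner_add_right)
  have "Hs \<xi> (s *\<^sub>R \<xi> + W) (s *\<^sub>R \<xi> + W) = (\<Sum>i\<in>Basis. ((s *\<^sub>R \<xi> + W) \<bullet> i) * (cgrad (partial i F) \<xi> \<bullet> W))"
    unfolding Hs_def by (intro sum.cong) (auto simp: r)
  also have "\<dots> = s * ((\<Sum>i\<in>Basis. (\<xi> \<bullet> i) *\<^sub>R cgrad (partial i F) \<xi>) \<bullet> W) + Hs \<xi> W W"
    by (simp add: Hs_def inner_add_left inner_sum_left distrib_right sum.distrib sum_distrib_left mult.assoc)
  finally show ?thesis using hessian_radial_left[OF assms] by simp
qed

text \<open>A convexity modulus of F^2/2. In the denominator, 2/a^2 is the price of recovering the
  radial part of a vector from the derivative of F, and the second term is the weight of the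
  tangential part divided by its ellipticity constant a \<mu>^2; see
  \<open>second_variation_ge\<close>.\<close>

definition ell :: real where
  "ell = 1 / (2 / a\<^sup>2 + (2 * b\<^sup>2 / a\<^sup>2 + 1) / (a * \<mu>\<^sup>2))"

lemma ell_denominator: "0 < 2 / a\<^sup>2 + (2 * b\<^sup>2 / a\<^sup>2 + 1) / (a * \<mu>\<^sup>2)"
proof -
  have "0 < 2 / a\<^sup>2" using ab by simp
  moreover have "0 \<le> (2 * b\<^sup>2 / a\<^sup>2 + 1) / (a * \<mu>\<^sup>2)" using ab by simp
  ultimately show ?thesis by linarith
qed

lemma ell_pos: "0 < ell"
  unfolding ell_def using ell_denominator by simp

lemma ell_le: "ell \<le> a\<^sup>2"
proof -
  have "0 \<le> (2 * b\<^sup>2 / a\<^sup>2 + 1) / (a * \<mu>\<^sup>2)" using ab by simp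
  moreover have "0 \<le> 1 / a\<^sup>2" by simp
  moreover have "2 / a\<^sup>2 = 1 / a\<^sup>2 + 1 / a\<^sup>2" by simp
  ultimately have "1 / a\<^sup>2 \<le> 2 / a\<^sup>2 + (2 * b\<^sup>2 / a\<^sup>2 + 1) / (a * \<mu>\<^sup>2)" by linarith
  then have "ell \<le> 1 / (1 / a\<^sup>2)"
    unfolding ell_def using ab ell_denominator by (intro divide_left_mono) auto
  then show ?thesis by simp
qed

text \<open>The right-hand side is the second derivative of F^2/2 in direction V. Its Hessian term
  sees only the component \<open>W\<close> orthogonal to \<xi> and controls it by ellipticity. The
  radial component \<open>\<alpha>\<close> is recovered from the squared term: by Euler's identity
  the derivative of F along the unit vector \<open>e\<close> is at least a, and the contribution of
  \<open>W\<close> to that derivative is at most b |W|.\<close>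

lemma second_variation_ge:
  assumes \<xi>: "\<xi> \<noteq> 0"
  shows "ell * (norm V)\<^sup>2 \<le> F \<xi> * Hs \<xi> V V + (cgrad F \<xi> \<bullet> V)\<^sup>2"
proof -
  define n where "n = norm \<xi>"
  define e where "e = (1 / n) *\<^sub>R \<xi>"
  have n: "n > 0" using \<xi> by (simp add: n_def)
  have e: "norm e = 1" using n by (simp add: e_def n_def)
  have ee: "e \<bullet> e = 1" using e by (simp add: dot_square_norm)
  have \<xi>e: "\<xi> = n *\<^sub>R e" using n by (simp add: e_def)
  define \<alpha> where "\<alpha> = V \<bullet> e"
  define W where "W = V - \<alpha> *\<^sub>R e"
  have We: "W \<bullet> e = 0" using ee by (simp add: W_def inner_diff_left \<alpha>_def)
  have V: "V = (\<alpha> / n) *\<^sub>R \<xi> + W" using n by (simp add: W_def \<xi>e)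
  have V2: "(norm V)\<^sup>2 = \<alpha>\<^sup>2 + (norm W)\<^sup>2"
  proof -
    have "V = \<alpha> *\<^sub>R e + W" by (simp add: W_def)
    then have "(norm V)\<^sup>2 = (\<alpha> *\<^sub>R e + W) \<bullet> (\<alpha> *\<^sub>R e + W)" by (simp add: power2_norm_eq_inner)
    also have "\<dots> = \<alpha>\<^sup>2 * (e \<bullet> e) + 2 * \<alpha> * (W \<bullet> e) + W \<bullet> W"
      by (simp add: inner_add_left inner_add_right inner_commute power2_eq_square)
    finally show ?thesis using ee We by (simp add: power2_norm_eq_inner)
  qed
  have "Hs \<xi> V V = Hs \<xi> W W" by (subst (1 2) V) (rule Hs_add_radial[OF \<xi>])
  also have "\<dots> = (1 / n) * Hs e W W"
  proof -
    have "cgrad (partial i F) \<xi> = (1 / n) *\<^sub>R cgrad (partial i F) e" if "i \<in> Basis" for i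
    proof -
      have "n *\<^sub>R cgrad (partial i F) \<xi> = cgrad (partial i F) e"
        unfolding \<xi>e by (rule hessian_scale) (use e n that in auto)
      from this[symmetric] show ?thesis using n by simp
    qed
    then show ?thesis unfolding Hs_def by (simp add: sum_distrib_left mult_ac)
  qed
  finally have H1: "n * Hs \<xi> V V = Hs e W W" using n by simp
  have "Hs e W W = (\<Sum>i\<in>Basis. \<Sum>j\<in>Basis. partial j (partial i F) e * (W \<bullet> i) * (W \<bullet> j))"
    by (simp add: Hs_def cgrad_inner_sum sum_distrib_left mult_ac)
  then have H2: "\<mu>\<^sup>2 * (norm W)\<^sup>2 \<le> Hs e W W" using hess e We by simp
  have H0: "0 \<le> Hs \<xi> V V"
  proof -
    have "0 \<le> n * Hs \<xi> V V" unfolding H1 by (rule order_trans[OF _ H2]) simp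
    then show ?thesis using n by (simp add: zero_le_mult_iff)
  qed
  have "a * \<mu>\<^sup>2 * (norm W)\<^sup>2 \<le> a * (n * Hs \<xi> V V)"
    unfolding H1 mult.assoc using ab H2 by (intro mult_left_mono) auto
  also have "\<dots> \<le> F \<xi> * Hs \<xi> V V"
    unfolding mult.assoc[symmetric] n_def using ab H0 by (intro mult_right_mono) auto
  finally have T1: "a * \<mu>\<^sup>2 * (norm W)\<^sup>2 \<le> F \<xi> * Hs \<xi> V V" .
  define p where "p = cgrad F \<xi> \<bullet> V"
  have pe: "p = \<alpha> * (F \<xi> / n) + cgrad F \<xi> \<bullet> W"
  proof -
    have "p = cgrad F \<xi> \<bullet> ((\<alpha> / n) *\<^sub>R \<xi> + W)" unfolding p_def by (subst V) simp
    then show ?thesis using euler[OF \<xi>] by (simp add: inner_add_right)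
  qed
  have Fn: "a \<le> F \<xi> / n" using ab n by (simp add: field_simps n_def)
  have cW: "\<bar>cgrad F \<xi> \<bullet> W\<bar> \<le> b * norm W"
    using Cauchy_Schwarz_ineq2[of "cgrad F \<xi>" W] mult_right_mono[OF cgrad_F_bound[OF \<xi>], of "norm W"] by simp
  have "a * \<bar>\<alpha>\<bar> \<le> (F \<xi> / n) * \<bar>\<alpha>\<bar>" using Fn by (intro mult_right_mono) auto
  also have "\<dots> = \<bar>p - cgrad F \<xi> \<bullet> W\<bar>"
    using n F_nonneg by (simp add: pe abs_mult)
  also have "\<dots> \<le> \<bar>p\<bar> + b * norm W" using cW by linarith
  finally have "(a * \<bar>\<alpha>\<bar>)\<^sup>2 \<le> (\<bar>p\<bar> + b * norm W)\<^sup>2" using ab by (intro power_mono) auto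
  also have "\<dots> \<le> 2 * p\<^sup>2 + 2 * b\<^sup>2 * (norm W)\<^sup>2"
    using zero_le_power2[of "\<bar>p\<bar> - b * norm W"] by (simp add: power2_sum power2_diff power_mult_distrib)
  finally have "a\<^sup>2 * \<alpha>\<^sup>2 \<le> 2 * p\<^sup>2 + 2 * b\<^sup>2 * (norm W)\<^sup>2" by (simp add: power_mult_distrib)
  then have \<alpha>2: "\<alpha>\<^sup>2 \<le> 2 / a\<^sup>2 * p\<^sup>2 + 2 * b\<^sup>2 / a\<^sup>2 * (norm W)\<^sup>2"
    using ab by (simp add: field_simps)
  define Y where "Y = a * \<mu>\<^sup>2 * (norm W)\<^sup>2"
  have Y: "(norm W)\<^sup>2 = Y / (a * \<mu>\<^sup>2)" "Y \<ge> 0" using ab mu by (auto simp: Y_def)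
  have "(norm V)\<^sup>2 \<le> 2 / a\<^sup>2 * p\<^sup>2 + (2 * b\<^sup>2 / a\<^sup>2 + 1) * (norm W)\<^sup>2"
    unfolding V2 using \<alpha>2 by (simp add: distrib_right)
  also have "\<dots> = 2 / a\<^sup>2 * p\<^sup>2 + (2 * b\<^sup>2 / a\<^sup>2 + 1) / (a * \<mu>\<^sup>2) * Y" unfolding Y by simp
  also have "\<dots> \<le> (2 / a\<^sup>2 + (2 * b\<^sup>2 / a\<^sup>2 + 1) / (a * \<mu>\<^sup>2)) * (Y + p\<^sup>2)"
  proof -
    have "0 \<le> 2 / a\<^sup>2 * Y" "0 \<le> (2 * b\<^sup>2 / a\<^sup>2 + 1) / (a * \<mu>\<^sup>2) * p\<^sup>2" using ab Y by auto
    then show ?thesis by (simp add: distrib_left distrib_right)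
  qed
  finally have "ell * (norm V)\<^sup>2 \<le> Y + p\<^sup>2"
    unfolding ell_def using ell_denominator by (simp add: field_simps)
  also have "\<dots> \<le> F \<xi> * Hs \<xi> V V + (cgrad F \<xi> \<bullet> V)\<^sup>2" using T1 by (simp add: Y_def p_def)
  finally show ?thesis .
qed

text \<open>Along the segment, F^2/2 minus the quadratic with coefficient \<open>ell / 2\<close> has
  nonnegative second derivative, hence lies above its tangent at the starting point. F is twice
  differentiable only away from 0, which the segment must avoid.\<close>

lemma strongly_convex_avoiding_0:
  assumes av: "\<And>t. 0 \<le> t \<Longrightarrow> t \<le> 1 \<Longrightarrow> \<xi> + t *\<^sub>R v \<noteq> 0"
  shows "(F (\<xi> + v))\<^sup>2 / 2 \<ge> (F \<xi>)\<^sup>2 / 2 + A \<xi> \<bullet> v + ell / 2 * (norm v)\<^sup>2"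
proof -
  let ?x = "\<lambda>t. \<xi> + t *\<^sub>R v"
  define k where "k t = (F (?x t))\<^sup>2 / 2 - ell / 2 * (norm v)\<^sup>2 * t\<^sup>2" for t
  define k1 where "k1 t = F (?x t) * (cgrad F (?x t) \<bullet> v) - ell * (norm v)\<^sup>2 * t" for t
  define k2 where "k2 t = (cgrad F (?x t) \<bullet> v)\<^sup>2 + F (?x t) * Hs (?x t) v v - ell * (norm v)\<^sup>2" for t
  have dF: "((\<lambda>t. F (?x t)) has_real_derivative cgrad F (?x t) \<bullet> v) (at t)" if "0 \<le> t" "t \<le> 1" for t
    by (rule line_deriv) (rule F_deriv[OF av[OF that]])
  have dG: "((\<lambda>t. cgrad F (?x t) \<bullet> v) has_real_derivative Hs (?x t) v v) (at t)" if "0 \<le> t" "t \<le> 1" for t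
  proof -
    have "((\<lambda>t. \<Sum>i\<in>Basis. (v \<bullet> i) * partial i F (?x t)) has_real_derivative
        (\<Sum>i\<in>Basis. (v \<bullet> i) * (cgrad (partial i F) (?x t) \<bullet> v))) (at t)"
      by (intro DERIV_sum DERIV_cmult line_deriv partial_F_deriv av that)
    then show ?thesis by (simp add: Hs_def cgrad_inner_sum)
  qed
  have d1: "(k has_real_derivative k1 t) (at t)" if "0 \<le> t" "t \<le> 1" for t
    unfolding k_def[abs_def] k1_def by (auto intro!: derivative_eq_intros dF[OF that])
  have d2: "(k1 has_real_derivative k2 t) (at t)" if "0 \<le> t" "t \<le> 1" for t
    unfolding k1_def[abs_def] k2_def
    by (auto intro!: derivative_eq_intros dF[OF that] dG[OF that] simp: power2_eq_square)
  have k2: "k2 t \<ge> 0" if "0 \<le> t" "t \<le> 1" for t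
    using second_variation_ge[OF av[OF that], of v] by (simp add: k2_def)
  obtain z where z: "0 < z" "z < 1" "k 1 - k 0 = (1 - 0) * k1 z"
    using MVT2[of 0 1 k k1] d1 by auto
  have "k1 0 \<le> k1 z"
  proof (rule DERIV_nonneg_imp_nondecreasing[of 0 z k1])
    show "\<exists>y. (k1 has_real_derivative y) (at t) \<and> 0 \<le> y" if "0 \<le> t" "t \<le> z" for t
      using d2[of t] k2[of t] that z by auto
  qed (use z in simp)
  then have "k 1 \<ge> k 0 + k1 0" using z by simp
  then show ?thesis by (simp add: k_def k1_def A_def)
qed

lemma A_line: "A (s *\<^sub>R e) \<bullet> e = s * (F e)\<^sup>2"
proof (cases "s = 0 \<or> e = 0")
  case False
  then have "A (s *\<^sub>R e) \<bullet> (s *\<^sub>R e) = (F (s *\<^sub>R e))\<^sup>2"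
    using euler[of "s *\<^sub>R e"] by (simp add: A_def power2_eq_square)
  then have "s * (A (s *\<^sub>R e) \<bullet> e) = s * (s * (F e)\<^sup>2)"
    using F_hom by (simp add: power_mult_distrib power2_eq_square[of s])
  then show ?thesis using False by simp
qed auto

text \<open>A segment through the origin lies on a line through the origin, where F^2 is exactly
  quadratic by homogeneity. The remainder is then (F e)^2/2 for the difference vector
  \<open>e\<close>, and \<open>ell_le\<close> bounds it from below.\<close>

lemma strongly_convex:
  "(F \<eta>)\<^sup>2 / 2 \<ge> (F \<xi>)\<^sup>2 / 2 + A \<xi> \<bullet> (\<eta> - \<xi>) + ell / 2 * (norm (\<eta> - \<xi>))\<^sup>2"
proof (cases "\<exists>t. 0 \<le> t \<and> t \<le> 1 \<and> \<xi> + t *\<^sub>R (\<eta> - \<xi>) = 0")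
  case False
  then show ?thesis using strongly_convex_avoiding_0[of \<xi> "\<eta> - \<xi>"] by auto
next
  case True
  then obtain t where t: "\<xi> + t *\<^sub>R (\<eta> - \<xi>) = 0" by blast
  define e where "e = \<eta> - \<xi>"
  have \<xi>: "\<xi> = (- t) *\<^sub>R e" using t by (simp add: e_def add_eq_0_iff2)
  have \<eta>: "\<eta> = (1 - t) *\<^sub>R e" using \<xi> by (simp add: e_def algebra_simps)
  have sq: "(F \<xi>)\<^sup>2 = t\<^sup>2 * (F e)\<^sup>2" "(F \<eta>)\<^sup>2 = (1 - t)\<^sup>2 * (F e)\<^sup>2" "A \<xi> \<bullet> e = - t * (F e)\<^sup>2"
    by (simp_all only: \<xi> \<eta> A_line F_hom[rule_format] power_mult_distrib power2_abs power2_minus)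
  have "(F \<eta>)\<^sup>2 / 2 - (F \<xi>)\<^sup>2 / 2 - A \<xi> \<bullet> e = (F e)\<^sup>2 / 2"
    unfolding sq by (simp add: power2_eq_square field_simps)
  moreover have "ell * (norm e)\<^sup>2 \<le> (F e)\<^sup>2"
  proof -
    have "ell * (norm e)\<^sup>2 \<le> a\<^sup>2 * (norm e)\<^sup>2" by (intro mult_right_mono ell_le) auto
    also have "\<dots> = (a * norm e)\<^sup>2" by (simp add: power_mult_distrib)
    also have "\<dots> \<le> (F e)\<^sup>2" using ab by (intro power_mono) auto
    finally show ?thesis .
  qed
  ultimately show ?thesis unfolding e_def[symmetric] by simp
qed

lemma A_strongly_monotone: "ell * (norm (\<eta> - \<xi>))\<^sup>2 \<le> (A \<eta> - A \<xi>) \<bullet> (\<eta> - \<xi>)"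
  using strongly_convex[of \<xi> \<eta>] strongly_convex[of \<eta> \<xi>]
  by (simp add: inner_diff_left inner_diff_right norm_minus_commute[of \<xi> \<eta>])

lemma A_coercive: "ell * (norm \<xi>)\<^sup>2 \<le> A \<xi> \<bullet> \<xi>"
  using A_strongly_monotone[of \<xi> 0] by simp

text \<open>Each endpoint differs from the midpoint by half of the difference, so strong convexity
  contributes \<open>ell / 2\<close> times a quarter of the squared distance. This term turns
  minimising sequences into Cauchy sequences.\<close>

lemma midpoint_convex:
  "(F ((1/2) *\<^sub>R (\<xi> + \<eta>)))\<^sup>2 / 2 + ell / 8 * (norm (\<xi> - \<eta>))\<^sup>2 \<le> ((F \<xi>)\<^sup>2 / 2 + (F \<eta>)\<^sup>2 / 2) / 2"
proof -
  define m where "m = (1/2) *\<^sub>R (\<xi> + \<eta>)"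
  have d: "\<xi> - m = (1/2) *\<^sub>R (\<xi> - \<eta>)" "\<eta> - m = - ((1/2) *\<^sub>R (\<xi> - \<eta>))"
    by (auto simp: m_def algebra_simps simp flip: scaleR_add_left)
  show ?thesis
    using strongly_convex[of m \<xi>] strongly_convex[of m \<eta>] unfolding d m_def[symmetric]
    by (simp add: power_divide power_mult_distrib)
qed

text \<open>Homogeneity of degree 1 is what lets a positive scalar factor of the gradient leave the
  flux when the solution is truncated.\<close>

lemma A_scale: "t > 0 \<Longrightarrow> A (t *\<^sub>R \<xi>) = t *\<^sub>R A \<xi>"
  using F_hom cgrad_F_hom[of \<xi> t] by (cases "\<xi> = 0") (auto simp: A_def)

lemma flux_term_A: "flux_term F \<xi> v = A \<xi> \<bullet> v"
  by (simp add: flux_term_def A_def)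

end

section \<open>The Dirichlet problem and the comparison principle\<close>

lemma test_fun_diff:
  assumes "test_fun \<Omega> \<phi>" "test_fun \<Omega> \<psi>"
  shows "test_fun \<Omega> (\<lambda>x. \<phi> x - \<psi> x)" "cgrad (\<lambda>x. \<phi> x - \<psi> x) x = cgrad \<phi> x - cgrad \<psi> x"
proof -
  have t: "test_fun \<Omega> (\<lambda>x. (-1) * \<psi> x)" by (rule test_fun_cmult[OF assms(2)])
  show "test_fun \<Omega> (\<lambda>x. \<phi> x - \<psi> x)" using test_fun_add[OF assms(1) t] by simp
  show "cgrad (\<lambda>x. \<phi> x - \<psi> x) x = cgrad \<phi> x - cgrad \<psi> x"
    using cgrad_add[OF test_funD(4)[OF assms(1)] test_funD(4)[OF t]] cgrad_cmult[OF test_funD(4)[OF assms(2)], of "-1"]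
    by simp
qed

locale anisotropic_domain = bounded_domain \<Omega> + finsler F a b \<mu> \<Lambda>
  for \<Omega> :: "'a::euclidean_space set" and F :: "'a \<Rightarrow> real" and a b \<mu> \<Lambda> :: real
begin

lemma A_borel: "A \<in> borel_measurable borel"
  by (intro borel_measurable_continuous_onI) (simp add: continuous_on_eq_continuous_at A_isCont)

lemma F_borel: "F \<in> borel_measurable borel"
proof (intro borel_measurable_continuous_onI, simp add: continuous_on_eq_continuous_at, rule allI)
  fix \<xi>
  show "isCont F \<xi>"
  proof (cases "\<xi> = 0")
    case True
    have "(F \<longlongrightarrow> 0) (at 0)"
    proof (rule Lim_null_comparison)
      show "\<forall>\<^sub>F x in at 0. norm (F x) \<le> b * norm x" using ab F_nonneg by simp
      have "((\<lambda>x::'a. b * norm x) \<longlongrightarrow> b * norm (0::'a)) (at 0)" by (intro tendsto_intros)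
      then show "((\<lambda>x::'a. b * norm x) \<longlongrightarrow> 0) (at 0)" by simp
    qed
    then show ?thesis using True by (simp add: isCont_def)
  qed (rule F_smooth)
qed

lemma A_sqint: "sqint M g \<Longrightarrow> sqint M (\<lambda>x. A (g x))"
  by (rule sqint_dominated[where g = g and C = "b\<^sup>2"])
    (auto intro: A_bound measurable_compose[OF sqint_measurable A_borel])

lemma F_sqint: "sqint M g \<Longrightarrow> sqint M (\<lambda>x. F (g x))"
  by (rule sqint_dominated[where g = g and C = b])
    (use ab F_nonneg in \<open>auto intro: measurable_compose[OF sqint_measurable F_borel]\<close>)

lemma A_L2_lim:
  assumes X: "L2_lim M X g"
  obtains r :: "nat \<Rightarrow> nat" where "strict_mono r" "L2_lim M (\<lambda>n x. A (X (r n) x)) (\<lambda>x. A (g x))"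
proof (rule L2_lim_superposition[OF X finite_M, of "\<lambda>_. A" "b^4"])
  show "(\<lambda>x. A (h x)) \<in> borel_measurable M" if "h \<in> borel_measurable M" for h
    by (rule measurable_compose[OF that A_borel])
  show "isCont A y" for y by (rule A_isCont)
  show "(norm (A y))\<^sup>2 \<le> b^4 * ((norm y)\<^sup>2 + 1)" for y
  proof -
    have "(norm (A y))\<^sup>2 \<le> (b\<^sup>2 * norm y)\<^sup>2" by (intro power_mono A_bound) auto
    also have "\<dots> = b^4 * (norm y)\<^sup>2" by (simp add: power_mult_distrib)
    also have "\<dots> \<le> b^4 * ((norm y)\<^sup>2 + 1)" by (intro mult_left_mono) auto
    finally show ?thesis .
  qed
qed (rule that)

section \<open>Minimisation of the Dirichlet energy\<close>

definition energy :: "('a \<Rightarrow> real) \<Rightarrow> ('a \<Rightarrow> real) \<Rightarrow> real" where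
  "energy f \<phi> = (\<integral>x. (F (cgrad \<phi> x))\<^sup>2 / 2 \<partial>M) - (\<integral>x. f x * \<phi> x \<partial>M)"

lemma energy_integrable:
  assumes "sqint M f" "test_fun \<Omega> \<phi>"
  shows "integrable M (\<lambda>x. (F (cgrad \<phi> x))\<^sup>2 / 2)" "integrable M (\<lambda>x. f x * \<phi> x)"
  using sqint_integrable[OF F_sqint[OF test_fun_sqint(2)[OF assms(2)]]] sqint_mult_integrable[OF assms(1) test_fun_sqint(1)[OF assms(2)]]
  by auto

lemma energy_bounded_below:
  assumes f: "sqint M f"
  obtains B where "\<And>\<phi>. test_fun \<Omega> \<phi> \<Longrightarrow> B \<le> energy f \<phi>"
proof -
  obtain P where P: "P > 0" "\<And>\<phi>. test_fun \<Omega> \<phi> \<Longrightarrow> (\<integral>x. (norm (\<phi> x))\<^sup>2 \<partial>M) \<le> P * (\<integral>x. (norm (cgrad \<phi> x))\<^sup>2 \<partial>M)"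
    using poincare_test by blast
  \<comment> \<open>With this weight, Young's inequality and the Poincare inequality leave exactly
    \<open>a\<^sup>2 / 2 * G\<close>, which the gradient part of the energy absorbs.\<close>
  define t where "t = P / a\<^sup>2"
  have t: "t > 0" using P ab by (simp add: t_def)
  have "- (t / 2 * (\<integral>x. (norm (f x))\<^sup>2 \<partial>M)) \<le> energy f \<phi>" if \<phi>: "test_fun \<Omega> \<phi>" for \<phi>
  proof -
    define G where "G = (\<integral>x. (norm (cgrad \<phi> x))\<^sup>2 \<partial>M)"
    have "(\<integral>x. f x * \<phi> x \<partial>M) \<le> t / 2 * (\<integral>x. (norm (f x))\<^sup>2 \<partial>M) + 1 / (2 * t) * (\<integral>x. (norm (\<phi> x))\<^sup>2 \<partial>M)"
      using sqint_inner_young[OF f test_fun_sqint(1)[OF \<phi>] t] by simp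
    also have "\<dots> \<le> t / 2 * (\<integral>x. (norm (f x))\<^sup>2 \<partial>M) + 1 / (2 * t) * (P * G)"
      unfolding G_def using P(2)[OF \<phi>] t by (intro add_mono mult_left_mono) auto
    also have "1 / (2 * t) * (P * G) = a\<^sup>2 / 2 * G" using P ab by (simp add: t_def)
    finally have 1: "(\<integral>x. f x * \<phi> x \<partial>M) \<le> t / 2 * (\<integral>x. (norm (f x))\<^sup>2 \<partial>M) + a\<^sup>2 / 2 * G" .
    have "a\<^sup>2 / 2 * G = (\<integral>x. a\<^sup>2 / 2 * (norm (cgrad \<phi> x))\<^sup>2 \<partial>M)" by (simp add: G_def)
    also have "\<dots> \<le> (\<integral>x. (F (cgrad \<phi> x))\<^sup>2 / 2 \<partial>M)"
    proof (rule integral_mono)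
      show "a\<^sup>2 / 2 * (norm (cgrad \<phi> x))\<^sup>2 \<le> (F (cgrad \<phi> x))\<^sup>2 / 2" for x
      proof -
        have "(a * norm (cgrad \<phi> x))\<^sup>2 \<le> (F (cgrad \<phi> x))\<^sup>2" using ab by (intro power_mono) auto
        then show ?thesis by (simp add: power_mult_distrib)
      qed
    qed (use energy_integrable[OF f \<phi>] sqint_integrable[OF test_fun_sqint(2)[OF \<phi>]] in auto)
    finally show ?thesis using 1 by (simp add: energy_def)
  qed
  then show thesis using that by blast
qed

lemma energy_midpoint:
  assumes f: "sqint M f" and \<phi>: "test_fun \<Omega> \<phi>" and \<psi>: "test_fun \<Omega> \<psi>"
  shows "energy f (\<lambda>x. 1/2 * (\<phi> x + \<psi> x)) + ell / 8 * (\<integral>x. (norm (cgrad \<phi> x - cgrad \<psi> x))\<^sup>2 \<partial>M)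
    \<le> (energy f \<phi> + energy f \<psi>) / 2"
proof -
  let ?m = "\<lambda>x. 1/2 * (\<phi> x + \<psi> x)"
  have m: "test_fun \<Omega> ?m" by (intro test_fun_cmult test_fun_add \<phi> \<psi>)
  have cm: "cgrad ?m x = (1/2) *\<^sub>R (cgrad \<phi> x + cgrad \<psi> x)" for x
    using cgrad_cmult[OF test_funD(4)[OF test_fun_add[OF \<phi> \<psi>]], of "1/2"] cgrad_add[OF test_funD(4)[OF \<phi>] test_funD(4)[OF \<psi>]] by simp
  note ints = energy_integrable[OF f m] energy_integrable[OF f \<phi>] energy_integrable[OF f \<psi>]
    sqint_integrable[OF sqint_diff[OF test_fun_sqint(2)[OF \<phi>] test_fun_sqint(2)[OF \<psi>]]]
  have "(\<integral>x. (F (cgrad ?m x))\<^sup>2 / 2 \<partial>M) + ell / 8 * (\<integral>x. (norm (cgrad \<phi> x - cgrad \<psi> x))\<^sup>2 \<partial>M)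
     = (\<integral>x. (F (cgrad ?m x))\<^sup>2 / 2 + ell / 8 * (norm (cgrad \<phi> x - cgrad \<psi> x))\<^sup>2 \<partial>M)"
    using ints by (subst Bochner_Integration.integral_add) auto
  also have "\<dots> \<le> (\<integral>x. ((F (cgrad \<phi> x))\<^sup>2 / 2 + (F (cgrad \<psi> x))\<^sup>2 / 2) / 2 \<partial>M)"
  proof (rule integral_mono)
    show "integrable M (\<lambda>x. (F (cgrad ?m x))\<^sup>2 / 2 + ell / 8 * (norm (cgrad \<phi> x - cgrad \<psi> x))\<^sup>2)"
      by (intro Bochner_Integration.integrable_add integrable_mult_right ints)
    show "integrable M (\<lambda>x. ((F (cgrad \<phi> x))\<^sup>2 / 2 + (F (cgrad \<psi> x))\<^sup>2 / 2) / 2)"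
      by (intro Bochner_Integration.integrable_add integrable_divide ints)
    show "(F (cgrad ?m x))\<^sup>2 / 2 + ell / 8 * (norm (cgrad \<phi> x - cgrad \<psi> x))\<^sup>2 \<le> ((F (cgrad \<phi> x))\<^sup>2 / 2 + (F (cgrad \<psi> x))\<^sup>2 / 2) / 2" for x
      unfolding cm by (rule midpoint_convex)
  qed
  also have "\<dots> = ((\<integral>x. (F (cgrad \<phi> x))\<^sup>2 / 2 \<partial>M) + (\<integral>x. (F (cgrad \<psi> x))\<^sup>2 / 2 \<partial>M)) / 2"
    using Bochner_Integration.integral_add[OF ints(3) ints(5)] by simp
  finally have 1: "(\<integral>x. (F (cgrad ?m x))\<^sup>2 / 2 \<partial>M) + ell / 8 * (\<integral>x. (norm (cgrad \<phi> x - cgrad \<psi> x))\<^sup>2 \<partial>M)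
    \<le> ((\<integral>x. (F (cgrad \<phi> x))\<^sup>2 / 2 \<partial>M) + (\<integral>x. (F (cgrad \<psi> x))\<^sup>2 / 2 \<partial>M)) / 2" .
  have 2: "(\<integral>x. f x * ?m x \<partial>M) = ((\<integral>x. f x * \<phi> x \<partial>M) + (\<integral>x. f x * \<psi> x \<partial>M)) / 2"
  proof -
    have "(\<integral>x. f x * ?m x \<partial>M) = (\<integral>x. (f x * \<phi> x + f x * \<psi> x) / 2 \<partial>M)" by (simp add: algebra_simps)
    then show ?thesis using Bochner_Integration.integral_add[OF ints(4) ints(6)] by simp
  qed
  show ?thesis using 1 unfolding energy_def 2 by argo
qed

text \<open>The tangent inequality is taken at the varied function and evaluated at the original
  one. It gives a one-sided estimate with the flux at the varied gradient, so the energy never has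
  to be differentiated under the integral.\<close>

lemma energy_variation:
  assumes f: "sqint M f" and \<phi>: "test_fun \<Omega> \<phi>" and \<psi>: "test_fun \<Omega> \<psi>"
  shows "energy f (\<lambda>x. \<phi> x + t * \<psi> x) - energy f \<phi>
    \<le> t * ((\<integral>x. A (cgrad \<phi> x + t *\<^sub>R cgrad \<psi> x) \<bullet> cgrad \<psi> x \<partial>M) - (\<integral>x. f x * \<psi> x \<partial>M))"
proof -
  let ?m = "\<lambda>x. \<phi> x + t * \<psi> x"
  have t\<psi>: "test_fun \<Omega> (\<lambda>x. t * \<psi> x)" by (intro test_fun_cmult \<psi>)
  have m: "test_fun \<Omega> ?m" by (intro test_fun_add \<phi> t\<psi>)
  have cm: "cgrad ?m x = cgrad \<phi> x + t *\<^sub>R cgrad \<psi> x" for x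
    using cgrad_add[OF test_funD(4)[OF \<phi>] test_funD(4)[OF t\<psi>]] cgrad_cmult[OF test_funD(4)[OF \<psi>]] by simp
  note ints = energy_integrable[OF f m] energy_integrable[OF f \<phi>] energy_integrable[OF f \<psi>]
  have iA: "integrable M (\<lambda>x. A (cgrad ?m x) \<bullet> cgrad \<psi> x)"
    by (intro sqint_inner_integrable A_sqint test_fun_sqint(2)[OF m] test_fun_sqint(2)[OF \<psi>])
  have "(\<integral>x. (F (cgrad ?m x))\<^sup>2 / 2 \<partial>M) - (\<integral>x. (F (cgrad \<phi> x))\<^sup>2 / 2 \<partial>M)
     = (\<integral>x. (F (cgrad ?m x))\<^sup>2 / 2 - (F (cgrad \<phi> x))\<^sup>2 / 2 \<partial>M)"
    using ints by (subst Bochner_Integration.integral_diff) auto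
  also have "\<dots> \<le> (\<integral>x. t * (A (cgrad ?m x) \<bullet> cgrad \<psi> x) \<partial>M)"
  proof (rule integral_mono)
    show "(F (cgrad ?m x))\<^sup>2 / 2 - (F (cgrad \<phi> x))\<^sup>2 / 2 \<le> t * (A (cgrad ?m x) \<bullet> cgrad \<psi> x)" for x
    proof -
      have "0 \<le> ell / 2 * (norm (cgrad \<phi> x - cgrad ?m x))\<^sup>2" using ell_pos by simp
      then show ?thesis
        using strongly_convex[of "cgrad ?m x" "cgrad \<phi> x"] by (simp add: cm)
    qed
  qed (use ints iA in auto)
  finally have 1: "(\<integral>x. (F (cgrad ?m x))\<^sup>2 / 2 \<partial>M) - (\<integral>x. (F (cgrad \<phi> x))\<^sup>2 / 2 \<partial>M) \<le> t * (\<integral>x. A (cgrad ?m x) \<bullet> cgrad \<psi> x \<partial>M)"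
    by simp
  have "(\<integral>x. f x * ?m x \<partial>M) = (\<integral>x. f x * \<phi> x + t * (f x * \<psi> x) \<partial>M)" by (simp add: algebra_simps)
  also have "\<dots> = (\<integral>x. f x * \<phi> x \<partial>M) + t * (\<integral>x. f x * \<psi> x \<partial>M)"
    using ints by (subst Bochner_Integration.integral_add) auto
  finally show ?thesis using 1 unfolding energy_def cm by (simp add: algebra_simps)
qed

definition solves :: "('a \<Rightarrow> real) \<Rightarrow> ('a \<Rightarrow> real) \<Rightarrow> ('a \<Rightarrow> 'a) \<Rightarrow> bool" where
  "solves f u g \<longleftrightarrow> H0 \<Omega> u g \<and>
     (\<forall>\<phi>. test_fun \<Omega> \<phi> \<longrightarrow> (\<integral>x. A (g x) \<bullet> cgrad \<phi> x \<partial>M) = (\<integral>x. f x * \<phi> x \<partial>M))"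

text \<open>Strong convexity makes every minimising sequence of test functions a Cauchy sequence, so no weak
  compactness is needed; the Euler--Lagrange equation is obtained along the sequence itself with
  increments \<open>1 / (k + 1)\<close>.\<close>
proposition Dirichlet_solvable:
  assumes f: "sqint M f"
  obtains u g where "solves f u g"
proof -
  define e where "e k = inverse (real (Suc k))" for k
  have e: "e k > 0" for k by (simp add: e_def)
  have e0: "e \<longlonglongrightarrow> 0" unfolding e_def[abs_def] by (rule LIMSEQ_inverse_real_of_nat)
  have edec: "e k \<le> e N" if "N \<le> k" for k N using that by (simp add: e_def)
  define S where "S = energy f ` {\<phi>. test_fun \<Omega> \<phi>}"
  obtain B where B: "\<And>\<phi>. test_fun \<Omega> \<phi> \<Longrightarrow> B \<le> energy f \<phi>" using energy_bounded_below[OF f] by blast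
  have S: "S \<noteq> {}" "bdd_below S" using B test_fun_zero by (auto simp: S_def intro!: bdd_belowI2)
  define m where "m = Inf S"
  have m: "m \<le> energy f \<phi>" if "test_fun \<Omega> \<phi>" for \<phi>
    unfolding m_def using S that by (intro cInf_lower) (auto simp: S_def)
  \<comment> \<open>The energy gap is the square of the increment \<open>e k\<close>, so that
    dividing the variation inequality by \<open>e k\<close> leaves an error \<open>e k\<close> that
    vanishes in the limit.\<close>
  have "\<exists>\<phi>. test_fun \<Omega> \<phi> \<and> energy f \<phi> < m + (e k)\<^sup>2" for k
  proof -
    have "m < m + (e k)\<^sup>2" using e[of k] by simp
    then show ?thesis unfolding m_def cInf_less_iff[OF S] by (auto simp: S_def)
  qed
  then have "\<forall>k. \<exists>\<phi>. test_fun \<Omega> \<phi> \<and> energy f \<phi> < m + (e k)\<^sup>2" by blast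
  from choice[OF this] obtain \<phi> where \<phi>: "\<And>k. test_fun \<Omega> (\<phi> k)" "\<And>k. energy f (\<phi> k) < m + (e k)\<^sup>2" by blast
  obtain P where P: "P > 0" "\<And>\<phi>. test_fun \<Omega> \<phi> \<Longrightarrow> (\<integral>x. (norm (\<phi> x))\<^sup>2 \<partial>M) \<le> P * (\<integral>x. (norm (cgrad \<phi> x))\<^sup>2 \<partial>M)"
    using poincare_test by blast
  define X where "X k x = (\<phi> k x, cgrad (\<phi> k) x)" for k x
  have sX: "sqint M (X k)" for k
    unfolding X_def[abs_def] sqint_Pair using test_fun_sqint[OF \<phi>(1)] by blast
  have est: "(\<integral>x. (norm (X j x - X k x))\<^sup>2 \<partial>M) \<le> (P + 1) * (8 / ell) * ((e j)\<^sup>2 + (e k)\<^sup>2)" for j k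
  proof -
    define D where "D = (\<integral>x. (norm (cgrad (\<phi> j) x - cgrad (\<phi> k) x))\<^sup>2 \<partial>M)"
    have "m \<le> energy f (\<lambda>x. 1/2 * (\<phi> j x + \<phi> k x))" by (intro m test_fun_cmult test_fun_add \<phi>)
    then have "ell / 8 * D \<le> ((e j)\<^sup>2 + (e k)\<^sup>2) / 2"
      using energy_midpoint[OF f \<phi>(1)[of j] \<phi>(1)[of k]] \<phi>(2)[of j] \<phi>(2)[of k] unfolding D_def by argo
    then have "ell / 8 * D \<le> (e j)\<^sup>2 + (e k)\<^sup>2" 
      using zero_le_power2[of "e j"] zero_le_power2[of "e k"] by argo
    then have "8 / ell * (ell / 8 * D) \<le> 8 / ell * ((e j)\<^sup>2 + (e k)\<^sup>2)" using ell_pos by (intro mult_left_mono) auto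
    then have D: "D \<le> 8 / ell * ((e j)\<^sup>2 + (e k)\<^sup>2)" using ell_pos by simp
    have "(\<integral>x. (norm (\<phi> j x - \<phi> k x))\<^sup>2 \<partial>M) \<le> P * D"
      using P(2)[OF test_fun_diff(1)[OF \<phi>(1)[of j] \<phi>(1)[of k]]]
      by (simp add: D_def test_fun_diff(2)[OF \<phi>(1)[of j] \<phi>(1)[of k]])
    moreover have "(\<integral>x. (norm (X j x - X k x))\<^sup>2 \<partial>M) = (\<integral>x. (norm (\<phi> j x - \<phi> k x))\<^sup>2 \<partial>M) + D"
      unfolding D_def
      by (subst Bochner_Integration.integral_add[symmetric])
        (auto intro!: sqint_integrable sqint_diff test_fun_sqint[OF \<phi>(1)] simp: X_def norm_Pair
          simp del: real_norm_def)
    ultimately have "(\<integral>x. (norm (X j x - X k x))\<^sup>2 \<partial>M) \<le> (P + 1) * D" by (simp add: distrib_right)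
    also have "\<dots> \<le> (P + 1) * (8 / ell * ((e j)\<^sup>2 + (e k)\<^sup>2))" using P D by (intro mult_left_mono) auto
    finally show ?thesis by (simp only: mult.assoc)
  qed
  obtain Y where Y: "L2_lim M X Y"
  proof (rule L2_complete[OF finite_M sX])
    fix \<epsilon> :: real assume \<epsilon>: "\<epsilon> > 0"
    define C where "C = (P + 1) * (8 / ell)"
    have C: "C > 0" using P ell_pos by (simp add: C_def)
    have "(\<lambda>k. C * ((e k)\<^sup>2 + (e k)\<^sup>2)) \<longlonglongrightarrow> C * (0\<^sup>2 + 0\<^sup>2)" by (intro tendsto_intros e0)
    then have "\<forall>\<^sub>F k in sequentially. C * ((e k)\<^sup>2 + (e k)\<^sup>2) < \<epsilon>" using \<epsilon> by (intro order_tendstoD(2)) auto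
    then obtain N where N: "C * ((e N)\<^sup>2 + (e N)\<^sup>2) < \<epsilon>" by (auto simp: eventually_sequentially)
    have "(\<integral>x. (norm (X j x - X k x))\<^sup>2 \<partial>M) \<le> \<epsilon>" if "j \<ge> N" "k \<ge> N" for j k
    proof -
      have "(\<integral>x. (norm (X j x - X k x))\<^sup>2 \<partial>M) \<le> C * ((e j)\<^sup>2 + (e k)\<^sup>2)" unfolding C_def by (rule est)
      also have "\<dots> \<le> C * ((e N)\<^sup>2 + (e N)\<^sup>2)"
        using C that edec by (intro mult_left_mono add_mono power_mono) (auto intro: less_imp_le[OF e])
      finally show ?thesis using N by linarith
    qed
    then show "\<exists>N. \<forall>m\<ge>N. \<forall>n\<ge>N. (\<integral>x. (norm (X m x - X n x))\<^sup>2 \<partial>M) \<le> \<epsilon>" by blast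
  qed (rule that)
  define u g where "u x = fst (Y x)" and "g x = snd (Y x)" for x
  have lim: "L2_lim M (\<lambda>k x. (\<phi> k x, cgrad (\<phi> k) x)) (\<lambda>x. (u x, g x))"
    using Y by (simp add: X_def[abs_def] u_def g_def)
  then have Hug: "H0 \<Omega> u g" unfolding H0c_def using \<phi>(1) by blast
  have limg: "L2_lim M (\<lambda>k. cgrad (\<phi> k)) g" using lim unfolding L2_lim_Pair by blast
  have EL: "0 \<le> (\<integral>x. A (g x) \<bullet> cgrad \<psi> x \<partial>M) - (\<integral>x. f x * \<psi> x \<partial>M)" if \<psi>: "test_fun \<Omega> \<psi>" for \<psi>
  proof -
    note sG = test_fun_sqint(2)[OF \<psi>]
    have "L2_lim M (\<lambda>k x. e k *\<^sub>R cgrad \<psi> x) (\<lambda>x. 0)"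
    proof (rule L2_limI)
      have "(\<lambda>k. (e k)\<^sup>2 * (\<integral>x. (norm (cgrad \<psi> x))\<^sup>2 \<partial>M)) \<longlonglongrightarrow> 0\<^sup>2 * (\<integral>x. (norm (cgrad \<psi> x))\<^sup>2 \<partial>M)"
        by (intro tendsto_intros e0)
      then show "(\<lambda>k. \<integral>x. (norm (e k *\<^sub>R cgrad \<psi> x - 0))\<^sup>2 \<partial>M) \<longlonglongrightarrow> 0"
        by (simp add: power_mult_distrib)
    qed (auto intro: sqint_scaleR sG)
    from L2_lim_add[OF limg this]
    have lk: "L2_lim M (\<lambda>k x. cgrad (\<phi> k) x + e k *\<^sub>R cgrad \<psi> x) g" by simp
    obtain r :: "nat \<Rightarrow> nat" where r: "strict_mono r"
      "L2_lim M (\<lambda>k x. A (cgrad (\<phi> (r k)) x + e (r k) *\<^sub>R cgrad \<psi> x)) (\<lambda>x. A (g x))"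
      by (rule A_L2_lim[OF lk])
    have "(\<lambda>k. \<integral>x. A (cgrad (\<phi> (r k)) x + e (r k) *\<^sub>R cgrad \<psi> x) \<bullet> cgrad \<psi> x \<partial>M) \<longlonglongrightarrow> (\<integral>x. A (g x) \<bullet> cgrad \<psi> x \<partial>M)"
      by (rule L2_lim_inner[OF r(2) L2_lim_const[OF sG]])
    then have lim: "(\<lambda>k. (\<integral>x. A (cgrad (\<phi> (r k)) x + e (r k) *\<^sub>R cgrad \<psi> x) \<bullet> cgrad \<psi> x \<partial>M) - (\<integral>x. f x * \<psi> x \<partial>M) + e (r k))
        \<longlonglongrightarrow> (\<integral>x. A (g x) \<bullet> cgrad \<psi> x \<partial>M) - (\<integral>x. f x * \<psi> x \<partial>M) + 0"
      using LIMSEQ_subseq_LIMSEQ[OF e0 r(1)] by (intro tendsto_add tendsto_diff tendsto_const) (simp_all add: o_def)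
    have "0 \<le> (\<integral>x. A (cgrad (\<phi> k) x + e k *\<^sub>R cgrad \<psi> x) \<bullet> cgrad \<psi> x \<partial>M) - (\<integral>x. f x * \<psi> x \<partial>M) + e k" for k
    proof -
      define I where "I = (\<integral>x. A (cgrad (\<phi> k) x + e k *\<^sub>R cgrad \<psi> x) \<bullet> cgrad \<psi> x \<partial>M) - (\<integral>x. f x * \<psi> x \<partial>M)"
      have "m \<le> energy f (\<lambda>x. \<phi> k x + e k * \<psi> x)" by (intro m test_fun_add test_fun_cmult \<phi> \<psi>)
      then have "- (e k)\<^sup>2 \<le> e k * I"
        using energy_variation[OF f \<phi>(1)[of k] \<psi>, of "e k"] \<phi>(2)[of k] unfolding I_def by linarith
      then have "0 \<le> e k * (I + e k)" by (simp add: distrib_left power2_eq_square)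
      then show ?thesis using e[of k] unfolding I_def by (simp add: zero_le_mult_iff)
    qed
    then show ?thesis using LIMSEQ_le_const[OF lim, of 0] by simp
  qed
  have "(\<integral>x. A (g x) \<bullet> cgrad \<psi> x \<partial>M) = (\<integral>x. f x * \<psi> x \<partial>M)" if \<psi>: "test_fun \<Omega> \<psi>" for \<psi>
  proof -
    have "cgrad (\<lambda>x. (-1) * \<psi> x) x = - cgrad \<psi> x" for x
      using cgrad_cmult[OF test_funD(4)[OF \<psi>], of "-1"] by simp
    with EL[OF test_fun_cmult[OF \<psi>, of "-1"]]
    have "0 \<le> - (\<integral>x. A (g x) \<bullet> cgrad \<psi> x \<partial>M) + (\<integral>x. f x * \<psi> x \<partial>M)" by simp
    with EL[OF \<psi>] show ?thesis by linarith
  qed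
  then show thesis using that Hug unfolding solves_def by blast
qed

end

section \<open>Comparison, order and stability for the Dirichlet problem\<close>

context anisotropic_domain
begin

lemma solvesD:
  assumes "solves f u g"
  shows "H0 \<Omega> u g" "sqint M u" "sqint M g" "sqint M (\<lambda>x. A (g x))"
    "test_fun \<Omega> \<phi> \<Longrightarrow> (\<integral>x. A (g x) \<bullet> cgrad \<phi> x \<partial>M) = (\<integral>x. f x * \<phi> x \<partial>M)"
  using assms H0c_sqint[of "test_fun \<Omega>" \<Omega> u g] A_sqint by (auto simp: solves_def)

text \<open>The inequality is tested with the negative part of w, on whose support coercivity of
  \<open>A\<close> gives the opposite sign; its gradient vanishes, and Poincare finishes. The
  boundary condition enters as membership of that negative part in the closure of the nonnegative
  test functions.\<close>

lemma supersolution_nonneg: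
  assumes h: "sqint M h"
    and H: "H0c (nonneg_test \<Omega>) \<Omega> (\<lambda>x. max 0 (- w x)) (\<lambda>x. if w x < 0 then - h x else 0)"
    and le: "\<And>\<phi>. nonneg_test \<Omega> \<phi> \<Longrightarrow> 0 \<le> (\<integral>x. A (h x) \<bullet> cgrad \<phi> x \<partial>M)"
  shows "AE x in M. 0 \<le> w x"
proof -
  let ?G = "\<lambda>x. if w x < 0 then - h x else 0"
  obtain P where P: "P > 0" "\<And>u g. H0 \<Omega> u g \<Longrightarrow> (\<integral>x. (norm (u x))\<^sup>2 \<partial>M) \<le> P * (\<integral>x. (norm (g x))\<^sup>2 \<partial>M)"
    using poincare by blast
  note sG = H0c_sqint(2)[OF H] and sA = A_sqint[OF h]
  have "(\<integral>x. - A (h x) \<bullet> ?G x \<partial>M) \<le> 0"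
    by (rule H0c_test_le[OF sqint_uminus[OF sA] _ H]) (use le in simp)
  moreover have "(\<integral>x. ell * (norm (?G x))\<^sup>2 \<partial>M) \<le> (\<integral>x. - A (h x) \<bullet> ?G x \<partial>M)"
  proof (rule integral_mono)
    show "integrable M (\<lambda>x. ell * (norm (?G x))\<^sup>2)" using sqint_integrable[OF sG] by simp
    show "integrable M (\<lambda>x. - A (h x) \<bullet> ?G x)" by (rule sqint_inner_integrable[OF sqint_uminus[OF sA] sG])
    show "ell * (norm (?G x))\<^sup>2 \<le> - A (h x) \<bullet> ?G x" for x using A_coercive[of "h x"] by simp
  qed
  ultimately have "ell * (\<integral>x. (norm (?G x))\<^sup>2 \<partial>M) \<le> 0" by simp
  then have "(\<integral>x. (norm (?G x))\<^sup>2 \<partial>M) \<le> 0" using ell_pos by (simp add: mult_le_0_iff)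
  then have "P * (\<integral>x. (norm (?G x))\<^sup>2 \<partial>M) \<le> 0" using P(1) by (simp add: mult_le_0_iff)
  with P(2)[OF H0c_mono[OF H]] have "(\<integral>x. (norm (max 0 (- w x)))\<^sup>2 \<partial>M) \<le> 0" by force
  then have "AE x in M. max 0 (- w x) = 0" by (rule sqint_eq_0_AE[OF H0c_sqint(1)[OF H]])
  then show ?thesis by eventually_elim (simp add: max_def split: if_splits)
qed

text \<open>The positive part of \<open>u - w\<close> is not known to be an admissible test function, because \<open>w\<close> is only a
  Sobolev function on \<open>\<Omega>\<close>. For a test function \<open>\<phi>\<close> close to \<open>u\<close> the positive part of \<open>\<phi> - w\<close> is supported
  in the support of \<open>\<phi>\<close>, where \<open>w\<close> may be replaced by a cut-off.\<close>
proposition comparison_principle: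
  assumes u: "H0 \<Omega> u g" and w: "sqint M w" and h: "sqint M h" and wh: "weak_gradient \<Omega> w h"
    and w0: "AE x in M. 0 \<le> w x"
    and le: "\<And>\<phi>. nonneg_test \<Omega> \<phi> \<Longrightarrow> (\<integral>x. (A (g x) - A (h x)) \<bullet> cgrad \<phi> x \<partial>M) \<le> 0"
  shows "AE x in M. u x \<le> w x"
proof -
  obtain \<phi> where \<phi>: "\<And>k. test_fun \<Omega> (\<phi> k)" "L2_lim M \<phi> u" "L2_lim M (\<lambda>k. cgrad (\<phi> k)) g"
    using H0cE[OF u] by blast
  obtain P where P: "P > 0" "\<And>u g. H0 \<Omega> u g \<Longrightarrow> (\<integral>x. (norm (u x))\<^sup>2 \<partial>M) \<le> P * (\<integral>x. (norm (g x))\<^sup>2 \<partial>M)"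
    using poincare by blast
  note su = H0c_sqint(1)[OF u] and sg = H0c_sqint(2)[OF u]
  define V where "V x = A (g x) - A (h x)" for x
  have sV: "sqint M V" unfolding V_def[abs_def] by (intro sqint_diff A_sqint sg h)
  have sd: "sqint M (\<lambda>x. g x - h x)" by (intro sqint_diff sg h)
  define N where "N = (\<integral>x. (norm (V x))\<^sup>2 \<partial>M)"
  define d where "d k = (\<integral>x. (norm (g x - cgrad (\<phi> k) x))\<^sup>2 \<partial>M)" for k
  define q where "q k = (\<integral>x. (norm (u x - \<phi> k x))\<^sup>2 \<partial>M)" for k
  have d0: "d \<longlonglongrightarrow> 0" using L2_lim_tendsto[OF \<phi>(3)] by (simp add: d_def[abs_def] norm_minus_commute)
  have q0: "q \<longlonglongrightarrow> 0" using L2_lim_tendsto[OF \<phi>(2)] by (simp add: q_def[abs_def] power2_commute)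
  let ?p = "\<lambda>x. max 0 (u x - w x)"
  have sp: "sqint M ?p"
    by (rule sqint_dominated[OF sqint_diff[OF su w], where C = 1])
      (use sqint_measurable[OF su] sqint_measurable[OF w] in auto)
  \<comment> \<open>The term under the root is the price of testing with the gradient of the
    approximant instead of g; \<open>d k\<close> and \<open>q k\<close> measure the replacement of g
    and u themselves, and P comes from the Poincare inequality.\<close>
  have est: "(\<integral>x. (norm (?p x))\<^sup>2 \<partial>M) \<le> 4 * P / ell * sqrt (N * d k) + 4 * P * d k + 2 * q k" for k
  proof -
    note t = \<phi>(1)[of k]
    let ?K = "closure {x. \<phi> k x \<noteq> 0}"
    obtain \<zeta> \<delta> where \<zeta>: "test_fun \<Omega> \<zeta>" "\<And>x. 0 \<le> \<zeta> x" and \<delta>: "\<delta> > 0"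
      "\<And>x y. y \<in> ?K \<Longrightarrow> dist x y \<le> \<delta> \<Longrightarrow> x \<in> \<Omega> \<and> \<zeta> x = 1 \<and> cgrad \<zeta> x = 0"
      using cutoff_exists[OF test_funD(2)[OF t] open_domain test_funD(3)[OF t]] by blast
    have K: "\<zeta> x = 1" "cgrad \<zeta> x = 0" if "\<phi> k x \<noteq> 0" for x
    proof -
      have "x \<in> ?K" using that closure_subset[of "{x. \<phi> k x \<noteq> 0}"] by auto
      then show "\<zeta> x = 1" "cgrad \<zeta> x = 0" using \<delta>(2)[of x x] \<delta>(1) by auto
    qed
    define z where "z x = \<phi> k x - \<zeta> x * w x" for x
    define y where "y x = cgrad (\<phi> k) x - (\<zeta> x *\<^sub>R h x + w x *\<^sub>R cgrad \<zeta> x)" for x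
    have "H0 \<Omega> z y" unfolding z_def[abs_def] y_def[abs_def]
      by (rule H0_diff[OF H0_test[OF t] H0_cutoff_mult[OF w h wh \<zeta>(1)]])
    note pos = H0_pos_part[OF this]
    define G where "G x = (if 0 < z x then y x else 0)" for x
    have sG: "sqint M G" unfolding G_def[abs_def] by (rule H0c_sqint(2)[OF pos])
    have zM: "z \<in> borel_measurable M"
      unfolding z_def[abs_def] using sqint_measurable[OF w] borel_M[OF test_fun_borel[OF \<zeta>(1)]] borel_M[OF test_fun_borel[OF t]]
      by measurable
    define I where "I x = (if 0 < z x then 1 else 0 :: real)" for x
    have IM: "I \<in> borel_measurable M" unfolding I_def[abs_def] using zM by measurable
    have sI: "sqint M (\<lambda>x. I x *\<^sub>R f x)" if "sqint M f" for f :: "'a \<Rightarrow> 'a"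
      by (rule sqint_bounded_scaleR[OF that IM, of 1]) (auto simp: I_def)
    \<comment> \<open>Both \<zeta> and w are nonnegative, so z can be positive only where the
      approximant is nonzero; there \<zeta> is 1 with zero gradient, and the cut-off leaves no trace
      in \<open>G\<close>.\<close>
    have zpos: "AE x in M. 0 < z x \<longrightarrow> \<phi> k x \<noteq> 0"
      using w0
    proof eventually_elim
      case (elim x)
      then show ?case using mult_nonneg_nonneg[OF \<zeta>(2)[of x] elim] by (auto simp: z_def)
    qed
    have GI: "AE x in M. G x = I x *\<^sub>R (cgrad (\<phi> k) x - h x)"
      using zpos by eventually_elim (auto simp: G_def I_def y_def K)
    \<comment> \<open>Monotonicity of \<open>A\<close> applies to g - h, while the admissible
      gradient involves the approximant in place of g; the difference is the error measured by
      \<open>d k\<close>.\<close>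
    have GI2: "AE x in M. G x = I x *\<^sub>R (g x - h x) - I x *\<^sub>R (g x - cgrad (\<phi> k) x)"
      using GI
    proof eventually_elim
      case (elim x)
      show ?case unfolding elim by (simp add: algebra_simps)
    qed
    have sdI: "sqint M (\<lambda>x. I x *\<^sub>R (g x - h x))" by (rule sI[OF sd])
    have seI: "sqint M (\<lambda>x. I x *\<^sub>R (g x - cgrad (\<phi> k) x))" by (intro sI sqint_diff sg test_fun_sqint(2)[OF t])
    define D where "D = (\<integral>x. (norm (I x *\<^sub>R (g x - h x)))\<^sup>2 \<partial>M)"
    have eI: "(\<integral>x. (norm (I x *\<^sub>R (g x - cgrad (\<phi> k) x)))\<^sup>2 \<partial>M) \<le> d k"
      unfolding d_def
      by (intro integral_mono sqint_integrable seI sqint_diff sg test_fun_sqint(2)[OF t]) (auto simp: I_def)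
    have "(\<integral>x. V x \<bullet> G x \<partial>M) \<le> 0"
      unfolding G_def by (rule H0c_test_le[OF sV _ pos]) (use le in \<open>simp add: V_def\<close>)
    moreover have "(\<integral>x. V x \<bullet> G x \<partial>M) = (\<integral>x. V x \<bullet> (I x *\<^sub>R (g x - h x)) - V x \<bullet> (I x *\<^sub>R (g x - cgrad (\<phi> k) x)) \<partial>M)"
    proof (rule integral_cong_AE)
      show "(\<lambda>x. V x \<bullet> G x) \<in> borel_measurable M"
        using sqint_inner_integrable[OF sV sG] by auto
      show "(\<lambda>x. V x \<bullet> (I x *\<^sub>R (g x - h x)) - V x \<bullet> (I x *\<^sub>R (g x - cgrad (\<phi> k) x))) \<in> borel_measurable M"
        using sqint_inner_integrable[OF sV sdI] sqint_inner_integrable[OF sV seI] by auto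
      show "AE x in M. V x \<bullet> G x = V x \<bullet> (I x *\<^sub>R (g x - h x)) - V x \<bullet> (I x *\<^sub>R (g x - cgrad (\<phi> k) x))"
        using GI2 by eventually_elim (simp only: inner_diff_right)
    qed
    ultimately have 1: "(\<integral>x. V x \<bullet> (I x *\<^sub>R (g x - h x)) \<partial>M) \<le> (\<integral>x. V x \<bullet> (I x *\<^sub>R (g x - cgrad (\<phi> k) x)) \<partial>M)"
      using sqint_inner_integrable[OF sV sdI] sqint_inner_integrable[OF sV seI] by simp
    have "ell * D = (\<integral>x. ell * (norm (I x *\<^sub>R (g x - h x)))\<^sup>2 \<partial>M)" by (simp add: D_def)
    also have "\<dots> \<le> (\<integral>x. V x \<bullet> (I x *\<^sub>R (g x - h x)) \<partial>M)"
    proof (rule integral_mono)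
      show "integrable M (\<lambda>x. ell * (norm (I x *\<^sub>R (g x - h x)))\<^sup>2)" using sqint_integrable[OF sdI] by simp
      show "integrable M (\<lambda>x. V x \<bullet> (I x *\<^sub>R (g x - h x)))" by (rule sqint_inner_integrable[OF sV sdI])
      show "ell * (norm (I x *\<^sub>R (g x - h x)))\<^sup>2 \<le> V x \<bullet> (I x *\<^sub>R (g x - h x))" for x
        using A_strongly_monotone[of "g x" "h x"] by (simp add: I_def V_def)
    qed
    also note 1
    also have "(\<integral>x. V x \<bullet> (I x *\<^sub>R (g x - cgrad (\<phi> k) x)) \<partial>M) \<le> sqrt (N * d k)"
    proof (rule real_le_rsqrt)
      have "(\<integral>x. V x \<bullet> (I x *\<^sub>R (g x - cgrad (\<phi> k) x)) \<partial>M)\<^sup>2 \<le> N * (\<integral>x. (norm (I x *\<^sub>R (g x - cgrad (\<phi> k) x)))\<^sup>2 \<partial>M)"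
        unfolding N_def by (rule sqint_Cauchy_Schwarz[OF sV seI])
      also have "\<dots> \<le> N * d k" using eI by (intro mult_left_mono) (auto simp: N_def)
      finally show "(\<integral>x. V x \<bullet> (I x *\<^sub>R (g x - cgrad (\<phi> k) x)) \<partial>M)\<^sup>2 \<le> N * d k" .
    qed
    finally have D: "D \<le> sqrt (N * d k) / ell" using ell_pos by (simp add: field_simps)
    have "(\<integral>x. (norm (G x))\<^sup>2 \<partial>M) \<le> (\<integral>x. 2 * (norm (I x *\<^sub>R (g x - h x)))\<^sup>2 + 2 * (norm (I x *\<^sub>R (g x - cgrad (\<phi> k) x)))\<^sup>2 \<partial>M)"
    proof (rule integral_mono_AE)
      show "integrable M (\<lambda>x. (norm (G x))\<^sup>2)" by (rule sqint_integrable[OF sG])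
      show "integrable M (\<lambda>x. 2 * (norm (I x *\<^sub>R (g x - h x)))\<^sup>2 + 2 * (norm (I x *\<^sub>R (g x - cgrad (\<phi> k) x)))\<^sup>2)"
        by (intro Bochner_Integration.integrable_add integrable_mult_right sqint_integrable[OF sdI] sqint_integrable[OF seI])
      show "AE x in M. (norm (G x))\<^sup>2 \<le> 2 * (norm (I x *\<^sub>R (g x - h x)))\<^sup>2 + 2 * (norm (I x *\<^sub>R (g x - cgrad (\<phi> k) x)))\<^sup>2"
        using GI2 by eventually_elim (simp only: norm_diff_power2_le)
    qed
    also have "\<dots> = 2 * D + 2 * (\<integral>x. (norm (I x *\<^sub>R (g x - cgrad (\<phi> k) x)))\<^sup>2 \<partial>M)"
      unfolding D_def by (subst Bochner_Integration.integral_add[OF integrable_mult_right[OF sqint_integrable[OF sdI]] integrable_mult_right[OF sqint_integrable[OF seI]]]) simp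
    also have "\<dots> \<le> 2 * (sqrt (N * d k) / ell) + 2 * d k" using D eI by (intro add_mono mult_left_mono) auto
    finally have G: "(\<integral>x. (norm (G x))\<^sup>2 \<partial>M) \<le> 2 * (sqrt (N * d k) / ell) + 2 * d k" .
    let ?z = "\<lambda>x. max 0 (z x)"
    have sz: "sqint M ?z" by (rule H0c_sqint(1)[OF pos])
    have "(\<integral>x. (norm (?z x))\<^sup>2 \<partial>M) \<le> P * (\<integral>x. (norm (G x))\<^sup>2 \<partial>M)"
      unfolding G_def by (rule P(2)[OF H0c_mono[OF pos]]) blast
    also have "\<dots> \<le> P * (2 * (sqrt (N * d k) / ell) + 2 * d k)" using P G by (intro mult_left_mono) auto
    finally have Z: "(\<integral>x. (norm (?z x))\<^sup>2 \<partial>M) \<le> P * (2 * (sqrt (N * d k) / ell) + 2 * d k)" .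
    have squ: "sqint M (\<lambda>x. u x - \<phi> k x)" by (intro sqint_diff su test_fun_sqint(1)[OF t])
    have "(\<integral>x. (norm (?p x))\<^sup>2 \<partial>M) \<le> (\<integral>x. 2 * (norm (?z x))\<^sup>2 + 2 * (norm (u x - \<phi> k x))\<^sup>2 \<partial>M)"
    proof (rule integral_mono_AE)
      show "integrable M (\<lambda>x. (norm (?p x))\<^sup>2)" by (rule sqint_integrable[OF sp])
      show "integrable M (\<lambda>x. 2 * (norm (?z x))\<^sup>2 + 2 * (norm (u x - \<phi> k x))\<^sup>2)"
        by (intro Bochner_Integration.integrable_add integrable_mult_right sqint_integrable[OF sz] sqint_integrable[OF squ])
      show "AE x in M. (norm (?p x))\<^sup>2 \<le> 2 * (norm (?z x))\<^sup>2 + 2 * (norm (u x - \<phi> k x))\<^sup>2"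
        using w0
      proof eventually_elim
        case (elim x)
        \<comment> \<open>Where the approximant vanishes the left side is 0 because w is
          nonnegative; elsewhere \<zeta> = 1 and both sides agree.\<close>
        have "max 0 (\<phi> k x - w x) \<le> ?z x"
          using K[of x] elim by (cases "\<phi> k x = 0") (auto simp: z_def)
        then have "norm (?p x) \<le> norm (?z x + \<bar>u x - \<phi> k x\<bar>)" by auto
        then have "(norm (?p x))\<^sup>2 \<le> (norm (?z x + \<bar>u x - \<phi> k x\<bar>))\<^sup>2" by (intro power_mono) auto
        also have "\<dots> \<le> 2 * (norm (?z x))\<^sup>2 + 2 * (norm \<bar>u x - \<phi> k x\<bar>)\<^sup>2" by (rule norm_add_power2_le)
        finally show ?case by simp
      qed
    qed
    also have "\<dots> = 2 * (\<integral>x. (norm (?z x))\<^sup>2 \<partial>M) + 2 * q k"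
      unfolding q_def by (subst Bochner_Integration.integral_add[OF integrable_mult_right[OF sqint_integrable[OF sz]] integrable_mult_right[OF sqint_integrable[OF squ]]]) simp
    also have "\<dots> \<le> 2 * (P * (2 * (sqrt (N * d k) / ell) + 2 * d k)) + 2 * q k" using Z by simp
    finally show ?thesis by (simp add: algebra_simps)
  qed
  have "(\<lambda>k. 4 * P / ell * sqrt (N * d k) + 4 * P * d k + 2 * q k) \<longlonglongrightarrow> 4 * P / ell * sqrt (N * 0) + 4 * P * 0 + 2 * 0"
    by (intro tendsto_intros d0 q0)
  then have "(\<integral>x. (norm (?p x))\<^sup>2 \<partial>M) \<le> 0"
    using est by (intro LIMSEQ_le_const[of _ 0]) auto
  then have "AE x in M. ?p x = 0" by (rule sqint_eq_0_AE[OF sp])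
  then show ?thesis by eventually_elim (simp add: max_def split: if_splits)
qed

text \<open>The gradient in the differential inequality is identified, by uniqueness, with the
  square integrable one of \<open>W12\<close>, and its restriction to the set where w is negative
  with the gradient of the minimum of w and 0. The negative part then becomes a legitimate test
  object, and w is nonnegative.\<close>

lemma supersolutionE:
  assumes "supersolution F \<Omega> lam w" and lam: "lam \<ge> 0"
  obtains h where "sqint M w" "sqint M h" "weak_gradient \<Omega> w h" "AE x in M. 0 \<le> w x"
    "\<And>\<phi>. nonneg_test \<Omega> \<phi> \<Longrightarrow> integrable M (\<lambda>x. exp (w x) * \<phi> x)"
    "\<And>\<phi>. nonneg_test \<Omega> \<phi> \<Longrightarrow> lam * (\<integral>x. exp (w x) * \<phi> x \<partial>M) \<le> (\<integral>x. A (h x) \<bullet> cgrad \<phi> x \<partial>M)"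
proof -
  from assms(1) obtain h k h' where w: "sqint M w" "sqint M h'" "weak_gradient \<Omega> w h'" "H0 \<Omega> (\<lambda>x. min (w x) 0) k"
    and wh: "weak_gradient \<Omega> w h"
    and sup: "\<And>\<phi>. nonneg_test \<Omega> \<phi> \<Longrightarrow> integrable M (\<lambda>x. exp (w x) * \<phi> x)"
      "\<And>\<phi>. nonneg_test \<Omega> \<phi> \<Longrightarrow> lam * (\<integral>x. exp (w x) * \<phi> x \<partial>M) \<le> (\<integral>x. A (h x) \<bullet> cgrad \<phi> x \<partial>M)"
    unfolding supersolution_def W12_M W012_M set_integrable_M set_integral_M flux_term_A by blast
  have h: "sqint M h"
    by (rule sqint_cong_AE[OF w(2) weak_gradient_unique[OF w(3) wh] weak_gradientD(1)[OF wh]])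
  have "H0 \<Omega> (\<lambda>x. min (w x) 0) (\<lambda>x. if w x < 0 then h x else 0)"
    by (rule H0_unique_gradient[OF w(4) weak_gradient_min[OF w(1) h wh]])
  from H0_pos_part[OF H0_uminus[OF this]]
  have "H0c (nonneg_test \<Omega>) \<Omega> (\<lambda>x. max 0 (- min (w x) 0)) (\<lambda>x. if 0 < - min (w x) 0 then - (if w x < 0 then h x else 0) else 0)" .
  moreover have "(\<lambda>x. max 0 (- min (w x) 0)) = (\<lambda>x. max 0 (- w x))"
    "(\<lambda>x. if 0 < - min (w x) 0 then - (if w x < 0 then h x else 0) else 0) = (\<lambda>x. if w x < 0 then - h x else 0)"
    by (auto simp: fun_eq_iff max_def min_def)
  ultimately have H: "H0c (nonneg_test \<Omega>) \<Omega> (\<lambda>x. max 0 (- w x)) (\<lambda>x. if w x < 0 then - h x else 0)" by metis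
  have "AE x in M. 0 \<le> w x"
  proof (rule supersolution_nonneg[OF h H])
    fix \<phi> assume \<phi>: "nonneg_test \<Omega> \<phi>"
    have "0 \<le> lam * (\<integral>x. exp (w x) * \<phi> x \<partial>M)"
      using lam \<phi> by (intro mult_nonneg_nonneg Bochner_Integration.integral_nonneg) auto
    then show "0 \<le> (\<integral>x. A (h x) \<bullet> cgrad \<phi> x \<partial>M)" using sup(2)[OF \<phi>] by linarith
  qed
  then show thesis using that[OF w(1) h wh _ sup] by blast
qed

text \<open>One step of the iteration: with f the nonlinearity frozen at a function already below w,
  the solution stays below w.\<close>

lemma solves_le_supersolution:
  assumes u: "solves f u g" and f: "sqint M f" and lam: "lam \<ge> 0" and w: "supersolution F \<Omega> lam w"
    and le: "AE x in M. f x \<le> lam * exp (w x)"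
  shows "AE x in M. u x \<le> w x"
proof -
  obtain h where h: "sqint M w" "sqint M h" "weak_gradient \<Omega> w h" "AE x in M. 0 \<le> w x"
    "\<And>\<phi>. nonneg_test \<Omega> \<phi> \<Longrightarrow> integrable M (\<lambda>x. exp (w x) * \<phi> x)"
    "\<And>\<phi>. nonneg_test \<Omega> \<phi> \<Longrightarrow> lam * (\<integral>x. exp (w x) * \<phi> x \<partial>M) \<le> (\<integral>x. A (h x) \<bullet> cgrad \<phi> x \<partial>M)"
    using supersolutionE[OF w lam] by blast
  note u' = solvesD[OF u]
  show ?thesis
  proof (rule comparison_principle[OF u'(1) h(1-4)])
    fix \<phi> assume \<phi>: "nonneg_test \<Omega> \<phi>"
    then have t: "test_fun \<Omega> \<phi>" by blast
    note s\<phi> = test_fun_sqint[OF t]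
    have "(\<integral>x. (A (g x) - A (h x)) \<bullet> cgrad \<phi> x \<partial>M) = (\<integral>x. A (g x) \<bullet> cgrad \<phi> x \<partial>M) - (\<integral>x. A (h x) \<bullet> cgrad \<phi> x \<partial>M)"
      unfolding inner_diff_left
      by (intro Bochner_Integration.integral_diff sqint_inner_integrable A_sqint u'(3) h(2) s\<phi>(2))
    also have "\<dots> \<le> (\<integral>x. f x * \<phi> x \<partial>M) - lam * (\<integral>x. exp (w x) * \<phi> x \<partial>M)"
      using u'(5)[OF t] h(6)[OF \<phi>] by simp
    also have "\<dots> \<le> 0"
    proof -
      have "(\<integral>x. f x * \<phi> x \<partial>M) \<le> (\<integral>x. lam * (exp (w x) * \<phi> x) \<partial>M)"
      proof (rule integral_mono_AE)
        show "AE x in M. f x * \<phi> x \<le> lam * (exp (w x) * \<phi> x)"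
          using le by eventually_elim (use \<phi> in \<open>simp add: mult_right_mono flip: mult.assoc\<close>)
      qed (use sqint_mult_integrable[OF f s\<phi>(1)] h(5)[OF \<phi>] in auto)
      then show ?thesis by simp
    qed
    finally show "(\<integral>x. (A (g x) - A (h x)) \<bullet> cgrad \<phi> x \<partial>M) \<le> 0" .
  qed
qed

lemma solves_nonneg:
  assumes u: "solves f u g" and f: "sqint M f" "AE x in M. 0 \<le> f x"
  shows "AE x in M. 0 \<le> u x"
proof (rule supersolution_nonneg[OF solvesD(3)[OF u]])
  show "H0c (nonneg_test \<Omega>) \<Omega> (\<lambda>x. max 0 (- u x)) (\<lambda>x. if u x < 0 then - g x else 0)"
    using H0_pos_part[OF H0_uminus[OF solvesD(1)[OF u]]] by simp
  fix \<phi> assume \<phi>: "nonneg_test \<Omega> \<phi>"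
  have "0 \<le> (\<integral>x. f x * \<phi> x \<partial>M)"
  proof (rule integral_nonneg_AE)
    show "AE x in M. 0 \<le> f x * \<phi> x" using f(2) by eventually_elim (use \<phi> in simp)
  qed
  then show "0 \<le> (\<integral>x. A (g x) \<bullet> cgrad \<phi> x \<partial>M)" using solvesD(5)[OF u] \<phi> by simp
qed

lemma solves_mono:
  assumes u: "solves f u g" and v: "solves f' v h" and f: "sqint M f" "sqint M f'"
    and le: "AE x in M. f x \<le> f' x" and v0: "AE x in M. 0 \<le> v x"
  shows "AE x in M. u x \<le> v x"
proof -
  note u' = solvesD[OF u] and v' = solvesD[OF v]
  show ?thesis
  proof (rule comparison_principle[OF u'(1) v'(2,3) H0_weak_gradient[OF v'(1)] v0])
    fix \<phi> assume \<phi>: "nonneg_test \<Omega> \<phi>"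
    then have t: "test_fun \<Omega> \<phi>" by blast
    note s\<phi> = test_fun_sqint[OF t]
    have "(\<integral>x. (A (g x) - A (h x)) \<bullet> cgrad \<phi> x \<partial>M) = (\<integral>x. A (g x) \<bullet> cgrad \<phi> x \<partial>M) - (\<integral>x. A (h x) \<bullet> cgrad \<phi> x \<partial>M)"
      unfolding inner_diff_left
      by (intro Bochner_Integration.integral_diff sqint_inner_integrable u'(4) v'(4) s\<phi>(2))
    also have "\<dots> = (\<integral>x. f x * \<phi> x \<partial>M) - (\<integral>x. f' x * \<phi> x \<partial>M)" using u'(5)[OF t] v'(5)[OF t] by simp
    also have "\<dots> \<le> 0"
    proof -
      have "(\<integral>x. f x * \<phi> x \<partial>M) \<le> (\<integral>x. f' x * \<phi> x \<partial>M)"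
      proof (rule integral_mono_AE)
        show "AE x in M. f x * \<phi> x \<le> f' x * \<phi> x" using le by eventually_elim (use \<phi> in \<open>simp add: mult_right_mono\<close>)
      qed (intro sqint_mult_integrable f s\<phi>(1))+
      then show ?thesis by simp
    qed
    finally show "(\<integral>x. (A (g x) - A (h x)) \<bullet> cgrad \<phi> x \<partial>M) \<le> 0" .
  qed
qed

text \<open>The difference of the equations is tested with the difference of the solutions; strong
  monotonicity and Poincare do the rest. A constant independent of the data allows the right-hand
  sides of the iteration to converge without any control of the gradients.\<close>

lemma solves_stable:
  obtains C where "C > 0" "\<And>f f' u g v h. sqint M f \<Longrightarrow> sqint M f' \<Longrightarrow> solves f u g \<Longrightarrow> solves f' v h \<Longrightarrow>
     (\<integral>x. (norm (u x - v x))\<^sup>2 \<partial>M) \<le> C * (\<integral>x. (norm (f x - f' x))\<^sup>2 \<partial>M)"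
proof -
  obtain P where P: "P > 0" "\<And>u g. H0 \<Omega> u g \<Longrightarrow> (\<integral>x. (norm (u x))\<^sup>2 \<partial>M) \<le> P * (\<integral>x. (norm (g x))\<^sup>2 \<partial>M)"
    using poincare by blast
  \<comment> \<open>Chosen so that Young's inequality returns half of \<open>ell * D\<close>, which
    is absorbed on the left.\<close>
  define t where "t = P / ell"
  have t: "t > 0" using P ell_pos by (simp add: t_def)
  have "(\<integral>x. (norm (u x - v x))\<^sup>2 \<partial>M) \<le> (P * (t / ell)) * (\<integral>x. (norm (f x - f' x))\<^sup>2 \<partial>M)"
    if f: "sqint M f" "sqint M f'" and u: "solves f u g" and v: "solves f' v h" for f f' u g v h
  proof -
    note u' = solvesD[OF u] and v' = solvesD[OF v]
    have H: "H0 \<Omega> (\<lambda>x. u x - v x) (\<lambda>x. g x - h x)" by (rule H0_diff[OF u'(1) v'(1)])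
    define D where "D = (\<integral>x. (norm (g x - h x))\<^sup>2 \<partial>M)"
    define N where "N = (\<integral>x. (norm (f x - f' x))\<^sup>2 \<partial>M)"
    have sV: "sqint M (\<lambda>x. A (g x) - A (h x))" by (intro sqint_diff u'(4) v'(4))
    have sf: "sqint M (\<lambda>x. f x - f' x)" by (intro sqint_diff f)
    have sd: "sqint M (\<lambda>x. g x - h x)" by (intro sqint_diff u'(3) v'(3))
    have su: "sqint M (\<lambda>x. u x - v x)" by (intro sqint_diff u'(2) v'(2))
    have "ell * D = (\<integral>x. ell * (norm (g x - h x))\<^sup>2 \<partial>M)" by (simp add: D_def)
    also have "\<dots> \<le> (\<integral>x. (A (g x) - A (h x)) \<bullet> (g x - h x) \<partial>M)"
      by (rule integral_mono) (use sqint_integrable[OF sd] sqint_inner_integrable[OF sV sd] A_strongly_monotone in auto)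
    also have "\<dots> = (\<integral>x. (f x - f' x) * (u x - v x) \<partial>M)"
    proof (rule H0_test_eq[OF sV sf _ H])
      fix \<phi> assume t: "test_fun \<Omega> \<phi>"
      note s\<phi> = test_fun_sqint[OF t]
      have "(\<integral>x. (A (g x) - A (h x)) \<bullet> cgrad \<phi> x \<partial>M) = (\<integral>x. A (g x) \<bullet> cgrad \<phi> x \<partial>M) - (\<integral>x. A (h x) \<bullet> cgrad \<phi> x \<partial>M)"
        unfolding inner_diff_left
        by (intro Bochner_Integration.integral_diff sqint_inner_integrable u'(4) v'(4) s\<phi>(2))
      also have "\<dots> = (\<integral>x. f x * \<phi> x \<partial>M) - (\<integral>x. f' x * \<phi> x \<partial>M)" using u'(5)[OF t] v'(5)[OF t] by simp
      also have "\<dots> = (\<integral>x. (f x - f' x) * \<phi> x \<partial>M)"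
        unfolding left_diff_distrib
        by (intro Bochner_Integration.integral_diff[symmetric] sqint_mult_integrable f s\<phi>(1))
      finally show "(\<integral>x. (A (g x) - A (h x)) \<bullet> cgrad \<phi> x \<partial>M) = (\<integral>x. (f x - f' x) * \<phi> x \<partial>M)" .
    qed
    also have "\<dots> \<le> t / 2 * N + 1 / (2 * t) * (\<integral>x. (norm (u x - v x))\<^sup>2 \<partial>M)"
      unfolding N_def using sqint_inner_young[OF sf su t] by simp
    also have "\<dots> \<le> t / 2 * N + 1 / (2 * t) * (P * D)"
      unfolding D_def using P(2)[OF H] t by (intro add_mono mult_left_mono) auto
    also have "1 / (2 * t) * (P * D) = ell / 2 * D" using P ell_pos by (simp add: t_def)
    finally have "ell * D \<le> t * N" by simp
    then have "D \<le> t / ell * N" using ell_pos by (simp add: field_simps)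
    then have "P * D \<le> P * (t / ell * N)" using P by (intro mult_left_mono) auto
    then show ?thesis using P(2)[OF H] unfolding D_def N_def by (simp add: mult.assoc)
  qed
  moreover have "P * (t / ell) > 0" using P t ell_pos by simp
  ultimately show thesis using that by blast
qed

end

section \<open>Truncation of the singular solution\<close>

lemma q_denominator_pos: "0 < \<theta> \<Longrightarrow> \<theta> < 1 \<Longrightarrow> 0 < 1 - \<theta> + \<theta> * exp (- s :: real)"
  by (simp add: add_pos_pos)

text \<open>\<open>trunc \<theta>\<close> is the solution of \<open>\<Phi>' s * exp s = \<theta> * exp (\<Phi> s)\<close> with \<open>\<Phi> 0 = 0\<close>; it is concave and bounded
  above, and composing with it turns a solution for \<open>\<lambda>\<close> into a supersolution for \<open>\<theta> * \<lambda>\<close>.\<close>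
definition trunc :: "real \<Rightarrow> real \<Rightarrow> real" where
  "trunc \<theta> s = - ln (1 - \<theta> + \<theta> * exp (- s))"

definition trunc' :: "real \<Rightarrow> real \<Rightarrow> real" where
  "trunc' \<theta> s = \<theta> * exp (- s) / (1 - \<theta> + \<theta> * exp (- s))"

context
  fixes \<theta> :: real assumes \<theta>: "0 < \<theta>" "\<theta> < 1"
begin

lemma trunc_deriv: "(trunc \<theta> has_real_derivative trunc' \<theta> s) (at s)"
  unfolding trunc_def[abs_def] trunc'_def
  using q_denominator_pos[OF \<theta>, of s] by (auto intro!: derivative_eq_intros)

lemma trunc'_deriv: "(trunc' \<theta> has_real_derivative (trunc' \<theta> s * trunc' \<theta> s + (-1) * trunc' \<theta> s)) (at s)"
proof -
  define E where "E = exp (- s)"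
  define c where "c = 1 - \<theta> + \<theta> * E"
  have c: "c > 0" unfolding c_def E_def by (rule q_denominator_pos[OF \<theta>])
  have "(trunc' \<theta> has_real_derivative (((- (\<theta> * E)) * c - (\<theta> * E) * (- (\<theta> * E))) / (c * c))) (at s)"
    unfolding trunc'_def[abs_def] E_def c_def
    using c[unfolded c_def E_def] by (auto intro!: derivative_eq_intros)
  moreover have "((- (\<theta> * E)) * c - (\<theta> * E) * (- (\<theta> * E))) / (c * c) = trunc' \<theta> s * trunc' \<theta> s + (-1) * trunc' \<theta> s"
  proof -
    have t: "trunc' \<theta> s = \<theta> * E / c" by (simp add: trunc'_def E_def c_def)
    show ?thesis unfolding t using c by (simp add: field_simps)
  qed
  ultimately show ?thesis by simp
qed

lemma trunc'_bounds: "0 < trunc' \<theta> s" "trunc' \<theta> s < 1"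
  unfolding trunc'_def using q_denominator_pos[OF \<theta>, of s] \<theta> by auto

text \<open>Polynomials in \<open>trunc' \<theta>\<close>. They are closed under differentiation
  because this logistic function q satisfies q' = q^2 - q.\<close>

inductive trunc_alg :: "(real \<Rightarrow> real) \<Rightarrow> bool" where
  base: "trunc_alg (trunc' \<theta>)"
| const: "trunc_alg (\<lambda>s. c)"
| add: "trunc_alg f \<Longrightarrow> trunc_alg g \<Longrightarrow> trunc_alg (\<lambda>s. f s + g s)"
| mult: "trunc_alg f \<Longrightarrow> trunc_alg g \<Longrightarrow> trunc_alg (\<lambda>s. f s * g s)"

lemma trunc_alg_deriv: "trunc_alg f \<Longrightarrow> \<exists>f'. trunc_alg f' \<and> (\<forall>s. (f has_real_derivative f' s) (at s))"
proof (induction rule: trunc_alg.induct)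
  case base
  have "trunc_alg (\<lambda>s. trunc' \<theta> s * trunc' \<theta> s + (-1) * trunc' \<theta> s)" by (intro trunc_alg.intros)
  then show ?case using trunc'_deriv by blast
next
  case (const c)
  show ?case by (intro exI[of _ "\<lambda>s. 0"] conjI allI trunc_alg.const DERIV_const)
next
  case (add f g)
  then show ?case by (blast intro: trunc_alg.add DERIV_add)
next
  case (mult f g)
  then obtain f' g' where "trunc_alg f'" "\<forall>s. (f has_real_derivative f' s) (at s)"
    "trunc_alg g'" "\<forall>s. (g has_real_derivative g' s) (at s)" by blast
  with mult have "trunc_alg (\<lambda>s. f' s * g s + g' s * f s)" "\<forall>s. ((\<lambda>s. f s * g s) has_real_derivative f' s * g s + g' s * f s) (at s)"
    by (auto intro: trunc_alg.add trunc_alg.mult DERIV_mult)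
  then show ?case by blast
qed

lemma smooth_trunc': "smooth_on UNIV (trunc' \<theta>)"
  by (rule smooth_realI[where P = trunc_alg]) (auto intro: trunc_alg.base trunc_alg_deriv)

lemma smooth_trunc: "smooth_on UNIV (trunc \<theta>)"
proof (rule smooth_realI[where P = "\<lambda>f. f = trunc \<theta> \<or> trunc_alg f"])
  show "\<exists>\<Psi>. (\<Psi> = trunc \<theta> \<or> trunc_alg \<Psi>) \<and> (\<forall>x. (\<Phi> has_real_derivative \<Psi> x) (at x))"
    if "\<Phi> = trunc \<theta> \<or> trunc_alg \<Phi>" for \<Phi>
    using that trunc_deriv trunc_alg.base trunc_alg_deriv by blast
qed simp

lemma deriv_trunc: "deriv (trunc \<theta>) s = trunc' \<theta> s"
  by (rule DERIV_imp_deriv[OF trunc_deriv])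

lemma deriv_trunc': "deriv (trunc' \<theta>) s = trunc' \<theta> s * (trunc' \<theta> s - 1)"
  using DERIV_imp_deriv[OF trunc'_deriv] by (simp add: algebra_simps)

lemma deriv_trunc'_bounds: "deriv (trunc' \<theta>) s \<le> 0" "\<bar>deriv (trunc' \<theta>) s\<bar> \<le> 1"
proof -
  note b = trunc'_bounds[of s]
  show "deriv (trunc' \<theta>) s \<le> 0" unfolding deriv_trunc' using b by (intro mult_nonneg_nonpos) auto
  have "\<bar>trunc' \<theta> s\<bar> * \<bar>trunc' \<theta> s - 1\<bar> \<le> 1 * 1" using b by (intro mult_mono) auto
  then show "\<bar>deriv (trunc' \<theta>) s\<bar> \<le> 1" by (simp add: deriv_trunc' abs_mult)
qed

lemma trunc_0: "trunc \<theta> 0 = 0" by (simp add: trunc_def)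

lemma trunc_upper: "trunc \<theta> s \<le> - ln (1 - \<theta>)"
  unfolding trunc_def using \<theta> by (auto intro!: ln_mono simp: add_pos_pos)

lemma exp_trunc: "exp s * trunc' \<theta> s = \<theta> * exp (trunc \<theta> s)"
proof -
  have c: "1 - \<theta> + \<theta> * exp (- s) > 0" by (rule q_denominator_pos[OF \<theta>])
  have "exp (trunc \<theta> s) = 1 / (1 - \<theta> + \<theta> * exp (- s))"
    using c by (simp add: trunc_def exp_minus inverse_eq_divide)
  moreover have "exp s * exp (- s) = 1" by (simp flip: exp_add)
  then have "exp s * (\<theta> * exp (- s)) = \<theta>" by (simp add: mult.left_commute)
  ultimately show ?thesis by (simp add: trunc'_def)
qed

end

context anisotropic_domain
begin

lemma weak_solutionE:
  assumes "weak_solution F \<Omega> lam u"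
  obtains g where "H0 \<Omega> u g"
    "\<And>\<phi>. test_fun \<Omega> \<phi> \<Longrightarrow> integrable M (\<lambda>x. exp (u x) * \<phi> x)"
    "\<And>\<phi>. test_fun \<Omega> \<phi> \<Longrightarrow> (\<integral>x. A (g x) \<bullet> cgrad \<phi> x \<partial>M) = lam * (\<integral>x. exp (u x) * \<phi> x \<partial>M)"
proof -
  from assms obtain k g where "H0 \<Omega> u k" "weak_gradient \<Omega> u g"
    "\<And>\<phi>. test_fun \<Omega> \<phi> \<Longrightarrow> integrable M (\<lambda>x. exp (u x) * \<phi> x)"
    "\<And>\<phi>. test_fun \<Omega> \<phi> \<Longrightarrow> (\<integral>x. A (g x) \<bullet> cgrad \<phi> x \<partial>M) = lam * (\<integral>x. exp (u x) * \<phi> x \<partial>M)"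
    unfolding weak_solution_def W012_M set_integrable_M set_integral_M flux_term_A by blast
  then show thesis using that H0_unique_gradient by blast
qed

text \<open>Formally the equation for \<open>u0\<close> is tested with \<psi> q(u0), where q is the
  derivative of the truncation. The gradient has two terms. The one with q' contributes a
  nonpositive integrand, as q decreases and the flux is coercive; in the other, homogeneity turns q
  times the flux into the flux of the truncated function. The differential equation of the
  truncation converts the right-hand side.\<close>

proposition trunc_supersolution:
  assumes u0: "weak_solution F \<Omega> lam_t u0" and lam: "0 < lam" "lam < lam_t"
  defines "\<theta> \<equiv> lam / lam_t"
  shows "supersolution F \<Omega> lam (\<lambda>x. trunc \<theta> (u0 x))"
proof -
  have \<theta>: "0 < \<theta>" "\<theta> < 1" using lam by (auto simp: \<theta>_def)
  let ?q = "trunc' \<theta>" and ?v = "\<lambda>x. trunc \<theta> (u0 x)"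
  note q = trunc'_bounds[OF \<theta>]
  obtain g where g: "H0 \<Omega> u0 g"
    "\<And>\<phi>. test_fun \<Omega> \<phi> \<Longrightarrow> integrable M (\<lambda>x. exp (u0 x) * \<phi> x)"
    "\<And>\<phi>. test_fun \<Omega> \<phi> \<Longrightarrow> (\<integral>x. A (g x) \<bullet> cgrad \<phi> x \<partial>M) = lam_t * (\<integral>x. exp (u0 x) * \<phi> x \<partial>M)"
    using weak_solutionE[OF u0] by blast
  note su = H0c_sqint(1)[OF g(1)] and sg = H0c_sqint(2)[OF g(1)]
  note [measurable] = sqint_measurable[OF su] sqint_measurable[OF sg]
  let ?g = "\<lambda>x. ?q (u0 x) *\<^sub>R g x"
  have Hv: "H0 \<Omega> ?v ?g"
    unfolding deriv_trunc[OF \<theta>, symmetric]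
  proof (rule H0_chain[OF g(1) smooth_trunc[OF \<theta>] trunc_0[OF \<theta>]])
    show "\<bar>deriv (trunc \<theta>) s\<bar> \<le> 1" for s using q[of s] by (simp add: deriv_trunc[OF \<theta>])
    show "test_fun \<Omega> (\<lambda>x. trunc \<theta> (\<phi> x))" if "test_fun \<Omega> \<phi>" for \<phi>
      by (rule test_fun_compose[OF that smooth_trunc[OF \<theta>] trunc_0[OF \<theta>]])
  qed
  note sv = H0c_sqint(1)[OF Hv] and sgv = H0c_sqint(2)[OF Hv]
  have "H0 \<Omega> (\<lambda>x. - max 0 (- ?v x)) (\<lambda>x. - (if 0 < - ?v x then - ?g x else 0))"
    by (rule H0_uminus[OF H0c_mono[OF H0_pos_part[OF H0_uminus[OF Hv]]]]) blast
  moreover have "(\<lambda>x. - max 0 (- ?v x)) = (\<lambda>x. min (?v x) 0)" by (auto simp: max_def min_def)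
  ultimately have min: "W012 \<Omega> (\<lambda>x. min (?v x) 0)" unfolding W012_M by metis
  have main: "set_integrable lebesgue \<Omega> (\<lambda>x. flux_term F (?g x) (cgrad \<psi> x)) \<and>
      set_integrable lebesgue \<Omega> (\<lambda>x. exp (?v x) * \<psi> x) \<and>
      lam * (LINT x:\<Omega>|lebesgue. exp (?v x) * \<psi> x) \<le> (LINT x:\<Omega>|lebesgue. flux_term F (?g x) (cgrad \<psi> x))"
    if \<psi>: "test_fun \<Omega> \<psi> \<and> (\<forall>x. 0 \<le> \<psi> x)" for \<psi>
    unfolding set_integrable_M set_integral_M flux_term_A
  proof (intro conjI)
    have t: "test_fun \<Omega> \<psi>" and \<psi>0: "\<And>x. 0 \<le> \<psi> x" using \<psi> by auto
    note s\<psi> = test_fun_sqint[OF t]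
    note [measurable] = sqint_measurable[OF s\<psi>(1)] sqint_measurable[OF s\<psi>(2)]
    obtain C where C: "C > 0" "\<And>x. \<bar>\<psi> x\<bar> \<le> C" "\<And>x. norm (cgrad \<psi> x) \<le> C" using test_fun_bounded[OF t] by metis
    show iA: "integrable M (\<lambda>x. A (?g x) \<bullet> cgrad \<psi> x)"
      by (intro sqint_inner_integrable A_sqint sgv s\<psi>(2))
    have "sqint M (\<lambda>x. exp (?v x))"
    proof (rule sqint_finite_bounded[OF finite_M, where C = "exp (- ln (1 - \<theta>))"])
      show "(\<lambda>x. exp (?v x)) \<in> borel_measurable M" using sqint_measurable[OF sv] by measurable
      show "AE x in M. norm (exp (?v x)) \<le> exp (- ln (1 - \<theta>))" using trunc_upper[OF \<theta>] by auto
    qed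
    then show "integrable M (\<lambda>x. exp (?v x) * \<psi> x)" by (rule sqint_mult_integrable[OF _ s\<psi>(1)])
    obtain \<phi> where \<phi>: "\<And>k. test_fun \<Omega> (\<phi> k)" "L2_lim M (\<lambda>k x. (\<phi> k x, cgrad (\<phi> k) x)) (\<lambda>x. (u0 x, g x))"
      using g(1) unfolding H0c_def by blast
    \<comment> \<open>The gradient of \<psi> q(u) as a function of the point and the pair (u, grad
      u). It has linear growth since \<psi> and its gradient are bounded by C and both q and q' by 1
      in absolute value.\<close>
    define B where "B x p = \<psi> x *\<^sub>R (deriv ?q (fst p) *\<^sub>R snd p) + ?q (fst p) *\<^sub>R cgrad \<psi> x" for x and p :: "real \<times> 'a"
    have cq: "isCont ?q s" "isCont (deriv ?q) s" for s
      by (intro smooth_isCont smooth_trunc'[OF \<theta>] smooth_real_deriv(2))+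
    have bq: "?q \<in> borel_measurable borel" "deriv ?q \<in> borel_measurable borel"
      using cq by (auto intro!: borel_measurable_continuous_onI simp: continuous_on_eq_continuous_at)
    obtain r :: "nat \<Rightarrow> nat" where r: "strict_mono r" "AE x in M. (\<lambda>n. (\<phi> (r n) x, cgrad (\<phi> (r n)) x)) \<longlonglongrightarrow> (u0 x, g x)"
      "L2_lim M (\<lambda>n x. B x (\<phi> (r n) x, cgrad (\<phi> (r n)) x)) (\<lambda>x. B x (u0 x, g x))"
    proof (rule L2_lim_superposition[OF \<phi>(2) finite_M, of B "2 * C\<^sup>2"])
      fix h :: "'a \<Rightarrow> real \<times> 'a" assume h: "h \<in> borel_measurable M"
      have m: "(\<lambda>x. fst (h x)) \<in> borel_measurable M" "(\<lambda>x. snd (h x)) \<in> borel_measurable M"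
        using measurable_compose[OF h borel_measurable_continuous_onI[OF continuous_on_fst[OF continuous_on_id]]]
          measurable_compose[OF h borel_measurable_continuous_onI[OF continuous_on_snd[OF continuous_on_id]]] by auto
      note [measurable] = m measurable_compose[OF m(1) bq(1)] measurable_compose[OF m(1) bq(2)]
      show "(\<lambda>x. B x (h x)) \<in> borel_measurable M" unfolding B_def by measurable
    next
      show "isCont (B x) p" for x p
        unfolding B_def[abs_def] by (intro continuous_intros isCont_o2[OF _ cq(1)] isCont_o2[OF _ cq(2)])
      show "(norm (B x p))\<^sup>2 \<le> 2 * C\<^sup>2 * ((norm p)\<^sup>2 + 1)" for x p
      proof -
        have "norm (\<psi> x *\<^sub>R (deriv ?q (fst p) *\<^sub>R snd p)) \<le> C * norm (snd p)"
        proof -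
          have "\<bar>\<psi> x\<bar> * \<bar>deriv ?q (fst p)\<bar> \<le> C * 1" using C deriv_trunc'_bounds[OF \<theta>] by (intro mult_mono) auto
          from mult_right_mono[OF this norm_ge_zero[of "snd p"]] show ?thesis by (simp add: abs_mult mult.assoc)
        qed
        also have "\<dots> \<le> C * norm p" using C norm_snd_le[of "snd p" "fst p"] by (intro mult_left_mono) auto
        finally have 1: "(norm (\<psi> x *\<^sub>R (deriv ?q (fst p) *\<^sub>R snd p)))\<^sup>2 \<le> (C * norm p)\<^sup>2" by (intro power_mono) auto
        have "norm (?q (fst p) *\<^sub>R cgrad \<psi> x) \<le> 1 * C"
          unfolding norm_scaleR using q[of "fst p"] C by (intro mult_mono) auto
        then have 2: "(norm (?q (fst p) *\<^sub>R cgrad \<psi> x))\<^sup>2 \<le> C\<^sup>2" by (intro power_mono) auto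
        have "(norm (B x p))\<^sup>2 \<le> 2 * (norm (\<psi> x *\<^sub>R (deriv ?q (fst p) *\<^sub>R snd p)))\<^sup>2 + 2 * (norm (?q (fst p) *\<^sub>R cgrad \<psi> x))\<^sup>2"
          unfolding B_def by (rule norm_add_power2_le)
        also have "\<dots> \<le> 2 * (C * norm p)\<^sup>2 + 2 * C\<^sup>2" using 1 2 by simp
        finally show ?thesis by (simp add: power_mult_distrib algebra_simps)
      qed
    qed (rule that)
    \<comment> \<open>An honest test function: q is evaluated at the approximants of
      \<open>u0\<close>, and \<psi> supplies the compact support, since q does not vanish at
      0.\<close>
    define \<eta> where "\<eta> n x = \<psi> x * ?q (\<phi> (r n) x)" for n x
    have \<eta>: "test_fun \<Omega> (\<eta> n)" for n
      unfolding \<eta>_def[abs_def] by (rule test_fun_mult[OF t smooth_compose[OF smooth_trunc'[OF \<theta>] test_funD(1)[OF \<phi>(1)]]])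
    have c\<eta>: "cgrad (\<eta> n) x = B x (\<phi> (r n) x, cgrad (\<phi> (r n)) x)" for n x
      unfolding \<eta>_def[abs_def] B_def fst_conv snd_conv
      by (subst cgrad_mult[OF test_funD(4)[OF t] smooth_onD(1)[OF smooth_compose[OF smooth_trunc'[OF \<theta>] test_funD(1)[OF \<phi>(1)]]]])
        (simp only: cgrad_compose[OF smooth_real_deriv(1)[OF smooth_trunc'[OF \<theta>]] test_funD(4)[OF \<phi>(1)]])
    have l1: "(\<lambda>n. \<integral>x. A (g x) \<bullet> cgrad (\<eta> n) x \<partial>M) \<longlonglongrightarrow> (\<integral>x. A (g x) \<bullet> B x (u0 x, g x) \<partial>M)"
      unfolding c\<eta> by (rule L2_lim_inner_right[OF r(3) A_sqint[OF sg]])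
    \<comment> \<open>No growth control of \<open>u0\<close> is available here, but 0 < q < 1 makes
      \<open>exp (u0 x) * \<psi> x\<close> a majorant, and it is integrable as part of the notion of
      solution.\<close>
    have l2: "(\<lambda>n. \<integral>x. exp (u0 x) * \<eta> n x \<partial>M) \<longlonglongrightarrow> (\<integral>x. exp (u0 x) * (\<psi> x * ?q (u0 x)) \<partial>M)"
    proof (rule integral_dominated_convergence[where w = "\<lambda>x. exp (u0 x) * \<psi> x"])
      show "integrable M (\<lambda>x. exp (u0 x) * \<psi> x)" by (rule g(2)[OF t])
      show "(\<lambda>x. exp (u0 x) * \<eta> n x) \<in> borel_measurable M" for n using g(2)[OF \<eta>[of n]] by auto
      have [measurable]: "(\<lambda>x. ?q (u0 x)) \<in> borel_measurable M" by (rule measurable_compose[OF _ bq(1)]) measurable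
      show "(\<lambda>x. exp (u0 x) * (\<psi> x * ?q (u0 x))) \<in> borel_measurable M" by measurable
      show "AE x in M. (\<lambda>n. exp (u0 x) * \<eta> n x) \<longlonglongrightarrow> exp (u0 x) * (\<psi> x * ?q (u0 x))"
        using r(2)
      proof eventually_elim
        case (elim x)
        have "(\<lambda>n. \<phi> (r n) x) \<longlonglongrightarrow> u0 x" using tendsto_fst[OF elim] by simp
        then have "(\<lambda>n. ?q (\<phi> (r n) x)) \<longlonglongrightarrow> ?q (u0 x)" by (rule isCont_tendsto_compose[OF cq(1)])
        then show ?case unfolding \<eta>_def by (intro tendsto_mult_left)
      qed
      show "AE x in M. norm (exp (u0 x) * \<eta> n x) \<le> exp (u0 x) * \<psi> x" for n
      proof (rule AE_I2)
        fix x
        have "\<psi> x * ?q (\<phi> (r n) x) \<le> \<psi> x" using \<psi>0[of x] q[of "\<phi> (r n) x"] by (intro mult_left_le) auto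
        then show "norm (exp (u0 x) * \<eta> n x) \<le> exp (u0 x) * \<psi> x"
          using \<psi>0[of x] q[of "\<phi> (r n) x"] by (simp add: \<eta>_def abs_mult)
      qed
    qed
    have "(\<lambda>n. \<integral>x. A (g x) \<bullet> cgrad (\<eta> n) x \<partial>M) \<longlonglongrightarrow> lam_t * (\<integral>x. exp (u0 x) * (\<psi> x * ?q (u0 x)) \<partial>M)"
      unfolding g(3)[OF \<eta>] by (rule tendsto_mult_left[OF l2])
    with l1 have eq: "(\<integral>x. A (g x) \<bullet> B x (u0 x, g x) \<partial>M) = lam_t * (\<integral>x. exp (u0 x) * (\<psi> x * ?q (u0 x)) \<partial>M)"
      by (rule LIMSEQ_unique)
    have pt: "lam_t * (exp (u0 x) * (\<psi> x * ?q (u0 x))) = lam * (exp (?v x) * \<psi> x)" for x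
    proof -
      have "lam_t * (exp (u0 x) * (\<psi> x * ?q (u0 x))) = lam_t * (exp (u0 x) * ?q (u0 x)) * \<psi> x" by simp
      also have "\<dots> = lam * exp (?v x) * \<psi> x" unfolding exp_trunc[OF \<theta>] using lam by (simp add: \<theta>_def)
      finally show ?thesis by simp
    qed
    have "lam * (\<integral>x. exp (?v x) * \<psi> x \<partial>M) = (\<integral>x. lam_t * (exp (u0 x) * (\<psi> x * ?q (u0 x))) \<partial>M)"
      unfolding pt by simp
    also have "\<dots> = (\<integral>x. A (g x) \<bullet> B x (u0 x, g x) \<partial>M)" using eq by simp
    also have "\<dots> \<le> (\<integral>x. A (?g x) \<bullet> cgrad \<psi> x \<partial>M)"
    proof (rule integral_mono[OF _ iA])
      show "integrable M (\<lambda>x. A (g x) \<bullet> B x (u0 x, g x))"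
        by (rule sqint_inner_integrable[OF A_sqint[OF sg] L2_lim_sqint(2)[OF r(3)]])
      fix x
      have "A (?g x) = ?q (u0 x) *\<^sub>R A (g x)" by (rule A_scale) (rule q)
      moreover have "A (g x) \<bullet> (\<psi> x *\<^sub>R (deriv ?q (u0 x) *\<^sub>R g x)) \<le> 0"
      proof -
        have "0 \<le> A (g x) \<bullet> g x" using A_coercive[of "g x"] ell_pos by (smt (verit) mult_nonneg_nonneg zero_le_power2)
        then have "deriv ?q (u0 x) * (A (g x) \<bullet> g x) \<le> 0"
          using deriv_trunc'_bounds(1)[OF \<theta>, of "u0 x"] by (simp add: mult_nonpos_nonneg)
        then show ?thesis using mult_nonneg_nonpos[OF \<psi>0[of x]] by (simp add: mult.assoc)
      qed
      ultimately show "A (g x) \<bullet> B x (u0 x, g x) \<le> A (?g x) \<bullet> cgrad \<psi> x"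
        by (simp add: B_def inner_add_right)
    qed
    finally show "lam * (\<integral>x. exp (?v x) * \<psi> x \<partial>M) \<le> (\<integral>x. A (?g x) \<bullet> cgrad \<psi> x \<partial>M)" .
  qed
  show ?thesis
    unfolding supersolution_def
    using sv sgv H0_weak_gradient[OF Hv] min main unfolding W12_M by blast
qed

section \<open>Monotone iteration\<close>

text \<open>A single supersolution bounded above suffices: it bounds all iterates, which are
  nonnegative, so every right-hand side is bounded. All other supersolutions serve only for
  minimality.\<close>

proposition minimal_solution_below_supersolution:
  assumes lam: "0 < lam" and v: "supersolution F \<Omega> lam v" and vK: "AE x in M. v x \<le> K"
  shows "\<exists>u. minimal_solution F \<Omega> lam u \<and> regular_sol \<Omega> u"
proof -
  \<comment> \<open>Only existence is known for the Dirichlet problem, so the iteration fixes an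
    arbitrary solution at each step.\<close>
  define sol where "sol f = (SOME u. \<exists>g. solves f u g)" for f
  have sol: "\<exists>g. solves f (sol f) g" if sf: "sqint M f" for f
  proof -
    obtain u g where "solves f u g" using Dirichlet_solvable[OF sf] by blast
    then have "\<exists>u g. solves f u g" by blast
    then show ?thesis unfolding sol_def by (rule someI_ex)
  qed
  define U where "U = rec_nat (\<lambda>x::'a. 0::real) (\<lambda>n u. sol (\<lambda>x. lam * exp (u x)))"
  have U0: "U 0 = (\<lambda>x. 0)" and US: "U (Suc n) = sol (\<lambda>x. lam * exp (U n x))" for n
    by (auto simp: U_def)
  define f where "f n x = lam * exp (U n x)" for n x
  have fs: "sqint M (\<lambda>x. lam * exp (u x))" if "u \<in> borel_measurable M" "AE x in M. u x \<le> K" for u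
  proof (rule sqint_finite_bounded[OF finite_M, where C = "lam * exp K"])
    show "AE x in M. norm (lam * exp (u x)) \<le> lam * exp K" using that(2) by eventually_elim (use lam in simp)
  qed (use that in measurable)
  \<comment> \<open>The invariant ranges over all supersolutions w at once: the instance v yields
    the bound \<open>K\<close> needed to continue, and the general case yields minimality in the
    limit.\<close>
  have inv: "U n \<in> borel_measurable M \<and> (\<forall>w. supersolution F \<Omega> lam w \<longrightarrow> (AE x in M. U n x \<le> w x)) \<and> (AE x in M. 0 \<le> U n x)" for n
  proof (induction n)
    case 0
    have "AE x in M. 0 \<le> w x" if "supersolution F \<Omega> lam w" for w
      using supersolutionE[OF that] lam by (metis less_imp_le)
    then show ?case by (simp add: U0)
  next
    case (Suc n)
    have "AE x in M. U n x \<le> v x" using Suc v by blast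
    with vK have "AE x in M. U n x \<le> K" by eventually_elim simp
    with Suc have sf: "sqint M (\<lambda>x. lam * exp (U n x))" by (intro fs) auto
    then obtain g where g: "solves (\<lambda>x. lam * exp (U n x)) (U (Suc n)) g" using sol US by metis
    have "AE x in M. U (Suc n) x \<le> w x" if w: "supersolution F \<Omega> lam w" for w
    proof (rule solves_le_supersolution[OF g sf _ w])
      have "AE x in M. U n x \<le> w x" using Suc w by blast
      then show "AE x in M. lam * exp (U n x) \<le> lam * exp (w x)" by eventually_elim (use lam in simp)
    qed (use lam in simp)
    moreover have "AE x in M. 0 \<le> U (Suc n) x" by (rule solves_nonneg[OF g sf]) (use lam in auto)
    ultimately show ?case using sqint_measurable[OF solvesD(2)[OF g]] by blast
  qed
  have Um: "U n \<in> borel_measurable M" and Uw: "supersolution F \<Omega> lam w \<Longrightarrow> AE x in M. U n x \<le> w x"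
    and Upos: "AE x in M. 0 \<le> U n x" for n w using inv by blast+
  have UK: "AE x in M. U n x \<le> K" for n using Uw[OF v, of n] vK by eventually_elim simp
  have sf: "sqint M (f n)" for n unfolding f_def[abs_def] by (rule fs[OF Um UK])
  have "\<forall>n. \<exists>g. solves (f n) (U (Suc n)) g" unfolding f_def[abs_def] US using sol sf[unfolded f_def[abs_def]] by blast
  then obtain g where g: "\<And>n. solves (f n) (U (Suc n)) (g n)" by metis
  have Umono: "AE x in M. U n x \<le> U (Suc n) x" for n
  proof (induction n)
    case 0
    show ?case using Upos[of 1] by (simp add: U0)
  next
    case (Suc n)
    show ?case
    proof (rule solves_mono[OF g g sf sf _ Upos])
      show "AE x in M. f n x \<le> f (Suc n) x" using Suc by eventually_elim (use lam in \<open>simp add: f_def\<close>)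
    qed
  qed
  define u where "u x = lim (\<lambda>n. U n x)" for x
  have um: "u \<in> borel_measurable M" unfolding u_def[abs_def] by (intro borel_measurable_lim_metric Um)
  have all: "AE x in M. \<forall>n. U n x \<le> U (Suc n) x \<and> U n x \<le> K \<and> 0 \<le> U n x"
    unfolding AE_all_countable using Umono UK Upos by auto
  have Ulim: "AE x in M. (\<lambda>n. U n x) \<longlonglongrightarrow> u x"
    using all
  proof eventually_elim
    case (elim x)
    then have "incseq (\<lambda>n. U n x)" by (simp add: incseq_Suc_iff)
    then have "convergent (\<lambda>n. U n x)"
      using incseq_convergent[of "\<lambda>n. U n x" K] elim by (metis convergentI)
    then show ?case by (simp add: u_def convergent_LIMSEQ_iff)
  qed
  have u_le: "AE x in M. u x \<le> w x" if w: "supersolution F \<Omega> lam w" for w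
  proof -
    have "AE x in M. \<forall>n. U n x \<le> w x" unfolding AE_all_countable using Uw[OF w] by blast
    with Ulim show ?thesis by eventually_elim (rule LIMSEQ_le_const2, auto)
  qed
  have uK: "AE x in M. 0 \<le> u x \<and> u x \<le> K"
    using Ulim all
  proof eventually_elim
    case (elim x)
    then show ?case by (auto intro: LIMSEQ_le_const LIMSEQ_le_const2)
  qed
  define F0 where "F0 x = lam * exp (u x)" for x
  have sF0: "sqint M F0" unfolding F0_def[abs_def] by (rule fs[OF um]) (use uK in auto)
  have limf: "L2_lim M f F0"
  proof (rule L2_lim_pointwise_dominated[where g = "\<lambda>x. (lam * exp K)\<^sup>2"])
    show "AE x in M. (\<lambda>n. f n x) \<longlonglongrightarrow> F0 x"
      using Ulim by eventually_elim (auto simp: f_def F0_def intro!: tendsto_intros)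
    show "AE x in M. (norm (f n x))\<^sup>2 \<le> (lam * exp K)\<^sup>2" for n
      using UK[of n] by eventually_elim (use lam in \<open>auto simp: f_def intro!: power_mono\<close>)
    show "AE x in M. (norm (F0 x))\<^sup>2 \<le> (lam * exp K)\<^sup>2"
      using uK by eventually_elim (use lam in \<open>auto simp: F0_def intro!: power_mono\<close>)
  qed (use sf sF0 finite_M in \<open>auto simp: sqint_def finite_measure.integrable_const\<close>)
  \<comment> \<open>The pointwise limit u has no gradient yet. The Dirichlet problem is solved
    afresh for the limiting right-hand side, and stability shows that the iterates converge to this
    solution w as well as to u.\<close>
  obtain w h where w: "solves F0 w h" using Dirichlet_solvable[OF sF0] by blast
  note w' = solvesD[OF w]
  obtain C where C: "C > 0" "\<And>f f' u g v h. sqint M f \<Longrightarrow> sqint M f' \<Longrightarrow> solves f u g \<Longrightarrow> solves f' v h \<Longrightarrow>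
     (\<integral>x. (norm (u x - v x))\<^sup>2 \<partial>M) \<le> C * (\<integral>x. (norm (f x - f' x))\<^sup>2 \<partial>M)"
    using solves_stable by blast
  have "L2_lim M (\<lambda>n. U (Suc n)) w"
  proof (rule L2_lim_squeeze)
    show "(\<lambda>n. C * (\<integral>x. (norm (f n x - F0 x))\<^sup>2 \<partial>M)) \<longlonglongrightarrow> 0"
      using tendsto_mult_left[OF L2_lim_tendsto[OF limf], of C] by simp
    show "(\<integral>x. (norm (U (Suc n) x - w x))\<^sup>2 \<partial>M) \<le> C * (\<integral>x. (norm (f n x - F0 x))\<^sup>2 \<partial>M)" for n
      by (rule C(2)[OF sf sF0 g w])
  qed (use solvesD(2)[OF g] w'(2) in auto)
  moreover have "L2_lim M (\<lambda>n. U (Suc n)) u"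
  proof (rule L2_lim_pointwise_dominated[where g = "\<lambda>x. K\<^sup>2"])
    show "AE x in M. (\<lambda>n. U (Suc n) x) \<longlonglongrightarrow> u x" using Ulim by eventually_elim (rule LIMSEQ_Suc)
    show "AE x in M. (norm (U (Suc n) x))\<^sup>2 \<le> K\<^sup>2" for n
      using UK[of "Suc n"] Upos[of "Suc n"] by eventually_elim (auto intro!: power_mono)
    show "AE x in M. (norm (u x))\<^sup>2 \<le> K\<^sup>2" using uK by eventually_elim (auto intro!: power_mono)
  qed (use Um um finite_M in \<open>auto simp: finite_measure.integrable_const\<close>)
  ultimately have wu: "AE x in M. w x = u x" by (rule L2_lim_unique_AE)
  have wm: "w \<in> borel_measurable M" by (rule sqint_measurable[OF w'(2)])
  have wK: "AE x in M. w x \<le> K" using wu uK by eventually_elim simp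
  have expw: "sqint M (\<lambda>x. exp (w x))"
    using sqint_scaleR[OF fs[OF wm wK], of "1 / lam"] lam by simp
  \<comment> \<open>The right-hand side was built from u; almost everywhere equality with w makes
    the equation self-consistent.\<close>
  have eqn: "(\<integral>x. A (h x) \<bullet> cgrad \<phi> x \<partial>M) = lam * (\<integral>x. exp (w x) * \<phi> x \<partial>M)" if t: "test_fun \<Omega> \<phi>" for \<phi>
  proof -
    note m = sqint_measurable[OF test_fun_sqint(1)[OF t]] sqint_measurable[OF sF0]
    have "(\<integral>x. F0 x * \<phi> x \<partial>M) = (\<integral>x. lam * (exp (w x) * \<phi> x) \<partial>M)"
    proof (rule integral_cong_AE)
      show "AE x in M. F0 x * \<phi> x = lam * (exp (w x) * \<phi> x)" using wu by eventually_elim (simp add: F0_def)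
    qed (use m wm in measurable)
    then show ?thesis using w'(5)[OF t] by simp
  qed
  have "weak_solution F \<Omega> lam w"
    unfolding weak_solution_def W012_M set_integrable_M set_integral_M flux_term_A
  proof (intro conjI exI allI impI)
    show "H0 \<Omega> w h" by (rule w'(1))
    show "weak_gradient \<Omega> w h" by (rule H0_weak_gradient[OF w'(1)])
    fix \<phi> assume t: "test_fun \<Omega> \<phi>"
    show "integrable M (\<lambda>x. A (h x) \<bullet> cgrad \<phi> x)" by (intro sqint_inner_integrable w'(4) test_fun_sqint(2)[OF t])
    show "integrable M (\<lambda>x. exp (w x) * \<phi> x)" by (intro sqint_mult_integrable expw test_fun_sqint(1)[OF t])
    show "(\<integral>x. A (h x) \<bullet> cgrad \<phi> x \<partial>M) = lam * (\<integral>x. exp (w x) * \<phi> x \<partial>M)" by (rule eqn[OF t])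
  qed
  moreover have "AE x in M. w x \<le> w1 x" if "supersolution F \<Omega> lam w1" for w1
    using u_le[OF that] wu by eventually_elim simp
  moreover have "AE x in M. exp (w x) \<le> exp K" using wK by eventually_elim simp
  ultimately show ?thesis unfolding minimal_solution_def regular_sol_def AE_M by blast
qed

end

theorem theorem3p1:
  fixes F :: "'a::euclidean_space \<Rightarrow> real" and \<Omega> :: "'a set"
    and a b \<mu> \<Lambda> lam_t :: real and u0 :: "'a \<Rightarrow> real"
  assumes dim: "DIM('a) \<ge> 2"
    and dom: "open \<Omega>" "connected \<Omega>" "bounded \<Omega>" "\<Omega> \<noteq> {}"
    and F_convex: "convex_on UNIV F"
    and F_nonneg: "\<forall>\<xi>. F \<xi> \<ge> 0"
    and F_C2: "C_on 2 (- {0}) F"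
    and F_hom: "\<forall>t \<xi>. F (t *\<^sub>R \<xi>) = \<bar>t\<bar> * F \<xi>"
    and F_pos: "\<forall>\<xi>. \<xi> \<noteq> 0 \<longrightarrow> F \<xi> > 0"
    and ab: "0 < a" "a \<le> b" "\<forall>\<xi>. a * norm \<xi> \<le> F \<xi> \<and> F \<xi> \<le> b * norm \<xi>"
    and mu: "\<mu> > 0"
    and hess: "\<forall>\<xi> V. norm \<xi> = 1 \<and> V \<bullet> \<xi> = 0 \<longrightarrow>
        \<mu>\<^sup>2 * (norm V)\<^sup>2 \<le> (\<Sum>i\<in>Basis. \<Sum>j\<in>Basis. partial j (partial i F) \<xi> * (V \<bullet> i) * (V \<bullet> j)) \<and>
        (\<Sum>i\<in>Basis. \<Sum>j\<in>Basis. partial j (partial i F) \<xi> * (V \<bullet> i) * (V \<bullet> j)) \<le> \<Lambda> * (norm V)\<^sup>2"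
    and lt: "lam_t > 0"
    and u0_sol: "weak_solution F \<Omega> lam_t u0"
    and u0_sing: "singular_sol \<Omega> u0"
  shows "\<forall>lam. 0 < lam \<and> lam < lam_t \<longrightarrow> (\<exists>u. minimal_solution F \<Omega> lam u \<and> regular_sol \<Omega> u)"
proof (intro allI impI)
  fix lam :: real assume lam: "0 < lam \<and> lam < lam_t"
  interpret anisotropic_domain \<Omega> F a b \<mu> \<Lambda>
    by unfold_locales (fact dom F_convex F_nonneg F_C2 F_hom ab mu hess)+
  have "supersolution F \<Omega> lam (\<lambda>x. trunc (lam / lam_t) (u0 x))"
    using trunc_supersolution[OF u0_sol] lam by blast
  \<comment> \<open>The bound is finite precisely because lam lies strictly below
    \<open>lam_t\<close>; at equality the truncation would be the identity.\<close>
  moreover have "AE x in lebesgue_on \<Omega>. trunc (lam / lam_t) (u0 x) \<le> - ln (1 - lam / lam_t)"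
    using trunc_upper[of "lam / lam_t"] lam by simp
  ultimately show "\<exists>u. minimal_solution F \<Omega> lam u \<and> regular_sol \<Omega> u"
    using minimal_solution_below_supersolution lam by blast
qed

end
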